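(* Let $f$ satisfy the codifferentiability conditions of order $p\in[1,+\infty]$, and let either $1<p\le+\infty$, or the set $\Omega$ be bounded and have the segment property. Then the functional $$\mathcal{I}(u)=\int_\Omega f(x,u(x),\nabla u(x))\,dx$$ is correctly defined on $W^{1,p}(\Omega;\mathbb{R}^m)$, it is codifferentiable at every $u\in W^{1,p}(\Omega;\mathbb{R}^m)$, and the pair $D\mathcal{I}(u)=[\underline{d}\mathcal{I}(u),\overline{d}\mathcal{I}(u)]$ is a codifferential of $\mathcal{I}$ at $u$, where \begin{multline*} \underline{d}\mathcal{I}(u)=\Big\{(A,x^* )\in\mathbb{R}\times(W^{1,p}(\Omega;\mathbb{R}^m))^*\Bigm| A=\int_\Omega a(x)\,dx,\ \langle x^*,h\rangle=\int_\Omega\big(\langle v_1(x),h(x)\rangle+\langle v_2(x),\nabla h(x)\rangle\big)dx\\ \forall h\in W^{1,p}(\Omega;\mathbb{R}^m),\ (a(\cdot),v_1(\cdot),v_2(\cdot))\text{ is a measurable selection of the map }\underline{d}_{u,\xi}f(\cdot,u(\cdot),\nabla u(\cdot))\Big\} \end{multline*} and \begin{multline*} \overline{d}\mathcal{I}(u)=\Big\{(B,y^* )\in\mathbb{R}\times(W^{1,p}(\Omega;\mathbb{R}^m))^*\Bigm| B=\int_\Omega b(x)\,dx,\ \langle y^*,h\rangle=\int_\Omega\big(\langle w_1(x),h(x)\rangle+\langle w_2(x),\nabla h(x)\rangle\big)dx\\ \forall h\in W^{1,p}(\Omega;\mathbb{R}^m),\ (b(\cdot),w_1(\cdot),w_2(\cdot))\text{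 is a measurable selection of the map }\overline{d}_{u,\xi}f(\cdot,u(\cdot),\nabla u(\cdot))\Big\}. \end{multline*} Furthermore, the multifunctions $\underline{d}\mathcal{I}(\cdot)$ and $\overline{d}\mathcal{I}(\cdot)$ are Hausdorff continuous on $W^{1,p}(\Omega;\mathbb{R}^m)$ (so that $\mathcal{I}$ is continuously codifferentiable on $W^{1,p}(\Omega;\mathbb{R}^m)$), provided either $1<p\le+\infty$, or the set-valued maps $\underline{d}_{u,\xi}f$ and $\overline{d}_{u,\xi}f$ have the form $$\underline{d}_{u,\xi}f(x,u,\xi)=\operatorname{co}\{(f_i(x,u,\xi),v_{1i},v_{2i})\mid i\in I\},\qquad \overline{d}_{u,\xi}f(x,u,\xi)=\operatorname{co}\{(g_j(x,u,\xi),w_{1j},w_{2j})\mid j\in J\}$$ for some (constant) vectors $v_{1i},w_{1j}\in\mathbb{R}^m$, $v_{2i},w_{2j}\in\mathbb{R}^{m\times d}$ and Carathéodory functions $f_i,g_j:\Omega\times\mathbb{R}^m\times\mathbb{R}^{m\times d}\to\mathbb{R}$, where $i\in I=\{1,\dots,\ell\}$ and $j\in J=\{1,\dots,r\}$.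
   Context: **Codifferentials.** Let $X$ be a real Banach space, $X^*$ its dual. $\mathbb{R}\times X^*$ carries the product topology $\tau_{\mathbb{R}}\times w^*$ ($\tau_{\mathbb{R}}$ standard, $w^*$ weak$^*$) and the norm $\|(a,x^* )\|=\sqrt{|a|^2+\|x^*\|^2}$. Let $U\subseteq X$ be open. A function $F:U\to\mathbb{R}$ is codifferentiable at $x\in U$ if there is a pair $DF(x)=[\underline{d}F(x),\overline{d}F(x)]$ (a codifferential; $\underline{d}F(x)$ is a hypodifferential, $\overline{d}F(x)$ a hyperdifferential) of convex subsets of $\mathbb{R}\times X^*$, compact in $\tau_{\mathbb{R}}\times w^*$, such that $\Phi_F(x,0)=\Psi_F(x,0)=0$ and for all $\Delta x\in X$ $$\lim_{\alpha\to+0}\frac1\alpha\big|F(x+\alpha\Delta x)-F(x)-\Phi_F(x,\alpha\Delta x)-\Psi_F(x,\alpha\Delta x)\big|=0,$$ where $\Phi_F(x,\Delta x)=\max_{(a,x^* )\in\underline{d}F(x)}(a+\langle x^*,\Delta x\rangle)$ and $\Psi_F(x,\Delta x)=\min_{(b,y^* )\in\overline{d}F(x)}(b+\langle y^*,\Delta x\rangle)$. Codifferentials are not unique. $F$ is continuously codifferentiable on a set if it is codifferentiable at each of its points and there is a codifferential mapping $DF(\cdot)$ such that both $\underline{d}F(\cdot)$ and $\overline{d}F(\cdot)$ are continuous on this set with respect to the Hausdorff metric (w.r.t. the norm on $\mathbb{R}\times X^*$), $d_H(A,B)=\max\{\sup_{x\in A}\inf_{y\in B}d(x,y),\sup_{y\in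 B}\inf_{x\in A}d(x,y)\}$. **Setting.** $\Omega\subseteq\mathbb{R}^d$ is an open set (not necessarily bounded), $f:\Omega\times\mathbb{R}^m\times\mathbb{R}^{m\times d}\to\mathbb{R}$, $f=f(x,u,\xi)$. $W^{1,p}(\Omega;\mathbb{R}^m)$, $1\le p\le+\infty$, is the Sobolev space with norm $\|u\|_{1,p}=(\|u\|_p^p+\|\nabla u\|_p^p)^{1/p}$ for $p<+\infty$, $\|u\|_{1,\infty}=\max\{\|u\|_\infty,\|\nabla u\|_\infty\}$; $1/p+1/p'=1$; $|\cdot|$ is the Euclidean norm and $\langle\cdot,\cdot\rangle$ the inner product; $\operatorname{co}$ is the convex hull. For a.e. $x\in\Omega$ the function $(u,\xi)\mapsto f(x,u,\xi)$ is assumed codifferentiable at every point of $\mathbb{R}^m\times\mathbb{R}^{m\times d}$; $D_{u,\xi}f(x,u,\xi)=[\underline{d}_{u,\xi}f(x,u,\xi),\overline{d}_{u,\xi}f(x,u,\xi)]$ denotes a fixed choice of its codifferential, consisting of convex compact subsets of $\mathbb{R}\times\mathbb{R}^m\times\mathbb{R}^{m\times d}$. A (set-valued or single-valued) map $F(x,y)$ is a Carathéodory map if it is measurable in $x$ for every $y$ and continuous in $y$ for (a.e.) every $x$ (for compact-valued maps into $\mathbb{R}^k$: Hausdorff continuous). A measurable selection of a multifunction $G$ on $\Omega$ is a measurable $z$ with $z(x)\in G(x)$ for a.e. $x$. **Codifferentiability conditions of order $p$.** $f$ satisfies them if: (1) $f$ is a Carathéodory function, and: if $1\le p<+\infty$,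 there are an a.e. nonnegative $\beta\in L^1(\Omega)$ and $C>0$ with $|f(x,u,\xi)|\le\beta(x)+C(|u|^p+|\xi|^p)$ for a.e. $x$ and all $(u,\xi)$; if $p=+\infty$, for any $N>0$ there is an a.e. nonnegative $\beta_N\in L^1(\Omega)$ with $|f(x,u,\xi)|\le\beta_N(x)$ for a.e. $x$ and all $(u,\xi)$ with $\max\{|u|,|\xi|\}\le N$; (2) for a.e. $x$ the function $(u,\xi)\mapsto f(x,u,\xi)$ is codifferentiable on $\mathbb{R}^m\times\mathbb{R}^{m\times d}$, both $\underline{d}_{u,\xi}f$ and $\overline{d}_{u,\xi}f$ are Carathéodory maps, and: if $1\le p<+\infty$, there are $C>0$ and a.e. nonnegative $\beta\in L^1(\Omega)$, $\gamma\in L^{p'}(\Omega)$ such that for a.e. $x$, all $(u,\xi)$, all $(a,v_1,v_2)\in\underline{d}_{u,\xi}f(x,u,\xi)$ and $(b,w_1,w_2)\in\overline{d}_{u,\xi}f(x,u,\xi)$: $\max\{|a|,|b|\}\le\beta(x)+C(|u|^p+|\xi|^p)$ and $\max\{|v_1|,|v_2|,|w_1|,|w_2|\}\le\gamma(x)+C(|u|^{p-1}+|\xi|^{p-1})$; if $p=+\infty$, for any $N>0$ there is an a.e. nonnegative $\beta_N\in L^1(\Omega)$ such that $\max\{|a|,|v_1|,|v_2|,|b|,|w_1|,|w_2|\}\le\beta_N(x)$ for a.e. $x$, for all such triples and all $(u,\xi)$ with $\max\{|u|,|\xi|\}\le N$. **Segment property.** $\Omega$ has the segment property if for every $x\in\partial\Omega$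 there are a neighbourhood $U_x\subset\mathbb{R}^d$ of $x$ and a nonzero $y_x\in\mathbb{R}^d$ such that for any $z\in\operatorname{cl}\Omega\cap U_x$ one has $z+ty_x\in\Omega$ for all $t\in(0,1)$. *)

theory Defs
  imports "HOL-Analysis.Analysis"
begin

section \<open>Classes of functions modulo equality almost everywhere\<close>

quotient_type (overloaded) ('a, 'b) aefun = "'a::euclidean_space \<Rightarrow> 'b" /
  "\<lambda>f g. AE x in lebesgue. f x = g x"
proof (rule equivpI)
  show "reflp (\<lambda>f g :: 'a \<Rightarrow> 'b. AE x in lebesgue. f x = g x)"
    by (simp add: reflp_def)
  show "symp (\<lambda>f g :: 'a \<Rightarrow> 'b. AE x in lebesgue. f x = g x)"
    by (auto intro!: sympI elim: eventually_mono)
  show "transp (\<lambda>f g :: 'a \<Rightarrow> 'b. AE x in lebesgue. f x = g x)"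
  proof (rule transpI)
    fix f g h :: "'a \<Rightarrow> 'b"
    assume "AE x in lebesgue. f x = g x" "AE x in lebesgue. g x = h x"
    then show "AE x in lebesgue. f x = h x" by eventually_elim simp
  qed
qed

instantiation aefun :: (euclidean_space, real_vector) real_vector
begin

lift_definition zero_aefun :: "('a, 'b) aefun" is "\<lambda>x. 0" .

lift_definition plus_aefun :: "('a, 'b) aefun \<Rightarrow> ('a, 'b) aefun \<Rightarrow> ('a, 'b) aefun"
  is "\<lambda>f g x. f x + g x" by (auto elim: eventually_elim2 eventually_mono)

lift_definition minus_aefun :: "('a, 'b) aefun \<Rightarrow> ('a, 'b) aefun \<Rightarrow> ('a, 'b) aefun"
  is "\<lambda>f g x. f x - g x" by (auto elim: eventually_elim2 eventually_mono)

lift_definition uminus_aefun :: "('a, 'b) aefun \<Rightarrow> ('a, 'b) aefun"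
  is "\<lambda>f x. - f x" by (auto elim: eventually_elim2 eventually_mono)

lift_definition scaleR_aefun :: "real \<Rightarrow> ('a, 'b) aefun \<Rightarrow> ('a, 'b) aefun"
  is "\<lambda>c f x. c *\<^sub>R f x" by (auto elim: eventually_elim2 eventually_mono)

instance
  by standard (transfer; simp add: algebra_simps)+

end


section \<open>Lebesgue and Sobolev spaces\<close>

definition Lp :: "ennreal \<Rightarrow> 'a measure \<Rightarrow> ('a \<Rightarrow> 'b::real_normed_vector) set" where
  "Lp p M = {f \<in> borel_measurable M.
     if p = \<infinity> then \<exists>K. AE x in M. norm (f x) \<le> K
     else integrable M (\<lambda>x. norm (f x) powr enn2real p)}"

definition Lp_norm :: "ennreal \<Rightarrow> 'a measure \<Rightarrow> ('a \<Rightarrow> 'b::real_normed_vector) \<Rightarrow> real" where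
  "Lp_norm p M f =
     (if p = \<infinity> then Inf {K. 0 \<le> K \<and> (AE x in M. norm (f x) \<le> K)}
      else (\<integral>x. norm (f x) powr enn2real p \<partial>M) powr (1 / enn2real p))"

fun Ck :: "nat \<Rightarrow> (real^'d \<Rightarrow> real) \<Rightarrow> bool" where
  "Ck 0 \<phi> = continuous_on UNIV \<phi>"
| "Ck (Suc k) \<phi> = (\<exists>G :: real^'d \<Rightarrow> real^'d.
     (\<forall>x. (\<phi> has_derivative (\<lambda>h. G x \<bullet> h)) (at x)) \<and> (\<forall>j. Ck k (\<lambda>x. G x $ j)))"

definition test_functions :: "(real^'d) set \<Rightarrow> (real^'d \<Rightarrow> real) set" where
  "test_functions \<Omega> = {\<phi>. (\<forall>k. Ck k \<phi>) \<and>
     compact (closure {x. \<phi> x \<noteq> 0}) \<and> closure {x. \<phi> x \<noteq> 0} \<subseteq> \<Omega>}"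

definition locally_integrable :: "(real^'d) set \<Rightarrow> (real^'d \<Rightarrow> 'b::euclidean_space) \<Rightarrow> bool" where
  "locally_integrable \<Omega> u \<longleftrightarrow> (\<forall>K. compact K \<longrightarrow> K \<subseteq> \<Omega> \<longrightarrow> u absolutely_integrable_on K)"

text \<open>The matrix \<open>g x\<close> has the rows \<open>g x $ i\<close>, that is,
  \<open>g x $ i $ j\<close> is the weak derivative of the component \<open>i\<close> in the direction \<open>j\<close>.
  The norm and inner product of \<^typ>\<open>real^'d^'m\<close> are the Euclidean (Frobenius) ones.\<close>

definition is_weak_gradient ::
    "(real^'d) set \<Rightarrow> (real^'d \<Rightarrow> real^'m) \<Rightarrow> (real^'d \<Rightarrow> real^'d^'m) \<Rightarrow> bool" where
  "is_weak_gradient \<Omega> u g \<longleftrightarrow> locally_integrable \<Omega> u \<and> locally_integrable \<Omega> g \<and>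
     (\<forall>\<phi>\<in>test_functions \<Omega>. \<forall>i j.
        (\<integral>x. u x $ i * frechet_derivative \<phi> (at x) (axis j 1) \<partial>lebesgue_on \<Omega>) =
        - (\<integral>x. g x $ i $ j * \<phi> x \<partial>lebesgue_on \<Omega>))"

text \<open>A class of functions on \<open>\<Omega>\<close> is represented by its extension by zero, so that
  the elements of the Sobolev space for different \<open>\<Omega>\<close> live in the same type. The gradient
  is taken in \<open>\<Omega>\<close> only; nothing is required of the extension across the boundary.\<close>

definition sobolev :: "ennreal \<Rightarrow> (real^'d) set \<Rightarrow> (real^'d, real^'m) aefun set" where
  "sobolev p \<Omega> = {u.
     (AE x in lebesgue. x \<notin> \<Omega> \<longrightarrow> rep_aefun u x = 0) \<and>
     rep_aefun u \<in> Lp p (lebesgue_on \<Omega>) \<and>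
     (\<exists>g. is_weak_gradient \<Omega> (rep_aefun u) g \<and> g \<in> Lp p (lebesgue_on \<Omega>))}"

text \<open>A representative of the weak gradient, which is unique up to null subsets of \<open>\<Omega>\<close>.\<close>

definition weak_gradient :: "(real^'d) set \<Rightarrow> (real^'d, real^'m) aefun \<Rightarrow> real^'d \<Rightarrow> real^'d^'m" where
  "weak_gradient \<Omega> u = (SOME g. is_weak_gradient \<Omega> (rep_aefun u) g)"

definition sobolev_norm :: "ennreal \<Rightarrow> (real^'d) set \<Rightarrow> (real^'d, real^'m) aefun \<Rightarrow> real" where
  "sobolev_norm p \<Omega> u =
     (let a = Lp_norm p (lebesgue_on \<Omega>) (rep_aefun u);
          b = Lp_norm p (lebesgue_on \<Omega>) (weak_gradient \<Omega> u)
      in if p = \<infinity> then max a b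
         else (a powr enn2real p + b powr enn2real p) powr (1 / enn2real p))"

definition segment_property :: "(real^'d) set \<Rightarrow> bool" where
  "segment_property \<Omega> \<longleftrightarrow>
     (\<forall>x\<in>frontier \<Omega>. \<exists>U y. open U \<and> x \<in> U \<and> y \<noteq> 0 \<and>
        (\<forall>z\<in>closure \<Omega> \<inter> U. \<forall>t\<in>{0<..<1}. z + t *\<^sub>R y \<in> \<Omega>))"


section \<open>Hausdorff continuity\<close>

definition hausdorff_dist :: "('a \<Rightarrow> 'a \<Rightarrow> real) \<Rightarrow> 'a set \<Rightarrow> 'a set \<Rightarrow> ennreal" where
  "hausdorff_dist d A B =
     max (SUP x\<in>A. INF y\<in>B. ennreal (d x y)) (SUP y\<in>B. INF x\<in>A. ennreal (d x y))"

definition hausdorff_continuous_on ::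
    "'x set \<Rightarrow> ('x \<Rightarrow> 'x \<Rightarrow> real) \<Rightarrow> ('a \<Rightarrow> 'a \<Rightarrow> real) \<Rightarrow> ('x \<Rightarrow> 'a set) \<Rightarrow> bool" where
  "hausdorff_continuous_on S dX d F \<longleftrightarrow>
     (\<forall>u\<in>S. \<forall>\<epsilon>>0. \<exists>\<delta>>0. \<forall>w\<in>S. dX w u < \<delta> \<longrightarrow> hausdorff_dist d (F w) (F u) < ennreal \<epsilon>)"


section \<open>Codifferentials\<close>

text \<open>A normed space is given by a subspace \<open>V\<close> of a real vector space and a norm \<open>N\<close> on \<open>V\<close>.
  Functionals are made unique by being \<^const>\<open>undefined\<close> outside \<open>V\<close>, as the
  elements of the product topology are; the latter induces the weak* topology.\<close>

definition dual :: "'a::real_vector set \<Rightarrow> ('a \<Rightarrow> real) \<Rightarrow> ('a \<Rightarrow> real) set" where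
  "dual V N = {\<phi> \<in> extensional V.
     (\<forall>g\<in>V. \<forall>h\<in>V. \<phi> (g + h) = \<phi> g + \<phi> h) \<and>
     (\<forall>c. \<forall>h\<in>V. \<phi> (c *\<^sub>R h) = c * \<phi> h) \<and>
     (\<exists>K. \<forall>h\<in>V. \<bar>\<phi> h\<bar> \<le> K * N h)}"

definition dual_norm :: "'a::real_vector set \<Rightarrow> ('a \<Rightarrow> real) \<Rightarrow> ('a \<Rightarrow> real) \<Rightarrow> real" where
  "dual_norm V N \<phi> = (SUP h\<in>{h\<in>V. N h \<le> 1}. \<bar>\<phi> h\<bar>)"

definition real_dual_dist :: "'a::real_vector set \<Rightarrow> ('a \<Rightarrow> real) \<Rightarrow>
    real \<times> ('a \<Rightarrow> real) \<Rightarrow> real \<times> ('a \<Rightarrow> real) \<Rightarrow> real" where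
  "real_dual_dist V N = (\<lambda>(a, \<phi>) (b, \<psi>).
     sqrt (\<bar>a - b\<bar>\<^sup>2 + (dual_norm V N (\<lambda>h. \<phi> h - \<psi> h))\<^sup>2))"

definition weak_star :: "'a::real_vector set \<Rightarrow> ('a \<Rightarrow> real) \<Rightarrow> ('a \<Rightarrow> real) topology" where
  "weak_star V N = subtopology (product_topology (\<lambda>_. euclideanreal) V) (dual V N)"

definition convex_real_dual :: "'a::real_vector set \<Rightarrow> (real \<times> ('a \<Rightarrow> real)) set \<Rightarrow> bool" where
  "convex_real_dual V A \<longleftrightarrow>
     (\<forall>(a, \<phi>)\<in>A. \<forall>(b, \<psi>)\<in>A. \<forall>t\<in>{0..1}.
        ((1 - t) * a + t * b, restrict (\<lambda>h. (1 - t) * \<phi> h + t * \<psi> h) V) \<in> A)"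

text \<open>The supremum and infimum are attained for the nonempty compact sets below.\<close>

definition hypo_fun :: "(real \<times> ('a \<Rightarrow> real)) set \<Rightarrow> 'a \<Rightarrow> real" where
  "hypo_fun A h = (SUP (a, \<phi>)\<in>A. a + \<phi> h)"

definition hyper_fun :: "(real \<times> ('a \<Rightarrow> real)) set \<Rightarrow> 'a \<Rightarrow> real" where
  "hyper_fun B h = (INF (b, \<psi>)\<in>B. b + \<psi> h)"

definition is_codifferential :: "'a::real_vector set \<Rightarrow> ('a \<Rightarrow> real) \<Rightarrow> ('a \<Rightarrow> real) \<Rightarrow> 'a \<Rightarrow>
    (real \<times> ('a \<Rightarrow> real)) set \<Rightarrow> (real \<times> ('a \<Rightarrow> real)) set \<Rightarrow> bool" where
  "is_codifferential V N F x A B \<longleftrightarrow>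
     A \<noteq> {} \<and> convex_real_dual V A \<and> compactin (prod_topology euclideanreal (weak_star V N)) A \<and>
     B \<noteq> {} \<and> convex_real_dual V B \<and> compactin (prod_topology euclideanreal (weak_star V N)) B \<and>
     hypo_fun A 0 = 0 \<and> hyper_fun B 0 = 0 \<and>
     (\<forall>h\<in>V. ((\<lambda>\<alpha>. 1 / \<alpha> * \<bar>F (x + \<alpha> *\<^sub>R h) - F x
                 - hypo_fun A (\<alpha> *\<^sub>R h) - hyper_fun B (\<alpha> *\<^sub>R h)\<bar>) \<longlongrightarrow> 0) (at_right 0))"

definition codifferentiable_at ::
    "'a::real_vector set \<Rightarrow> ('a \<Rightarrow> real) \<Rightarrow> ('a \<Rightarrow> real) \<Rightarrow> 'a \<Rightarrow> bool" where
  "codifferentiable_at V N F x \<longleftrightarrow> (\<exists>A B. is_codifferential V N F x A B)"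

definition continuously_codifferentiable_on ::
    "'a::real_vector set \<Rightarrow> ('a \<Rightarrow> real) \<Rightarrow> 'a set \<Rightarrow> ('a \<Rightarrow> real) \<Rightarrow> bool" where
  "continuously_codifferentiable_on V N S F \<longleftrightarrow>
     (\<exists>dlo dup. (\<forall>x\<in>S. is_codifferential V N F x (dlo x) (dup x)) \<and>
        hausdorff_continuous_on S (\<lambda>u w. N (u - w)) (real_dual_dist V N) dlo \<and>
        hausdorff_continuous_on S (\<lambda>u w. N (u - w)) (real_dual_dist V N) dup)"

text \<open>In a Euclidean space the dual is identified with the space itself.\<close>

definition riesz :: "real \<times> 'a::euclidean_space \<Rightarrow> real \<times> ('a \<Rightarrow> real)" where
  "riesz = (\<lambda>(a, v). (a, \<lambda>h. v \<bullet> h))"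

definition is_euclidean_codifferential :: "('a::euclidean_space \<Rightarrow> real) \<Rightarrow> 'a \<Rightarrow>
    (real \<times> 'a) set \<Rightarrow> (real \<times> 'a) set \<Rightarrow> bool" where
  "is_euclidean_codifferential F x A B \<longleftrightarrow>
     is_codifferential UNIV norm F x (riesz ` A) (riesz ` B)"


section \<open>Integrands\<close>

type_synonym ('d, 'm, 'r) integrand = "real^'d \<Rightarrow> real^'m \<Rightarrow> real^'d^'m \<Rightarrow> 'r"

type_synonym ('d, 'm) triple = "real \<times> (real^'m) \<times> (real^'d^'m)"

definition caratheodory :: "(real^'d) set \<Rightarrow> ('d::finite, 'm::finite, real) integrand \<Rightarrow> bool" where
  "caratheodory \<Omega> f \<longleftrightarrow>
     (\<forall>u \<xi>. (\<lambda>x. f x u \<xi>) \<in> borel_measurable (lebesgue_on \<Omega>)) \<and>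
     (AE x in lebesgue_on \<Omega>. continuous_on UNIV (\<lambda>(u, \<xi>). f x u \<xi>))"

definition measurable_multifunction ::
    "'a measure \<Rightarrow> ('a \<Rightarrow> 'b::topological_space set) \<Rightarrow> bool" where
  "measurable_multifunction M G \<longleftrightarrow> (\<forall>U. open U \<longrightarrow> {x \<in> space M. G x \<inter> U \<noteq> {}} \<in> sets M)"

definition caratheodory_multi ::
    "(real^'d) set \<Rightarrow> ('d::finite, 'm::finite, ('d, 'm) triple set) integrand \<Rightarrow> bool" where
  "caratheodory_multi \<Omega> D \<longleftrightarrow>
     (\<forall>u \<xi>. measurable_multifunction (lebesgue_on \<Omega>) (\<lambda>x. D x u \<xi>)) \<and>
     (AE x in lebesgue_on \<Omega>. hausdorff_continuous_on UNIV dist dist (\<lambda>(u, \<xi>). D x u \<xi>))"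

definition measurable_selections ::
    "'a measure \<Rightarrow> ('a \<Rightarrow> 'b::topological_space set) \<Rightarrow> ('a \<Rightarrow> 'b) set" where
  "measurable_selections M G = {z \<in> borel_measurable M. AE x in M. z x \<in> G x}"

text \<open>Real power with the convention that the power zero is one also at the base
  zero, where \<open>powr\<close> is zero.\<close>

definition rpow :: "real \<Rightarrow> real \<Rightarrow> real" where
  "rpow t s = (if s = 0 then 1 else t powr s)"

definition growth_condition ::
    "ennreal \<Rightarrow> (real^'d) set \<Rightarrow> ('d::finite, 'm::finite, real) integrand \<Rightarrow> bool" where
  "growth_condition p \<Omega> f \<longleftrightarrow>
     (if p < \<infinity> then
        \<exists>\<beta>\<in>Lp 1 (lebesgue_on \<Omega>). \<exists>C>0. (AE x in lebesgue_on \<Omega>. 0 \<le> \<beta> x) \<and>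
          (AE x in lebesgue_on \<Omega>. \<forall>u \<xi>.
             \<bar>f x u \<xi>\<bar> \<le> \<beta> x + C * (rpow (norm u) (enn2real p) + rpow (norm \<xi>) (enn2real p)))
      else
        \<forall>N>0. \<exists>\<beta>\<in>Lp 1 (lebesgue_on \<Omega>). (AE x in lebesgue_on \<Omega>. 0 \<le> \<beta> x) \<and>
          (AE x in lebesgue_on \<Omega>. \<forall>u \<xi>. max (norm u) (norm \<xi>) \<le> N \<longrightarrow> \<bar>f x u \<xi>\<bar> \<le> \<beta> x))"

definition codiff_growth_condition :: "ennreal \<Rightarrow> (real^'d) set \<Rightarrow>
    ('d::finite, 'm::finite, ('d, 'm) triple set) integrand \<Rightarrow>
    ('d, 'm, ('d, 'm) triple set) integrand \<Rightarrow> bool" where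
  "codiff_growth_condition p \<Omega> dlo dup \<longleftrightarrow>
     (if p < \<infinity> then
        \<exists>C>0. \<exists>p'. 1 / p + 1 / p' = 1 \<and>
          (\<exists>\<beta>\<in>Lp 1 (lebesgue_on \<Omega>). \<exists>\<gamma>\<in>Lp p' (lebesgue_on \<Omega>).
            (AE x in lebesgue_on \<Omega>. 0 \<le> \<beta> x) \<and> (AE x in lebesgue_on \<Omega>. 0 \<le> \<gamma> x) \<and>
            (AE x in lebesgue_on \<Omega>. \<forall>u \<xi>. \<forall>(a, v1, v2)\<in>dlo x u \<xi>. \<forall>(b, w1, w2)\<in>dup x u \<xi>.
               Max {\<bar>a\<bar>, \<bar>b\<bar>}
                 \<le> \<beta> x + C * (rpow (norm u) (enn2real p) + rpow (norm \<xi>) (enn2real p)) \<and>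
               Max {norm v1, norm v2, norm w1, norm w2}
                 \<le> \<gamma> x + C * (rpow (norm u) (enn2real p - 1) + rpow (norm \<xi>) (enn2real p - 1))))
      else
        \<forall>N>0. \<exists>\<beta>\<in>Lp 1 (lebesgue_on \<Omega>). (AE x in lebesgue_on \<Omega>. 0 \<le> \<beta> x) \<and>
          (AE x in lebesgue_on \<Omega>. \<forall>u \<xi>. max (norm u) (norm \<xi>) \<le> N \<longrightarrow>
             (\<forall>(a, v1, v2)\<in>dlo x u \<xi>. \<forall>(b, w1, w2)\<in>dup x u \<xi>.
               Max {\<bar>a\<bar>, norm v1, norm v2, \<bar>b\<bar>, norm w1, norm w2} \<le> \<beta> x)))"

text \<open>\<open>dlo\<close> and \<open>dup\<close> are the fixed choice of the codifferential of
  \<open>f x\<close> in \<open>(u, \<xi>)\<close>.\<close>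

definition codifferentiability_conditions :: "ennreal \<Rightarrow> (real^'d) set \<Rightarrow>
    ('d::finite, 'm::finite, real) integrand \<Rightarrow> ('d, 'm, ('d, 'm) triple set) integrand \<Rightarrow>
    ('d, 'm, ('d, 'm) triple set) integrand \<Rightarrow> bool" where
  "codifferentiability_conditions p \<Omega> f dlo dup \<longleftrightarrow>
     caratheodory \<Omega> f \<and> growth_condition p \<Omega> f \<and>
     (AE x in lebesgue_on \<Omega>. \<forall>u \<xi>.
        is_euclidean_codifferential (\<lambda>(u, \<xi>). f x u \<xi>) (u, \<xi>) (dlo x u \<xi>) (dup x u \<xi>)) \<and>
     caratheodory_multi \<Omega> dlo \<and> caratheodory_multi \<Omega> dup \<and>
     codiff_growth_condition p \<Omega> dlo dup"

definition finitely_generated_form ::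
    "(real^'d) set \<Rightarrow> ('d::finite, 'm::finite, ('d, 'm) triple set) integrand \<Rightarrow> bool" where
  "finitely_generated_form \<Omega> D \<longleftrightarrow>
     (\<exists>(n::nat) (F :: nat \<Rightarrow> ('d, 'm, real) integrand) v1 v2.
        (\<forall>i\<in>{1..n}. caratheodory \<Omega> (F i)) \<and>
        (AE x in lebesgue_on \<Omega>. \<forall>u \<xi>.
           D x u \<xi> = convex hull ((\<lambda>i. (F i x u \<xi>, v1 i, v2 i)) ` {1..n})))"


section \<open>The integral functional\<close>

definition int_functional :: "(real^'d) set \<Rightarrow> ('d::finite, 'm::finite, real) integrand \<Rightarrow>
    (real^'d, real^'m) aefun \<Rightarrow> real" where
  "int_functional \<Omega> f u = (\<integral>x. f x (rep_aefun u x) (weak_gradient \<Omega> u x) \<partial>lebesgue_on \<Omega>)"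

definition correctly_defined :: "ennreal \<Rightarrow> (real^'d) set \<Rightarrow>
    ('d::finite, 'm::finite, real) integrand \<Rightarrow> bool" where
  "correctly_defined p \<Omega> f \<longleftrightarrow>
     (\<forall>u\<in>sobolev p \<Omega>. \<forall>v g.
        (AE x in lebesgue_on \<Omega>. v x = rep_aefun u x) \<and> is_weak_gradient \<Omega> v g \<longrightarrow>
        integrable (lebesgue_on \<Omega>) (\<lambda>x. f x (v x) (g x)) \<and>
        (\<integral>x. f x (v x) (g x) \<partial>lebesgue_on \<Omega>) = int_functional \<Omega> f u)"

text \<open>With \<open>D\<close> the hypodifferential (hyperdifferential) of the integrand this is the
  hypodifferential (hyperdifferential) of the functional.\<close>

definition integral_differential :: "ennreal \<Rightarrow> (real^'d) set \<Rightarrow>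
    ('d::finite, 'm::finite, ('d, 'm) triple set) integrand \<Rightarrow> (real^'d, real^'m) aefun \<Rightarrow>
    (real \<times> ((real^'d, real^'m) aefun \<Rightarrow> real)) set" where
  "integral_differential p \<Omega> D u =
     {(A, \<phi>). \<phi> \<in> dual (sobolev p \<Omega>) (sobolev_norm p \<Omega>) \<and>
        (\<exists>a v1 v2.
           (\<lambda>x. (a x, v1 x, v2 x)) \<in> measurable_selections (lebesgue_on \<Omega>)
             (\<lambda>x. D x (rep_aefun u x) (weak_gradient \<Omega> u x)) \<and>
           A = (\<integral>x. a x \<partial>lebesgue_on \<Omega>) \<and>
           (\<forall>h\<in>sobolev p \<Omega>.
              \<phi> h = (\<integral>x. v1 x \<bullet> rep_aefun h x + v2 x \<bullet> weak_gradient \<Omega> h x \<partial>lebesgue_on \<Omega>)))}"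

end

theory Submission
  imports Defs
begin

text \<open>
  A selection \<open>z\<close> of a compact convex valued map \<open>G\<close> acts on functions \<open>q\<close> by integrating
  \<open>z x \<bullet> q x\<close>. The functionals obtained in this way are exactly the linear ones that are dominated by
  the integral of the support function of \<open>G x\<close> at \<open>q x\<close>: such a functional has a density by the
  Radon-Nikodym theorem, and the density lies in \<open>G x\<close> by separation. Domination is a closed condition
  in a product of compact intervals, so Tychonoff's theorem gives weak* compactness of the integral
  hypo- and hyperdifferentials for all \<open>p\<close> at once. The
  supremum over the selections is the integral of the support function, because projecting large
  multiples of \<open>q x\<close> onto \<open>G x\<close> gives nearly optimal measurable selections. The codifferential
  expansion then follows by dominated convergence from the expansions of the integrand, whose
  increments are bounded by a mean value inequality for one-sided derivatives. Hausdorff continuity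
  follows by projecting a selection for one argument onto the values for a nearby one. All integrals
  depend on a function through the pair of its values and its weak gradient, which is well defined
  almost everywhere by the fundamental lemma of the calculus of variations.
\<close>

section \<open>Measurable selections of compact convex maps\<close>

text \<open>A jet of a Sobolev function times an indicator is in general no longer a jet, so an
  inequality tested on jets alone cannot be localised. The duality is therefore set up on the larger
  space \<open>pairable\<close>, which admits cut-offs; evaluation at jets then maps its dominated
  functionals continuously onto the differential of the integral functional. For
  \<open>p = \<infinity>\<close> the second components are merely integrable, and bounded sets in
  L^1 need not be weakly compact; domination by a support integral replaces compactness arguments in
  L^p'. The underlying measure may be infinite and the sets \<open>G x\<close> need not be bounded
  uniformly in x, hence the positive integrable weights. For Hausdorff continuity, pointwise
  closeness has to become smallness that is uniform over all selections and over the unit ball. The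
  former is reached by choosing a worst selection for each index of a sequence, the latter by
  dominated convergence in L^p', which is available for finite p' only, that is for
  \<open>p > 1\<close>. For \<open>p = 1\<close> the second components must be close uniformly in x,
  and there the constant vectors of the generators enter.\<close>

text \<open>On each level set of a simple function the parameter is constant, so substituting simple
  approximations of \<open>c\<close> gives measurable functions; continuity in the parameter passes
  this on to the limit.\<close>

lemma borel_measurable_caratheodory_compose:
  fixes g :: "'a \<Rightarrow> 'b::{metric_space, second_countable_topology} \<Rightarrow> 'c::metric_space"
  assumes g: "\<And>y. (\<lambda>x. g x y) \<in> borel_measurable M"
    and cont: "\<And>x. x \<in> space M \<Longrightarrow> continuous_on UNIV (g x)"
    and c: "c \<in> borel_measurable M"
  shows "(\<lambda>x. g x (c x)) \<in> borel_measurable M"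
proof -
  obtain F where F: "\<And>i. simple_function M (F i)"
      "\<And>x. x \<in> space M \<Longrightarrow> (\<lambda>i. F i x) \<longlonglongrightarrow> c x"
    using borel_measurable_implies_sequence_metric[OF c, of undefined] by metis
  have "(\<lambda>x. g x (F i x)) \<in> borel_measurable M" for i
  proof (rule measurable_compose_countable'[where f = "\<lambda>y x. g x y" and I = "F i ` space M"])
    show "F i \<in> measurable M (count_space (F i ` space M))"
      using F(1)[of i] by (auto simp: simple_function_def measurable_count_space_eq2)
    show "countable (F i ` space M)"
      using F(1)[of i] by (simp add: simple_function_def countable_finite)
  qed (use g in auto)
  moreover have "(\<lambda>i. g x (F i x)) \<longlonglongrightarrow> g x (c x)" if "x \<in> space M" for x
    using continuous_on_tendsto_compose[OF cont[OF that] F(2)[OF that]] by auto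
  ultimately show ?thesis by (rule borel_measurable_LIMSEQ_metric)
qed

text \<open>Measurability is imposed on the distances to fixed points because these are real
  functions, 1-Lipschitz in the point, to which the composition lemma applies;
  \<open>infdist_measurable_if_open_hit_measurable\<close> derives it from the measurability of
  hitting open sets.\<close>

locale compact_convex_map = sigma_finite_measure M for M :: "'a measure" +
  fixes G :: "'a \<Rightarrow> 'b::euclidean_space set"
  assumes nonempty: "x \<in> space M \<Longrightarrow> G x \<noteq> {}"
    and compact: "x \<in> space M \<Longrightarrow> compact (G x)"
    and convex: "x \<in> space M \<Longrightarrow> convex (G x)"
    and infdist_measurable: "(\<lambda>x. infdist y (G x)) \<in> borel_measurable M"
begin

lemma borel_measurable_infdist_compose:
  "c \<in> borel_measurable M \<Longrightarrow> (\<lambda>x. infdist (c x) (G x)) \<in> borel_measurable M"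
  by (rule borel_measurable_caratheodory_compose[where g = "\<lambda>x y. infdist y (G x)"])
     (auto intro!: infdist_measurable continuous_intros)

text \<open>The metric projection onto a convex set is the gradient of half the difference of the squared
  norm and the squared distance, hence a pointwise limit of measurable difference quotients.\<close>

lemma borel_measurable_closest_point:
  assumes c: "c \<in> borel_measurable M"
  shows "(\<lambda>x. closest_point (G x) (c x)) \<in> borel_measurable M"
proof -
  define t :: "nat \<Rightarrow> real" where "t n = 1 / real (Suc n)" for n
  have t: "t n > 0" for n by (simp add: t_def)
  have t0: "t \<longlonglongrightarrow> 0" unfolding t_def by (rule LIMSEQ_Suc[OF lim_1_over_n])
  define \<psi> where "\<psi> e n x = (((norm (c x + t n *\<^sub>R e))\<^sup>2 - (infdist (c x + t n *\<^sub>R e) (G x))\<^sup>2)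
     - ((norm (c x))\<^sup>2 - (infdist (c x) (G x))\<^sup>2)) / (2 * t n)" for e n x
  have "(\<lambda>x. closest_point (G x) (c x) \<bullet> e) \<in> borel_measurable M" for e
  proof (rule borel_measurable_LIMSEQ_metric)
    show "(\<lambda>x. \<psi> e n x) \<in> borel_measurable M" for n
      unfolding \<psi>_def using c borel_measurable_infdist_compose[of "\<lambda>x. c x + t n *\<^sub>R e"]
        borel_measurable_infdist_compose[OF c] by measurable
    fix x assume x: "x \<in> space M"
    let ?P = "closest_point (G x)"
    have cl: "closed (G x)" "G x \<noteq> {}" "convex (G x)"
      using compact[OF x] compact_imp_closed nonempty[OF x] convex[OF x] by auto
    have P: "?P y \<in> G x" "infdist y (G x) = norm (y - ?P y)" for y
      using closest_point_in_set[OF cl(1,2)] setdist_closest_point[OF cl(1,2), of y]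
      by (auto simp: infdist_eq_setdist dist_norm)
    have Ple: "(norm (y - ?P y))\<^sup>2 \<le> (norm (y - z))\<^sup>2" if "z \<in> G x" for y z
      using closest_point_le[OF cl(1) that, of y] by (simp add: dist_norm)
    have ex: "(norm (a + s *\<^sub>R b))\<^sup>2 = (norm a)\<^sup>2 + 2 * s * (a \<bullet> b) + s\<^sup>2 * (norm b)\<^sup>2"
      for a b :: 'b and s
      unfolding power2_norm_eq_inner by (simp add: algebra_simps inner_commute power2_eq_square)
    \<comment> \<open>The projection of each of the two points is a competitor for the other.
      Expanding the squared norms turns the two minimality inequalities into a two-sided bound on
      the difference quotient, and continuity of the projection closes the gap as \<open>t n\<close>
      tends to 0.\<close>
    have lo: "?P (c x) \<bullet> e \<le> \<psi> e n x" and up: "\<psi> e n x \<le> ?P (c x + t n *\<^sub>R e) \<bullet> e" for n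
    proof -
      let ?y = "c x + t n *\<^sub>R e"
      have "(norm (?y - ?P ?y))\<^sup>2 \<le> (norm ((c x - ?P (c x)) + t n *\<^sub>R e))\<^sup>2"
        using Ple[OF P(1), of ?y "c x"] by (simp add: algebra_simps)
      then have 1: "(norm (?y - ?P ?y))\<^sup>2 \<le> (norm (c x - ?P (c x)))\<^sup>2 + 2 * t n * ((c x - ?P (c x)) \<bullet> e)
         + (t n)\<^sup>2 * (norm e)\<^sup>2" by (simp only: ex)
      have e2: "(norm ?y)\<^sup>2 = (norm (c x))\<^sup>2 + 2 * t n * (c x \<bullet> e) + (t n)\<^sup>2 * (norm e)\<^sup>2" by (rule ex)
      have "2 * t n * (?P (c x) \<bullet> e) \<le> ((norm ?y)\<^sup>2 - (norm (?y - ?P ?y))\<^sup>2)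
          - ((norm (c x))\<^sup>2 - (norm (c x - ?P (c x)))\<^sup>2)"
        using 1 e2 by (simp add: inner_diff_left algebra_simps)
      then show "?P (c x) \<bullet> e \<le> \<psi> e n x" using t[of n]
        by (simp add: \<psi>_def P(2) field_simps)
      have "(norm (c x - ?P (c x)))\<^sup>2 \<le> (norm (c x - ?P ?y))\<^sup>2" by (rule Ple[OF P(1)])
      moreover have "(norm (?y - ?P ?y))\<^sup>2 = (norm ((c x - ?P ?y) + t n *\<^sub>R e))\<^sup>2"
        by (simp add: algebra_simps)
      moreover note ex[of "c x - ?P ?y" "t n" e]
      ultimately have "(norm (c x - ?P (c x)))\<^sup>2 \<le> (norm (?y - ?P ?y))\<^sup>2 - 2 * t n * ((c x - ?P ?y) \<bullet> e)
          - (t n)\<^sup>2 * (norm e)\<^sup>2" by linarith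
      then have "((norm ?y)\<^sup>2 - (norm (?y - ?P ?y))\<^sup>2)
          - ((norm (c x))\<^sup>2 - (norm (c x - ?P (c x)))\<^sup>2) \<le> 2 * t n * (?P ?y \<bullet> e)"
        using e2 by (simp add: inner_diff_left algebra_simps)
      then show "\<psi> e n x \<le> ?P ?y \<bullet> e" using t[of n]
        by (simp add: \<psi>_def P(2) field_simps)
    qed
    have "(\<lambda>n. ?P (c x + t n *\<^sub>R e)) \<longlonglongrightarrow> ?P (c x)"
    proof (rule isCont_tendsto_compose[OF continuous_at_closest_point[OF cl(3,1,2)]])
      show "(\<lambda>n. c x + t n *\<^sub>R e) \<longlonglongrightarrow> c x" using t0 by (auto intro!: tendsto_eq_intros)
    qed
    then have L: "(\<lambda>n. ?P (c x + t n *\<^sub>R e) \<bullet> e) \<longlonglongrightarrow> ?P (c x) \<bullet> e" by (intro tendsto_intros)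
    show "(\<lambda>n. \<psi> e n x) \<longlonglongrightarrow> ?P (c x) \<bullet> e"
    proof (rule tendsto_sandwich[OF _ _ tendsto_const L])
      show "\<forall>\<^sub>F n in sequentially. ?P (c x) \<bullet> e \<le> \<psi> e n x" using lo by simp
      show "\<forall>\<^sub>F n in sequentially. \<psi> e n x \<le> ?P (c x + t n *\<^sub>R e) \<bullet> e" using up by simp
    qed
  qed
  then show ?thesis using borel_measurable_euclidean_space by blast
qed

definition supp :: "'a \<Rightarrow> 'b \<Rightarrow> real" where "supp x q = (SUP z\<in>G x. z \<bullet> q)"

lemma supp_attained:
  assumes "x \<in> space M" obtains z where "z \<in> G x" "z \<bullet> q = supp x q" "\<And>y. y \<in> G x \<Longrightarrow> y \<bullet> q \<le> supp x q"
proof -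
  have "continuous_on (G x) (\<lambda>z. z \<bullet> q)" by (intro continuous_intros)
  from continuous_attains_sup[OF compact[OF assms] nonempty[OF assms] this]
  obtain z where z: "z \<in> G x" "\<forall>y\<in>G x. y \<bullet> q \<le> z \<bullet> q" by auto
  have "supp x q = z \<bullet> q" unfolding supp_def
    using z by (intro cSup_eq_maximum) auto
  then show ?thesis using z that by auto
qed

lemma supp_upper: "x \<in> space M \<Longrightarrow> z \<in> G x \<Longrightarrow> z \<bullet> q \<le> supp x q"
  by (metis supp_attained)

lemma supp_least: "x \<in> space M \<Longrightarrow> (\<And>z. z \<in> G x \<Longrightarrow> z \<bullet> q \<le> r) \<Longrightarrow> supp x q \<le> r"
  by (metis supp_attained)

lemma supp_scaleR: "x \<in> space M \<Longrightarrow> 0 \<le> c \<Longrightarrow> supp x (c *\<^sub>R q) = c * supp x q"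
proof (rule antisym)
  assume x: "x \<in> space M" and c: "0 \<le> c"
  show "supp x (c *\<^sub>R q) \<le> c * supp x q"
    using c by (intro supp_least[OF x]) (auto intro!: mult_left_mono supp_upper[OF x])
  obtain z where "z \<in> G x" "z \<bullet> q = supp x q" using supp_attained[OF x] by metis
  then show "c * supp x q \<le> supp x (c *\<^sub>R q)" using supp_upper[OF x, of z "c *\<^sub>R q"] by simp
qed

lemma supp_zero: "x \<in> space M \<Longrightarrow> supp x 0 = 0"
  using supp_scaleR[of x 0 0] by simp

text \<open>Projecting \<open>n *\<^sub>R q\<close> means maximising z \<bullet> q - |z|^2 / (2 n)
  over \<open>G x\<close>, so the quadratic penalty costs at most R^2 / (2 n).\<close>

lemma supp_closest_point:
  assumes x: "x \<in> space M" and n: "n > 0" and R: "\<And>z. z \<in> G x \<Longrightarrow> norm z \<le> R"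
  shows "supp x q - R\<^sup>2 / (2 * n) \<le> closest_point (G x) (n *\<^sub>R q) \<bullet> q"
proof -
  let ?P = "closest_point (G x) (n *\<^sub>R q)"
  have cl: "closed (G x)" using compact[OF x] compact_imp_closed by auto
  obtain z where z: "z \<in> G x" "z \<bullet> q = supp x q" using supp_attained[OF x] by metis
  have "(norm (n *\<^sub>R q - ?P))\<^sup>2 \<le> (norm (n *\<^sub>R q - z))\<^sup>2"
    using closest_point_le[OF cl z(1), of "n *\<^sub>R q"] by (simp add: dist_norm)
  then have "(norm ?P)\<^sup>2 - 2 * n * (?P \<bullet> q) \<le> (norm z)\<^sup>2 - 2 * n * (z \<bullet> q)"
    unfolding power2_norm_eq_inner by (simp add: algebra_simps inner_commute)
  moreover have "(norm z)\<^sup>2 \<le> R\<^sup>2" using R[OF z(1)] by (intro power_mono) auto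
  moreover have "(norm ?P)\<^sup>2 \<ge> 0" by simp
  ultimately have "2 * n * (z \<bullet> q) - R\<^sup>2 \<le> 2 * n * (?P \<bullet> q)" by linarith
  then show ?thesis using n z by (simp add: field_simps)
qed

text \<open>The squeeze in \<open>supp_closest_point\<close> exhibits the support function as a
  limit of pairings with measurable selections, so no uncountable supremum of measurable functions
  has to be treated.\<close>

lemma borel_measurable_supp:
  assumes q: "q \<in> borel_measurable M"
  shows "(\<lambda>x. supp x (q x)) \<in> borel_measurable M"
proof (rule borel_measurable_LIMSEQ_metric)
  show "(\<lambda>x. closest_point (G x) (real (Suc n) *\<^sub>R q x) \<bullet> q x) \<in> borel_measurable M" for n
    using borel_measurable_closest_point[of "\<lambda>x. real (Suc n) *\<^sub>R q x"] q by measurable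
  fix x assume x: "x \<in> space M"
  obtain R where R: "\<And>z. z \<in> G x \<Longrightarrow> norm z \<le> R"
    using compact_imp_bounded[OF compact[OF x]] bounded_iff by blast
  show "(\<lambda>n. closest_point (G x) (real (Suc n) *\<^sub>R q x) \<bullet> q x) \<longlonglongrightarrow> supp x (q x)"
  proof (rule tendsto_sandwich)
    show "\<forall>\<^sub>F n in sequentially. supp x (q x) - R\<^sup>2 / (2 * real (Suc n))
        \<le> closest_point (G x) (real (Suc n) *\<^sub>R q x) \<bullet> q x"
      by (intro always_eventually allI supp_closest_point[OF x _ R]) auto
    show "\<forall>\<^sub>F n in sequentially. closest_point (G x) (real (Suc n) *\<^sub>R q x) \<bullet> q x \<le> supp x (q x)"
      using supp_upper[OF x closest_point_in_set] compact[OF x] nonempty[OF x] compact_imp_closed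
      by (intro always_eventually) auto
    have "(\<lambda>n. supp x (q x) - R\<^sup>2 / 2 * (1 / real (Suc n))) \<longlonglongrightarrow> supp x (q x) - R\<^sup>2 / 2 * 0"
      by (intro tendsto_intros LIMSEQ_Suc[OF lim_1_over_n])
    then show "(\<lambda>n. supp x (q x) - R\<^sup>2 / (2 * real (Suc n))) \<longlonglongrightarrow> supp x (q x)" by simp
  qed auto
qed

text \<open>The gauge sup |z \<bullet> q| over \<open>G x\<close>: a seminorm in q that dominates
  every pairing in absolute value, so that one integrability condition covers q and -q.\<close>

definition asupp :: "'a \<Rightarrow> 'b \<Rightarrow> real" where "asupp x q = max (supp x q) (supp x (- q))"

lemma borel_measurable_asupp:
  "q \<in> borel_measurable M \<Longrightarrow> (\<lambda>x. asupp x (q x)) \<in> borel_measurable M"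
  unfolding asupp_def by (intro borel_measurable_max borel_measurable_supp) auto

lemma asupp_upper: "x \<in> space M \<Longrightarrow> z \<in> G x \<Longrightarrow> \<bar>z \<bullet> q\<bar> \<le> asupp x q"
  using supp_upper[of x z q] supp_upper[of x z "-q"] by (auto simp: asupp_def abs_if)

lemma asupp_least: "x \<in> space M \<Longrightarrow> (\<And>z. z \<in> G x \<Longrightarrow> \<bar>z \<bullet> q\<bar> \<le> r) \<Longrightarrow> asupp x q \<le> r"
  unfolding asupp_def by (rule max.boundedI; rule supp_least) (force simp: abs_le_iff)+

lemma asupp_nonneg: "x \<in> space M \<Longrightarrow> 0 \<le> asupp x q"
  by (metis abs_ge_zero asupp_upper order_trans supp_attained)

lemma abs_supp_le: "x \<in> space M \<Longrightarrow> \<bar>supp x q\<bar> \<le> asupp x q"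
  by (metis asupp_upper supp_attained)

lemma asupp_add: "x \<in> space M \<Longrightarrow> asupp x (q + r) \<le> asupp x q + asupp x r"
  by (rule asupp_least) (auto simp: inner_add_right intro!: order_trans[OF abs_triangle_ineq] add_mono asupp_upper)

lemma asupp_scaleR: "x \<in> space M \<Longrightarrow> asupp x (c *\<^sub>R q) \<le> \<bar>c\<bar> * asupp x q"
  by (rule asupp_least) (auto simp: abs_mult intro!: mult_left_mono asupp_upper)

text \<open>A bound for the norms in \<open>G x\<close> whose measurability is immediate, being a
  finite sum over basis vectors; the smallest bound would be a supremum over the set.\<close>

definition radius :: "'a \<Rightarrow> real" where "radius x = (\<Sum>b\<in>Basis. asupp x b)"

lemma borel_measurable_radius: "radius \<in> borel_measurable M"
  unfolding radius_def by (intro borel_measurable_sum borel_measurable_asupp) auto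

lemma norm_le_radius: "x \<in> space M \<Longrightarrow> z \<in> G x \<Longrightarrow> norm z \<le> radius x"
  unfolding radius_def by (rule order_trans[OF norm_le_l1]) (auto intro!: sum_mono asupp_upper)

lemma radius_nonneg: "x \<in> space M \<Longrightarrow> 0 \<le> radius x"
  unfolding radius_def by (intro sum_nonneg asupp_nonneg)

lemma asupp_le_radius: "x \<in> space M \<Longrightarrow> asupp x q \<le> radius x * norm q"
proof (rule asupp_least)
  fix z assume x: "x \<in> space M" and z: "z \<in> G x"
  have "\<bar>z \<bullet> q\<bar> \<le> norm z * norm q" by (rule Cauchy_Schwarz_ineq2)
  also have "\<dots> \<le> radius x * norm q" by (intro mult_right_mono norm_le_radius[OF x z]) auto
  finally show "\<bar>z \<bullet> q\<bar> \<le> radius x * norm q" .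
qed

text \<open>The test space of the duality: every selection pairs integrably with its members, and
  cutting a member off by an indicator stays inside, so integral inequalities can be
  localised.\<close>

definition pairable :: "('a \<Rightarrow> 'b) set" where
  "pairable = {q \<in> borel_measurable M. integrable M (\<lambda>x. asupp x (q x))}"

lemma pairableI:
  assumes "q \<in> borel_measurable M" "integrable M k" "AE x in M. asupp x (q x) \<le> k x"
  shows "q \<in> pairable"
  unfolding pairable_def using assms(1)
proof (intro CollectI conjI)
  show "integrable M (\<lambda>x. asupp x (q x))"
  proof (rule Bochner_Integration.integrable_bound[OF assms(2) borel_measurable_asupp[OF assms(1)]])
    show "AE x in M. norm (asupp x (q x)) \<le> norm (k x)"
      using assms(3) AE_space
    proof eventually_elim
      case (elim x)
      then show ?case using asupp_nonneg[of x "q x"] by simp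
    qed
  qed
qed

lemma pairable_add: "q \<in> pairable \<Longrightarrow> r \<in> pairable \<Longrightarrow> (\<lambda>x. q x + r x) \<in> pairable"
  by (rule pairableI[where k = "\<lambda>x. asupp x (q x) + asupp x (r x)"])
     (auto simp: pairable_def intro!: AE_I2 asupp_add)

lemma pairable_scale:
  assumes "q \<in> pairable" shows "(\<lambda>x. c *\<^sub>R q x) \<in> pairable"
  using assms by (intro pairableI[where k = "\<lambda>x. \<bar>c\<bar> * asupp x (q x)"])
     (auto simp: pairable_def intro!: AE_I2 asupp_scaleR)

lemma pairable_minus: "q \<in> pairable \<Longrightarrow> (\<lambda>x. - q x) \<in> pairable"
  using pairable_scale[of q "-1"] by simp

lemma integrable_supp: "q \<in> pairable \<Longrightarrow> integrable M (\<lambda>x. supp x (q x))"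
  by (rule Bochner_Integration.integrable_bound[where f = "\<lambda>x. asupp x (q x)"])
     (auto simp: pairable_def intro!: AE_I2 borel_measurable_supp order_trans[OF abs_supp_le abs_ge_self])

lemma
  assumes z: "z \<in> measurable_selections M G" and q: "q \<in> pairable"
  shows integrable_selection: "integrable M (\<lambda>x. z x \<bullet> q x)"
    and integral_selection_le: "(\<integral>x. z x \<bullet> q x \<partial>M) \<le> (\<integral>x. supp x (q x) \<partial>M)"
proof -
  have m: "z \<in> borel_measurable M" "AE x in M. z x \<in> G x" using z by (auto simp: measurable_selections_def)
  have qm: "q \<in> borel_measurable M" and i: "integrable M (\<lambda>x. asupp x (q x))"
    using q by (auto simp: pairable_def)
  show 1: "integrable M (\<lambda>x. z x \<bullet> q x)"
  proof (rule Bochner_Integration.integrable_bound[OF i])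
    show "(\<lambda>x. z x \<bullet> q x) \<in> borel_measurable M" using m(1) qm by measurable
    show "AE x in M. norm (z x \<bullet> q x) \<le> norm (asupp x (q x))"
      using m(2) AE_space
    proof eventually_elim
      case (elim x)
      then show ?case using asupp_upper[of x "z x" "q x"] by simp
    qed
  qed
  show "(\<integral>x. z x \<bullet> q x \<partial>M) \<le> (\<integral>x. supp x (q x) \<partial>M)"
  proof (rule integral_mono_AE[OF 1 integrable_supp[OF q]])
    show "AE x in M. z x \<bullet> q x \<le> supp x (q x)"
      using m(2) AE_space by eventually_elim (rule supp_upper)
  qed
qed

lemma closest_point_selection:
  assumes "c \<in> borel_measurable M"
  shows "(\<lambda>x. closest_point (G x) (c x)) \<in> measurable_selections M G"
  unfolding measurable_selections_def
  by (auto intro!: AE_I2 borel_measurable_closest_point[OF assms] closest_point_in_set nonempty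
      compact_imp_closed compact)

text \<open>The factor in front of q is a function of x: it must be large where
  \<open>radius x\<close> is large, so that the loss from \<open>supp_closest_point\<close> stays
  below \<open>k * \<eta> x\<close>, whose integral is at most \<epsilon>. Sigma-finiteness supplies
  the positive integrable \<eta>.\<close>

lemma near_optimal_selection:
  assumes q: "q \<in> pairable" and e: "\<epsilon> > 0"
  obtains z where "z \<in> measurable_selections M G"
    "(\<integral>x. supp x (q x) \<partial>M) - \<epsilon> \<le> (\<integral>x. z x \<bullet> q x \<partial>M)"
proof -
  have [measurable]: "q \<in> borel_measurable M" "radius \<in> borel_measurable M"
    using q borel_measurable_radius by (auto simp: pairable_def)
  obtain \<eta> :: "'a \<Rightarrow> real" where \<eta>: "\<eta> \<in> borel_measurable M" "\<And>x. 0 < \<eta> x" "integrable M \<eta>"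
    using obtain_positive_integrable_function by metis
  note [measurable] = \<eta>(1)
  define k where "k = \<epsilon> / ((\<integral>x. \<eta> x \<partial>M) + 1)"
  have I: "(\<integral>x. \<eta> x \<partial>M) \<ge> 0" using \<eta>(2) by (intro integral_nonneg_AE AE_I2) (auto intro: less_imp_le)
  have k: "k > 0" "k * (\<integral>x. \<eta> x \<partial>M) \<le> \<epsilon>" using I e by (auto simp: k_def field_simps)
  \<comment> \<open>The first summand brings the loss down to \<open>k * \<eta> x\<close>; adding 1
    keeps the factor positive where the radius vanishes.\<close>
  define n where "n x = (radius x)\<^sup>2 / (2 * k * \<eta> x) + 1" for x
  have n: "n x > 0" for x using k \<eta>(2)[of x] by (auto simp: n_def intro!: add_nonneg_pos divide_nonneg_pos)
  have nle: "(radius x)\<^sup>2 / (2 * n x) \<le> k * \<eta> x" for x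
  proof -
    have "(radius x)\<^sup>2 = ((radius x)\<^sup>2 / (2 * k * \<eta> x)) * (2 * k * \<eta> x)" using k \<eta>(2)[of x] by simp
    also have "\<dots> \<le> n x * (2 * k * \<eta> x)" unfolding n_def using k \<eta>(2)[of x]
      by (intro mult_right_mono) auto
    finally show ?thesis using n[of x] by (simp add: field_simps)
  qed
  have nm: "(\<lambda>x. n x *\<^sub>R q x) \<in> borel_measurable M" unfolding n_def by measurable
  define z where "z = (\<lambda>x. closest_point (G x) (n x *\<^sub>R q x))"
  have z: "z \<in> measurable_selections M G" unfolding z_def by (rule closest_point_selection[OF nm])
  have "(\<integral>x. supp x (q x) \<partial>M) - k * (\<integral>x. \<eta> x \<partial>M) = (\<integral>x. supp x (q x) - k * \<eta> x \<partial>M)"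
    using integrable_supp[OF q] \<eta>(3) by simp
  also have "\<dots> \<le> (\<integral>x. z x \<bullet> q x \<partial>M)"
  proof (rule integral_mono)
    show "integrable M (\<lambda>x. supp x (q x) - k * \<eta> x)" using integrable_supp[OF q] \<eta>(3) by auto
    show "integrable M (\<lambda>x. z x \<bullet> q x)" by (rule integrable_selection[OF z q])
    fix x assume x: "x \<in> space M"
    show "supp x (q x) - k * \<eta> x \<le> z x \<bullet> q x"
      using supp_closest_point[OF x n[of x] norm_le_radius[OF x], of "q x"] nle[of x]
      unfolding z_def by linarith
  qed
  finally show ?thesis using k z by (intro that[of z]) auto
qed

end

section \<open>Set functions with densities\<close>

text \<open>Test with the set where g < f: there f - g is positive while its integral is at most 0,
  so the set is null.\<close>

lemma AE_le_if_set_integrals_le: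
  fixes f g :: "'a \<Rightarrow> real"
  assumes "integrable M f" "integrable M g"
    and le: "\<And>E. E \<in> sets M \<Longrightarrow> (\<integral>x. indicator E x * f x \<partial>M) \<le> (\<integral>x. indicator E x * g x \<partial>M)"
  shows "AE x in M. f x \<le> g x"
proof -
  have [measurable]: "f \<in> borel_measurable M" "g \<in> borel_measurable M" using assms by auto
  define E where "E = {x \<in> space M. g x < f x}"
  have E: "E \<in> sets M" unfolding E_def by measurable
  have i: "integrable M (\<lambda>x. indicator E x * f x)" "integrable M (\<lambda>x. indicator E x * g x)"
    using integrable_mult_indicator[OF E assms(1)] integrable_mult_indicator[OF E assms(2)] by auto
  have "(\<integral>x. indicator E x * (f x - g x) \<partial>M) \<le> 0"
    using le[OF E] i by (simp add: algebra_simps)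
  moreover have nn: "AE x in M. 0 \<le> indicator E x * (f x - g x)"
    by (rule AE_I2) (auto simp: E_def indicator_def)
  ultimately have "(\<integral>x. indicator E x * (f x - g x) \<partial>M) = 0"
    using integral_nonneg_AE[OF nn] by linarith
  moreover have "integrable M (\<lambda>x. indicator E x * (f x - g x))" using i by (simp add: algebra_simps)
  ultimately have "AE x in M. indicator E x * (f x - g x) = 0"
    using nn integral_nonneg_eq_0_iff_AE by blast
  with AE_space show ?thesis
    by eventually_elim (auto simp: E_def indicator_def split: if_splits)
qed

text \<open>The bound by an integrable function turns finite additivity into countable additivity:
  along sets decreasing to the empty set it tends to 0 by dominated convergence. Adding the bound
  itself gives a finite positive measure that is absolutely continuous, and its Radon-Nikodym
  density is shifted back by \<eta>.\<close>

lemma finite_signed_density: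
  fixes \<nu> :: "'a set \<Rightarrow> real" and \<eta> :: "'a \<Rightarrow> real"
  assumes "sigma_finite_measure M"
    and \<eta>: "integrable M \<eta>" "\<And>x. x \<in> space M \<Longrightarrow> 0 \<le> \<eta> x"
    and add: "\<And>A B. A \<in> sets M \<Longrightarrow> B \<in> sets M \<Longrightarrow> A \<inter> B = {} \<Longrightarrow> \<nu> (A \<union> B) = \<nu> A + \<nu> B"
    and bd: "\<And>A. A \<in> sets M \<Longrightarrow> \<bar>\<nu> A\<bar> \<le> (\<integral>x. indicator A x * \<eta> x \<partial>M)"
  obtains y where "integrable M y" "\<And>A. A \<in> sets M \<Longrightarrow> \<nu> A = (\<integral>x. indicator A x * y x \<partial>M)"
proof -
  interpret sigma_finite_measure M by fact
  define I where "I A = (\<integral>x. indicator A x * \<eta> x \<partial>M)" for A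
  have ii: "integrable M (\<lambda>x. indicator A x * \<eta> x)" if "A \<in> sets M" for A
    using integrable_mult_indicator[OF that \<eta>(1)] by auto
  have Iadd: "I (A \<union> B) = I A + I B" if "A \<in> sets M" "B \<in> sets M" "A \<inter> B = {}" for A B
  proof -
    have "I (A \<union> B) = (\<integral>x. indicator A x * \<eta> x + indicator B x * \<eta> x \<partial>M)"
      unfolding I_def using that(3)
      by (intro Bochner_Integration.integral_cong) (auto simp: indicator_def)
    then show ?thesis unfolding I_def using ii that by simp
  qed
  define l where "l A = \<nu> A + I A" for A
  have l0: "0 \<le> l A" "l A \<le> 2 * I A" if "A \<in> sets M" for A
    using bd[OF that] unfolding l_def I_def by auto
  have ladd: "l (A \<union> B) = l A + l B" if "A \<in> sets M" "B \<in> sets M" "A \<inter> B = {}" for A B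
    using that by (simp add: l_def add Iadd)
  have lempty: "l {} = 0" using ladd[of "{}" "{}"] by simp
  have ca: "countably_additive (sets M) (\<lambda>A. ennreal (l A))"
  proof (rule sets.empty_continuous_imp_countably_additive)
    show "positive (sets M) (\<lambda>A. ennreal (l A))" by (simp add: positive_def lempty)
    show "additive (sets M) (\<lambda>A. ennreal (l A))"
      by (auto simp: additive_def ladd l0 ennreal_plus)
    show "\<forall>A\<in>sets M. ennreal (l A) \<noteq> \<infinity>" by simp
    fix A :: "nat \<Rightarrow> 'a set" assume A: "range A \<subseteq> sets M" "decseq A" "(\<Inter>i. A i) = {}"
    have As: "A i \<in> sets M" for i using A(1) by auto
    have "(\<lambda>i. I (A i)) \<longlonglongrightarrow> (\<integral>x. 0 \<partial>M)" unfolding I_def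
    proof (rule integral_dominated_convergence[OF _ _ \<eta>(1)])
      show "(\<lambda>x. indicator (A i) x * \<eta> x) \<in> borel_measurable M" for i using ii[OF As] by auto
      have "(\<lambda>i. indicator (A i) x * \<eta> x) \<longlonglongrightarrow> 0" for x
      proof -
        obtain i where "x \<notin> A i" using A(3) by auto
        then have "x \<notin> A j" if "j \<ge> i" for j using A(2) that by (auto simp: decseq_def)
        then have "\<forall>\<^sub>F j in sequentially. indicator (A j) x * \<eta> x = 0"
          by (intro eventually_sequentiallyI[of i]) simp
        then show ?thesis by (rule tendsto_eventually)
      qed
      then show "AE x in M. (\<lambda>i. indicator (A i) x * \<eta> x) \<longlonglongrightarrow> 0" by simp
      show "AE x in M. norm (indicator (A i) x * \<eta> x) \<le> \<eta> x" for i
        using \<eta>(2) by (intro AE_I2) (auto simp: indicator_def)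
    qed simp
    then have L: "(\<lambda>i. 2 * I (A i)) \<longlonglongrightarrow> 0" by (auto intro: tendsto_mult_right_zero)
    have "(\<lambda>i. l (A i)) \<longlonglongrightarrow> 0"
      by (rule tendsto_sandwich[OF _ _ tendsto_const L]) (use l0[OF As] in auto)
    then show "(\<lambda>i. ennreal (l (A i))) \<longlonglongrightarrow> 0" by (metis ennreal_0 tendsto_ennrealI)
  qed
  define N where "N = measure_of (space M) (sets M) (\<lambda>A. ennreal (l A))"
  have sN: "sets N = sets M" unfolding N_def by (simp add: sets.sets_measure_of_eq)
  have eN: "emeasure N A = ennreal (l A)" if "A \<in> sets M" for A
    unfolding N_def using ca that
    by (intro emeasure_measure_of_sigma) (auto simp: positive_def lempty sets.sigma_algebra_axioms)
  have "absolutely_continuous M N"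
  proof (unfold absolutely_continuous_def, rule subsetI)
    fix A assume "A \<in> null_sets M"
    then have A: "A \<in> sets M" "AE x in M. x \<notin> A" by (auto simp: null_sets_def AE_not_in)
    have "I A = (\<integral>x. 0 \<partial>M)" unfolding I_def
      using A ii[OF A(1)] by (intro integral_cong_AE) (auto elim!: eventually_mono)
    then show "A \<in> null_sets N" using l0[OF A(1)] A(1) by (auto simp: null_sets_def sN eN)
  qed
  from Radon_Nikodym[OF this sN] obtain g where g: "g \<in> borel_measurable M" "density M g = N" by auto
  have gint: "(\<integral>\<^sup>+x. g x * indicator A x \<partial>M) = ennreal (l A)" if "A \<in> sets M" for A
    using emeasure_density[OF g(1) that] eN[OF that] g(2) by simp
  have "(\<integral>\<^sup>+x. g x \<partial>M) = ennreal (l (space M))"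
    using gint[of "space M"] by (simp cong: nn_integral_cong)
  then have gfin: "AE x in M. g x \<noteq> \<infinity>" using nn_integral_PInf_AE[OF g(1)] by simp
  define r where "r x = enn2real (g x)" for x
  have r: "r \<in> borel_measurable M" "AE x in M. ennreal (r x) = g x" "\<And>x. 0 \<le> r x"
    using g(1) gfin by (auto simp: r_def[abs_def] elim!: eventually_mono intro!: ennreal_enn2real simp: less_top)
  have hb: "has_bochner_integral M (\<lambda>x. indicator A x * r x) (l A)" if A: "A \<in> sets M" for A
  proof (rule has_bochner_integral_nn_integral)
    show "(\<lambda>x. indicator A x * r x) \<in> borel_measurable M" using A r(1) by measurable
    show "AE x in M. 0 \<le> indicator A x * r x" using r(3) by simp
    show "0 \<le> l A" by (rule l0[OF A])
    have "(\<integral>\<^sup>+x. ennreal (indicator A x * r x) \<partial>M) = (\<integral>\<^sup>+x. g x * indicator A x \<partial>M)"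
      using r(2) by (intro nn_integral_cong_AE) (auto elim!: eventually_mono simp: indicator_def)
    then show "(\<integral>\<^sup>+x. ennreal (indicator A x * r x) \<partial>M) = ennreal (l A)" by (simp add: gint[OF A])
  qed
  show ?thesis
  proof
    have "integrable M r"
      using hb[of "space M"] by (auto simp: has_bochner_integral_iff cong: Bochner_Integration.integrable_cong)
    then show "integrable M (\<lambda>x. r x - \<eta> x)" using \<eta>(1) by simp
    fix A assume A: "A \<in> sets M"
    have "(\<integral>x. indicator A x * (r x - \<eta> x) \<partial>M) = l A - I A"
      using hb[OF A] ii[OF A] by (simp add: has_bochner_integral_iff right_diff_distrib I_def)
    then show "\<nu> A = (\<integral>x. indicator A x * (r x - \<eta> x) \<partial>M)" by (simp add: l_def)
  qed
qed

context compact_convex_map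
begin

text \<open>The null set in the assumption depends on q, so only countably many directions can be
  used at once. If \<open>z x\<close> lay outside the closed convex set, some direction would
  separate it strictly, and a nearby member of a countable dense set still separates.\<close>

lemma AE_in_if_AE_le_supp:
  assumes "\<And>q. AE x in M. z x \<bullet> q \<le> supp x q"
  shows "AE x in M. z x \<in> G x"
proof -
  obtain D :: "'b set" where D: "countable D" "\<And>X. open X \<Longrightarrow> X \<noteq> {} \<Longrightarrow> \<exists>d\<in>D. d \<in> X"
    using countable_dense_setE by metis
  have "AE x in M. \<forall>q\<in>D. z x \<bullet> q \<le> supp x q" using D(1) assms by (subst AE_ball_countable) auto
  with AE_space show ?thesis
  proof eventually_elim
    case (elim x)
    note x = elim(1)
    have cl: "closed (G x)" using compact[OF x] compact_imp_closed by auto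
    show ?case
    proof (rule ccontr)
      assume "z x \<notin> G x"
      from separating_hyperplane_closed_point[OF convex[OF x] cl this]
      obtain a b where ab: "a \<bullet> z x < b" "\<forall>y\<in>G x. b < a \<bullet> y" by auto
      \<comment> \<open>The gap of the separation divided by 1 plus a bound for the distance of
        \<open>z x\<close> from points of \<open>G x\<close>: moving the direction by less than this
        cannot close the gap. The separating functional is smaller at \<open>z x\<close> than on
        \<open>G x\<close>, hence a direction near \<open>- a\<close> violates the support
        inequality.\<close>
      define \<delta> where "\<delta> = (b - a \<bullet> z x) / (norm (z x) + radius x + 1)"
      have \<delta>: "\<delta> > 0" using ab radius_nonneg[OF x] by (auto simp: \<delta>_def intro!: divide_pos_pos add_nonneg_pos)
      obtain q where q: "q \<in> D" "q \<in> ball (- a) \<delta>" using D(2)[of "ball (-a) \<delta>"] \<delta> by auto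
      obtain y where y: "y \<in> G x" "y \<bullet> q = supp x q" using supp_attained[OF x] by metis
      have nq: "norm (q + a) < \<delta>" using q(2) by (simp add: dist_norm norm_minus_commute add.commute)
      have "(z x - y) \<bullet> q \<le> 0" using elim q y by (simp add: inner_diff_left)
      moreover have "(z x - y) \<bullet> q = (z x - y) \<bullet> (q + a) - a \<bullet> z x + a \<bullet> y"
        by (simp add: algebra_simps inner_commute)
      moreover have "\<bar>(z x - y) \<bullet> (q + a)\<bar> \<le> norm (z x - y) * norm (q + a)" by (rule Cauchy_Schwarz_ineq2)
      moreover have "norm (z x - y) * norm (q + a) \<le> (norm (z x) + radius x + 1) * \<delta>"
        using nq norm_le_radius[OF x y(1)] norm_triangle_ineq4[of "z x" y] radius_nonneg[OF x]
        by (intro mult_mono) auto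
      moreover have "(norm (z x) + radius x + 1) * \<delta> = b - a \<bullet> z x"
      proof -
        have "norm (z x) + radius x + 1 \<noteq> 0" using radius_nonneg[OF x] norm_ge_zero[of "z x"] by linarith
        then show ?thesis by (simp add: \<delta>_def)
      qed
      ultimately show False using ab y(1) by fastforce
    qed
  qed
qed

section \<open>Representation and compactness of dominated functionals\<close>

text \<open>Members are \<open>undefined\<close> off \<open>pairable\<close>, so that they are
  points of the product topology. The one-sided domination also bounds from below, because
  \<open>pairable\<close> contains - q together with q.\<close>

definition dominated_functionals :: "(('a \<Rightarrow> 'b) \<Rightarrow> real) set" where
  "dominated_functionals = {\<phi> \<in> extensional pairable.
     (\<forall>q\<in>pairable. \<forall>r\<in>pairable. \<phi> (\<lambda>x. q x + r x) = \<phi> q + \<phi> r) \<and>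
     (\<forall>c. \<forall>q\<in>pairable. \<phi> (\<lambda>x. c *\<^sub>R q x) = c * \<phi> q) \<and>
     (\<forall>q\<in>pairable. \<phi> q \<le> (\<integral>x. supp x (q x) \<partial>M))}"

lemma dominated_functionals_abs_le:
  assumes \<phi>: "\<phi> \<in> dominated_functionals" and q: "q \<in> pairable"
  shows "\<bar>\<phi> q\<bar> \<le> (\<integral>x. asupp x (q x) \<partial>M)"
proof -
  have i: "integrable M (\<lambda>x. asupp x (q x))" using q by (auto simp: pairable_def)
  have "\<phi> r \<le> (\<integral>x. asupp x (q x) \<partial>M)" if "r \<in> pairable" "r = q \<or> r = (\<lambda>x. - q x)" for r
  proof -
    have "\<phi> r \<le> (\<integral>x. supp x (r x) \<partial>M)" using \<phi> that by (auto simp: dominated_functionals_def)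
    also have "\<dots> \<le> (\<integral>x. asupp x (q x) \<partial>M)"
      by (rule integral_mono[OF integrable_supp[OF that(1)] i]) (use that(2) in \<open>auto simp: asupp_def\<close>)
    finally show ?thesis .
  qed
  from this[OF q] this[OF pairable_minus[OF q]]
  have "\<phi> q \<le> (\<integral>x. asupp x (q x) \<partial>M)" "\<phi> (\<lambda>x. - q x) \<le> (\<integral>x. asupp x (q x) \<partial>M)" by auto
  moreover have "\<phi> (\<lambda>x. (-1) *\<^sub>R q x) = -1 * \<phi> q"
    using \<phi> q unfolding dominated_functionals_def by blast
  ultimately show ?thesis by auto
qed

lemma selection_functional_dominated:
  assumes z: "z \<in> measurable_selections M G"
  shows "restrict (\<lambda>q. \<integral>x. z x \<bullet> q x \<partial>M) pairable \<in> dominated_functionals"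
  unfolding dominated_functionals_def
  by (auto simp: pairable_add pairable_scale inner_add_right integrable_selection[OF z]
      integral_selection_le[OF z])

text \<open>A density argument. Vanishing on weighted indicators extends to w s for all s integrable
  against \<open>radius x * w x\<close> by approximation with simple functions; a general q is
  truncated to the sets where |q| \<le> n w, and the rest has small gauge integral. The factor 2 in
  the bound fits the difference of two dominated functionals.\<close>

lemma dominated_functional_eq_0:
  fixes \<delta> :: "('a \<Rightarrow> 'b) \<Rightarrow> real"
  assumes add: "\<And>q r. q \<in> pairable \<Longrightarrow> r \<in> pairable \<Longrightarrow> \<delta> (\<lambda>x. q x + r x) = \<delta> q + \<delta> r"
    and bd: "\<And>q. q \<in> pairable \<Longrightarrow> \<bar>\<delta> q\<bar> \<le> 2 * (\<integral>x. asupp x (q x) \<partial>M)"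
    and w: "w \<in> borel_measurable M" "\<And>x. x \<in> space M \<Longrightarrow> 0 < w x" "integrable M (\<lambda>x. radius x * w x)"
    and zero: "\<And>A c. A \<in> sets M \<Longrightarrow> \<delta> (\<lambda>x. (indicator A x * w x) *\<^sub>R c) = 0"
    and q: "q \<in> pairable"
  shows "\<delta> q = 0"
proof -
  note [measurable] = w(1) borel_measurable_radius
  \<comment> \<open>The gauge integral of \<open>w x *\<^sub>R s x\<close> is at most the norm of s
    in L^1(N), so \<delta> is continuous along the limits taken in
    \<open>integrable_induct\<close>.\<close>
  define N where "N = density M (\<lambda>x. ennreal (radius x * w x))"
  have rw0: "0 \<le> radius x * w x" if "x \<in> space M" for x
    using radius_nonneg[OF that] w(2)[OF that] by simp
  have pw: "(\<lambda>x. w x *\<^sub>R s x) \<in> pairable"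
    if "s \<in> borel_measurable M" "integrable M (\<lambda>x. (radius x * w x) *\<^sub>R norm (s x))" for s :: "'a \<Rightarrow> 'b"
  proof (rule pairableI[OF _ that(2)])
    show "(\<lambda>x. w x *\<^sub>R s x) \<in> borel_measurable M" using that(1) by measurable
    show "AE x in M. asupp x (w x *\<^sub>R s x) \<le> (radius x * w x) *\<^sub>R norm (s x)"
      using w(2) by (intro AE_I2 order_trans[OF asupp_le_radius]) (auto simp: less_imp_le)
  qed
  have dm: "\<delta> (\<lambda>x. q x - r x) = \<delta> q - \<delta> r" if "q \<in> pairable" "r \<in> pairable" for q r
  proof -
    have "(\<lambda>x. q x - r x) \<in> pairable" using pairable_add[OF that(1) pairable_minus[OF that(2)]] by simp
    from add[OF this that(2)] show ?thesis by simp
  qed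
  have iN: "integrable N s \<longleftrightarrow> integrable M (\<lambda>x. (radius x * w x) *\<^sub>R s x)"
    if "s \<in> borel_measurable M" for s :: "'a \<Rightarrow> 'c::{banach, second_countable_topology}"
    unfolding N_def using that rw0 by (subst integrable_density) auto
  have sN: "sets N = sets M" "space N = space M" by (simp_all add: N_def)
  have N0: "\<delta> (\<lambda>x. w x *\<^sub>R s x) = 0" if "integrable N s" for s :: "'a \<Rightarrow> 'b"
    using that
  proof (induction rule: integrable_induct)
    case (base A c)
    have "A \<in> sets M" using base by (simp add: sN)
    from zero[OF this, of c] show ?case by (simp add: mult.commute)
  next
    case (add f g)
    have m: "f \<in> borel_measurable M" "g \<in> borel_measurable M"
      using add by (auto dest!: borel_measurable_integrable simp: measurable_cong_sets[OF sN(1)])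
    have "integrable N (\<lambda>x. norm (f x))" "integrable N (\<lambda>x. norm (g x))" using add by auto
    then have "(\<lambda>x. w x *\<^sub>R f x) \<in> pairable" "(\<lambda>x. w x *\<^sub>R g x) \<in> pairable"
      using m by (auto intro!: pw simp: iN)
    from assms(1)[OF this] show ?case using add by (simp add: scaleR_add_right)
  next
    case (lim f s)
    have m: "f \<in> borel_measurable M" "\<And>i. s i \<in> borel_measurable M"
      using borel_measurable_integrable[OF lim(4)] borel_measurable_integrable[OF lim(1)]
      by (simp_all add: measurable_cong_sets[OF sN(1) refl])
    have i: "integrable N (\<lambda>x. norm (f x))" "\<And>i. integrable N (\<lambda>x. norm (s i x))"
       "\<And>i. integrable N (\<lambda>x. norm (f x - s i x))" using lim by auto
    have p: "(\<lambda>x. w x *\<^sub>R f x) \<in> pairable" "(\<lambda>x. w x *\<^sub>R s i x) \<in> pairable"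
        "(\<lambda>x. w x *\<^sub>R (f x - s i x)) \<in> pairable" for i
      using m i by (auto intro!: pw simp: iN)
    have le: "\<bar>\<delta> (\<lambda>x. w x *\<^sub>R f x)\<bar> \<le> 2 * (\<integral>x. norm (f x - s i x) \<partial>N)" for i
    proof -
      have "\<delta> (\<lambda>x. w x *\<^sub>R f x) = \<delta> (\<lambda>x. w x *\<^sub>R (f x - s i x))"
        using dm[OF p(1) p(2)[of i]] lim by (simp add: scaleR_diff_right)
      then have "\<bar>\<delta> (\<lambda>x. w x *\<^sub>R f x)\<bar> \<le> 2 * (\<integral>x. asupp x (w x *\<^sub>R (f x - s i x)) \<partial>M)"
        using bd[OF p(3)[of i]] by simp
      also have "(\<integral>x. asupp x (w x *\<^sub>R (f x - s i x)) \<partial>M) \<le> (\<integral>x. (radius x * w x) *\<^sub>R norm (f x - s i x) \<partial>M)"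
        using p(3)[of i] i(3)[of i] m w(2)
        by (intro integral_mono order_trans[OF asupp_le_radius]) (auto simp: iN pairable_def less_imp_le)
      also have "\<dots> = (\<integral>x. norm (f x - s i x) \<partial>N)"
        unfolding N_def using m rw0 by (subst integral_density) auto
      finally show ?thesis by simp
    qed
    have "(\<lambda>i. \<integral>x. norm (f x - s i x) \<partial>N) \<longlonglongrightarrow> (\<integral>x. 0 \<partial>N)"
    proof (rule integral_dominated_convergence)
      show "integrable N (\<lambda>x. 3 * norm (f x))" using i by auto
      show "AE x in N. (\<lambda>i. norm (f x - s i x)) \<longlonglongrightarrow> 0"
      proof (rule AE_I2)
        fix x assume "x \<in> space N"
        from lim(2)[OF this] have "(\<lambda>i. f x - s i x) \<longlonglongrightarrow> f x - f x" by (intro tendsto_intros)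
        then show "(\<lambda>i. norm (f x - s i x)) \<longlonglongrightarrow> 0" by (simp add: tendsto_norm_zero)
      qed
      show "AE x in N. norm (norm (f x - s i x)) \<le> 3 * norm (f x)" for i
      proof (rule AE_I2)
        fix x assume "x \<in> space N"
        from lim(3)[OF this, of i] norm_triangle_ineq4[of "f x" "s i x"]
        show "norm (norm (f x - s i x)) \<le> 3 * norm (f x)" by simp
      qed
    qed (use i in auto)
    then have "(\<lambda>i. 2 * (\<integral>x. norm (f x - s i x) \<partial>N)) \<longlonglongrightarrow> 0" by (auto intro: tendsto_mult_right_zero)
    then have "\<bar>\<delta> (\<lambda>x. w x *\<^sub>R f x)\<bar> \<le> 0" by (rule LIMSEQ_le_const) (use le in auto)
    then show ?case by simp
  qed
  have qm[measurable]: "q \<in> borel_measurable M" and qi: "integrable M (\<lambda>x. asupp x (q x))"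
    using q by (auto simp: pairable_def)
  \<comment> \<open>On \<open>E n\<close> the quotient of q by w is bounded by n, hence integrable
    against \<open>radius x * w x\<close>; as w is positive, these sets exhaust
    \<open>space M\<close>.\<close>
  define E where "E n = {x \<in> space M. norm (q x) \<le> real n * w x}" for n
  have E[measurable]: "E n \<in> sets M" for n unfolding E_def by measurable
  define p where "p n x = indicator (E n) x *\<^sub>R q x" for n x
  define p' where "p' n x = indicator (space M - E n) x *\<^sub>R q x" for n x
  have pm: "p' n \<in> borel_measurable M" "p n \<in> borel_measurable M" for n
    unfolding p_def[abs_def] p'_def[abs_def] by measurable
  have asp': "asupp x (p' n x) \<le> asupp x (q x)" if "x \<in> space M" for x n
    unfolding p'_def using asupp_scaleR[OF that, of "indicator (space M - E n) x" "q x"] asupp_nonneg[OF that]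
    by (auto simp: indicator_def intro: order_trans split: if_splits)
  have asp: "asupp x (p n x) \<le> asupp x (q x)" if "x \<in> space M" for x n
    unfolding p_def using asupp_scaleR[OF that, of "indicator (E n) x" "q x"] asupp_nonneg[OF that]
    by (auto simp: indicator_def intro: order_trans split: if_splits)
  have pp: "p n \<in> pairable" "p' n \<in> pairable" for n
    using asp asp' pm by (auto intro!: pairableI[OF _ qi])
  have "\<delta> (p n) = 0" for n
  proof -
    have s: "(\<lambda>x. p n x /\<^sub>R w x) \<in> borel_measurable M" using pm by measurable
    have "integrable M (\<lambda>x. (radius x * w x) *\<^sub>R (p n x /\<^sub>R w x))"
    proof (rule Bochner_Integration.integrable_bound)
      show "integrable M (\<lambda>x. (radius x * w x) * real n)" using w(3) by auto
      show "(\<lambda>x. (radius x * w x) *\<^sub>R (p n x /\<^sub>R w x)) \<in> borel_measurable M" using s by measurable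
      have *: "norm (p n x /\<^sub>R w x) \<le> real n" if "x \<in> space M" for x
        using w(2)[OF that] by (auto simp: p_def E_def indicator_def field_simps)
      then show "AE x in M. norm ((radius x * w x) *\<^sub>R (p n x /\<^sub>R w x)) \<le> norm ((radius x * w x) * real n)"
      proof (intro AE_I2)
        fix x assume x: "x \<in> space M"
        have "norm ((radius x * w x) *\<^sub>R (p n x /\<^sub>R w x)) = (radius x * w x) * norm (p n x /\<^sub>R w x)"
          unfolding norm_scaleR using rw0[OF x] by simp
        also have "\<dots> \<le> (radius x * w x) * real n" by (intro mult_left_mono *[OF x] rw0[OF x])
        also have "\<dots> \<le> norm \<dots>" by simp
        finally show "norm ((radius x * w x) *\<^sub>R (p n x /\<^sub>R w x)) \<le> norm ((radius x * w x) * real n)" .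
      qed
    qed
    then have "\<delta> (\<lambda>x. w x *\<^sub>R (p n x /\<^sub>R w x)) = 0" by (intro N0) (simp add: iN[OF s])
    moreover have "w x *\<^sub>R (p n x /\<^sub>R w x) = p n x" for x
    proof (cases "x \<in> space M")
      case True then show ?thesis using w(2)[OF True] by simp
    next
      case False then show ?thesis by (simp add: p_def E_def)
    qed
    ultimately show ?thesis by simp
  qed
  \<comment> \<open>Functions are total, so q carries values off \<open>space M\<close> that no
    integral sees but \<delta> formally might. The third piece collects them; its gauge integral is
    0, which forces \<delta> to vanish on it.\<close>
  moreover have "\<delta> q = \<delta> (p n) + \<delta> (p' n) + \<delta> (\<lambda>x. indicator (- space M) x *\<^sub>R q x)" for n
  proof -
    have o: "(\<lambda>x. indicator (- space M) x *\<^sub>R q x) \<in> pairable"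
      by (rule pairableI[where k = "\<lambda>_. 0"])
         (auto simp: supp_zero asupp_def intro!: AE_I2 cong: measurable_cong_simp)
    have "q = (\<lambda>x. (p n x + p' n x) + indicator (- space M) x *\<^sub>R q x)"
      by (rule ext) (auto simp: p_def p'_def indicator_def E_def)
    then show ?thesis using add[OF pairable_add[OF pp] o, of n n] add[OF pp] by metis
  qed
  moreover have "\<delta> (\<lambda>x. indicator (- space M) x *\<^sub>R q x) = 0"
  proof -
    have o: "(\<lambda>x. indicator (- space M) x *\<^sub>R q x) \<in> pairable"
      by (rule pairableI[where k = "\<lambda>_. 0"])
         (auto simp: supp_zero asupp_def intro!: AE_I2 cong: measurable_cong_simp)
    have "(\<integral>x. asupp x (indicator (- space M) x *\<^sub>R q x) \<partial>M) = (\<integral>x. 0 \<partial>M)"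
      by (intro Bochner_Integration.integral_cong) (auto simp: asupp_def supp_zero)
    then show ?thesis using bd[OF o] by simp
  qed
  ultimately have le: "\<bar>\<delta> q\<bar> \<le> 2 * (\<integral>x. asupp x (p' n x) \<partial>M)" for n
    using bd[OF pp(2)[of n]] by simp
  have "(\<lambda>n. \<integral>x. asupp x (p' n x) \<partial>M) \<longlonglongrightarrow> (\<integral>x. 0 \<partial>M)"
  proof (rule integral_dominated_convergence[OF _ _ qi])
    show "(\<lambda>x. asupp x (p' n x)) \<in> borel_measurable M" for n by (rule borel_measurable_asupp[OF pm(1)])
    show "AE x in M. norm (asupp x (p' n x)) \<le> asupp x (q x)" for n
      using asp' asupp_nonneg by (intro AE_I2) auto
    show "AE x in M. (\<lambda>n. asupp x (p' n x)) \<longlonglongrightarrow> 0"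
    proof (rule AE_I2)
      fix x assume x: "x \<in> space M"
      obtain n where n: "norm (q x) / w x \<le> real n" using real_arch_simple by blast
      have "p' m x = 0" if "m \<ge> n" for m
      proof -
        have "norm (q x) \<le> real n * w x" using n w(2)[OF x] by (simp add: field_simps)
        also have "\<dots> \<le> real m * w x" using that w(2)[OF x] by (intro mult_right_mono) auto
        finally show ?thesis using x by (simp add: p'_def E_def)
      qed
      then have "\<forall>\<^sub>F m in sequentially. asupp x (p' m x) = 0"
        by (intro eventually_sequentiallyI[of n]) (simp add: asupp_def supp_zero[OF x])
      then show "(\<lambda>n. asupp x (p' n x)) \<longlonglongrightarrow> 0" by (rule tendsto_eventually)
    qed
  qed simp
  then have "(\<lambda>n. 2 * (\<integral>x. asupp x (p' n x) \<partial>M)) \<longlonglongrightarrow> 0" by (auto intro: tendsto_mult_right_zero)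
  then have "\<bar>\<delta> q\<bar> \<le> 0" by (rule LIMSEQ_le_const) (use le in auto)
  then show ?thesis by simp
qed

text \<open>For each basis vector b the value of \<phi> at w b cut off to A is an additive function
  of A with a density, and dividing these densities by w assembles the candidate Z. Domination
  tested on cut-offs localises to \<open>Z x \<bullet> q \<le> supp x q\<close>, which puts Z into
  \<open>G x\<close>; \<open>dominated_functional_eq_0\<close> then shows that Z represents \<phi>
  on all of \<open>pairable\<close>.\<close>

lemma dominated_functional_representation:
  assumes \<phi>: "\<phi> \<in> dominated_functionals"
  obtains z where "z \<in> measurable_selections M G" "\<phi> = restrict (\<lambda>q. \<integral>x. z x \<bullet> q x \<partial>M) pairable"
proof -
  note [measurable] = borel_measurable_radius
  have \<phi>ext: "\<phi> \<in> extensional pairable"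
    and \<phi>add: "\<And>q r. q \<in> pairable \<Longrightarrow> r \<in> pairable \<Longrightarrow> \<phi> (\<lambda>x. q x + r x) = \<phi> q + \<phi> r"
    and \<phi>scale: "\<And>c q. q \<in> pairable \<Longrightarrow> \<phi> (\<lambda>x. c *\<^sub>R q x) = c * \<phi> q"
    and \<phi>le: "\<And>q. q \<in> pairable \<Longrightarrow> \<phi> q \<le> (\<integral>x. supp x (q x) \<partial>M)"
    using \<phi> by (auto simp: dominated_functionals_def)
  note \<phi>abs = dominated_functionals_abs_le[OF \<phi>]
  obtain \<eta> :: "'a \<Rightarrow> real" where \<eta>: "\<eta> \<in> borel_measurable M" "\<And>x. 0 < \<eta> x" "integrable M \<eta>"
    using obtain_positive_integrable_function by metis
  note [measurable] = \<eta>(1)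
  \<comment> \<open>\<open>radius\<close> need be neither integrable nor bounded. This weight is
    positive and satisfies \<open>radius x * w x \<le> \<eta> x\<close>, so weighted indicators are
    pairable.\<close>
  define w where "w x = \<eta> x / (1 + radius x)" for x
  have wm[measurable]: "w \<in> borel_measurable M" unfolding w_def[abs_def] by measurable
  have wpos: "0 < w x" if "x \<in> space M" for x
    using \<eta>(2)[of x] radius_nonneg[OF that] by (auto simp: w_def)
  have rw: "0 \<le> radius x * w x" "radius x * w x \<le> \<eta> x" if "x \<in> space M" for x
    using \<eta>(2)[of x] radius_nonneg[OF that] by (auto simp: w_def field_simps)
  have irw: "integrable M (\<lambda>x. radius x * w x)"
    by (rule Bochner_Integration.integrable_bound[OF \<eta>(3)]) (use rw \<eta>(2) in \<open>auto intro!: AE_I2 simp: abs_of_nonneg less_imp_le\<close>)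
  have ip: "(\<lambda>x. (indicator A x * w x) *\<^sub>R c) \<in> pairable"
    and ile: "(\<integral>x. asupp x ((indicator A x * w x) *\<^sub>R c) \<partial>M) \<le> (\<integral>x. indicator A x * (norm c * (radius x * w x)) \<partial>M)"
    if A[measurable]: "A \<in> sets M" for A c
  proof -
    have i: "integrable M (\<lambda>x. indicator A x * (norm c * (radius x * w x)))"
      using integrable_mult_indicator[OF A, of "\<lambda>x. norm c * (radius x * w x)"] irw by auto
    have le: "asupp x ((indicator A x * w x) *\<^sub>R c) \<le> indicator A x * (norm c * (radius x * w x))"
      if x: "x \<in> space M" for x
      using asupp_le_radius[OF x, of "(indicator A x * w x) *\<^sub>R c"] wpos[OF x]
      by (auto simp: indicator_def ac_simps split: if_splits)
    show p: "(\<lambda>x. (indicator A x * w x) *\<^sub>R c) \<in> pairable"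
      by (rule pairableI[OF _ i]) (use le in \<open>auto intro!: AE_I2\<close>)
    show "(\<integral>x. asupp x ((indicator A x * w x) *\<^sub>R c) \<partial>M) \<le> (\<integral>x. indicator A x * (norm c * (radius x * w x)) \<partial>M)"
      by (rule integral_mono[OF _ i le]) (use p in \<open>auto simp: pairable_def\<close>)
  qed
  have "\<exists>y. integrable M y \<and> (\<forall>A\<in>sets M. \<phi> (\<lambda>x. (indicator A x * w x) *\<^sub>R b) = (\<integral>x. indicator A x * y x \<partial>M))" for b
  proof (rule finite_signed_density[OF sigma_finite_measure_axioms,
        where \<eta> = "\<lambda>x. norm b * (radius x * w x)" and \<nu> = "\<lambda>A. \<phi> (\<lambda>x. (indicator A x * w x) *\<^sub>R b)"])
    show "integrable M (\<lambda>x. norm b * (radius x * w x))" using irw by auto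
    show "0 \<le> norm b * (radius x * w x)" if "x \<in> space M" for x using rw[OF that] by simp
    show "\<phi> (\<lambda>x. (indicator (A \<union> B) x * w x) *\<^sub>R b)
      = \<phi> (\<lambda>x. (indicator A x * w x) *\<^sub>R b) + \<phi> (\<lambda>x. (indicator B x * w x) *\<^sub>R b)"
      if "A \<in> sets M" "B \<in> sets M" "A \<inter> B = {}" for A B
    proof -
      have "(\<lambda>x. (indicator (A \<union> B) x * w x) *\<^sub>R b)
          = (\<lambda>x. (indicator A x * w x) *\<^sub>R b + (indicator B x * w x) *\<^sub>R b)"
        using that(3) by (auto simp: indicator_def fun_eq_iff)
      then show ?thesis using \<phi>add[OF ip[OF that(1)] ip[OF that(2)]] by simp
    qed
    show "\<bar>\<phi> (\<lambda>x. (indicator A x * w x) *\<^sub>R b)\<bar> \<le> (\<integral>x. indicator A x * (norm b * (radius x * w x)) \<partial>M)"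
      if "A \<in> sets M" for A
      using order_trans[OF \<phi>abs[OF ip[OF that]] ile[OF that]] .
  qed blast
  then obtain y where y: "\<And>b. integrable M (y b)"
     "\<And>A b. A \<in> sets M \<Longrightarrow> \<phi> (\<lambda>x. (indicator A x * w x) *\<^sub>R b) = (\<integral>x. indicator A x * y b x \<partial>M)"
    by metis
  define Z where "Z x = (\<Sum>b\<in>Basis. (y b x / w x) *\<^sub>R b)" for x
  have Zm: "Z \<in> borel_measurable M"
    unfolding Z_def[abs_def] using y(1) by (intro borel_measurable_sum) (auto dest!: borel_measurable_integrable)
  have ZI: "integrable M (\<lambda>x. indicator A x * (w x * (Z x \<bullet> c)))"
      "(\<integral>x. indicator A x * (w x * (Z x \<bullet> c)) \<partial>M) = \<phi> (\<lambda>x. (indicator A x * w x) *\<^sub>R c)"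
    if A: "A \<in> sets M" for A c
  proof -
    have eq: "indicator A x * (w x * (Z x \<bullet> c)) = (\<Sum>b\<in>Basis. (c \<bullet> b) * (indicator A x * y b x))"
      if x: "x \<in> space M" for x
    proof -
      have "w x * (Z x \<bullet> c) = (\<Sum>b\<in>Basis. (c \<bullet> b) * y b x)"
        unfolding Z_def inner_sum_left sum_distrib_left
        by (rule sum.cong) (use wpos[OF x] in \<open>auto simp: inner_commute\<close>)
      then show ?thesis by (simp only: sum_distrib_left mult.left_commute)
    qed
    have ib: "integrable M (\<lambda>x. indicator A x * y b x)" for b
      using integrable_mult_indicator[OF A y(1)] by auto
    have isum: "integrable M (\<lambda>x. \<Sum>b\<in>Basis. (c \<bullet> b) * (indicator A x * y b x))" using ib by auto
    then show "integrable M (\<lambda>x. indicator A x * (w x * (Z x \<bullet> c)))"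
      by (simp add: eq cong: Bochner_Integration.integrable_cong)
    have "(\<integral>x. indicator A x * (w x * (Z x \<bullet> c)) \<partial>M) = (\<Sum>b\<in>Basis. (c \<bullet> b) * \<phi> (\<lambda>x. (indicator A x * w x) *\<^sub>R b))"
      using ib by (simp add: eq y(2)[OF A] cong: Bochner_Integration.integral_cong)
    also have "\<dots> = \<phi> (\<lambda>x. (indicator A x * w x) *\<^sub>R c)"
    proof -
      have "\<phi> (\<lambda>x. \<Sum>b\<in>B. (c \<bullet> b) *\<^sub>R ((indicator A x * w x) *\<^sub>R b)) = (\<Sum>b\<in>B. (c \<bullet> b) * \<phi> (\<lambda>x. (indicator A x * w x) *\<^sub>R b))
         \<and> (\<lambda>x. \<Sum>b\<in>B. (c \<bullet> b) *\<^sub>R ((indicator A x * w x) *\<^sub>R b)) \<in> pairable" if "finite B" for B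
        using that
      proof induction
        case empty
        have "(\<lambda>x. 0 :: 'b) \<in> pairable" using ip[OF A, of 0] by simp
        then show ?case using \<phi>scale[of "\<lambda>x. 0" 0] by simp
      next
        case (insert b B)
        have "(\<lambda>x. (c \<bullet> b) *\<^sub>R ((indicator A x * w x) *\<^sub>R b)) \<in> pairable" by (rule pairable_scale[OF ip[OF A]])
        from \<phi>add[OF this] pairable_add[OF this] \<phi>scale[OF ip[OF A]] insert show ?case by simp
      qed
      from this[OF finite_Basis] have "(\<Sum>b\<in>Basis. (c \<bullet> b) * \<phi> (\<lambda>x. (indicator A x * w x) *\<^sub>R b))
         = \<phi> (\<lambda>x. \<Sum>b\<in>Basis. (c \<bullet> b) *\<^sub>R ((indicator A x * w x) *\<^sub>R b))" by simp
      also have "(\<lambda>x. \<Sum>b\<in>Basis. (c \<bullet> b) *\<^sub>R ((indicator A x * w x) *\<^sub>R b)) = (\<lambda>x. (indicator A x * w x) *\<^sub>R c)"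
      proof
        fix x
        have "(\<Sum>b\<in>Basis. (c \<bullet> b) *\<^sub>R ((indicator A x * w x) *\<^sub>R b)) = (indicator A x * w x) *\<^sub>R (\<Sum>b\<in>Basis. (c \<bullet> b) *\<^sub>R b)"
          by (simp add: scaleR_sum_right mult.commute)
        then show "(\<Sum>b\<in>Basis. (c \<bullet> b) *\<^sub>R ((indicator A x * w x) *\<^sub>R b)) = (indicator A x * w x) *\<^sub>R c"
          by (simp add: euclidean_representation)
      qed
      finally show ?thesis .
    qed
    finally show "(\<integral>x. indicator A x * (w x * (Z x \<bullet> c)) \<partial>M) = \<phi> (\<lambda>x. (indicator A x * w x) *\<^sub>R c)" .
  qed
  have "AE x in M. Z x \<in> G x"
  proof (rule AE_in_if_AE_le_supp)
    fix q
    have iq: "integrable M (\<lambda>x. w x * supp x q)"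
    proof (rule Bochner_Integration.integrable_bound)
      show "integrable M (\<lambda>x. norm q * (radius x * w x))" using irw by auto
      show "(\<lambda>x. w x * supp x q) \<in> borel_measurable M" using borel_measurable_supp[of "\<lambda>_. q"] by measurable
      show "AE x in M. norm (w x * supp x q) \<le> norm (norm q * (radius x * w x))"
      proof (rule AE_I2)
        fix x assume x: "x \<in> space M"
        have "w x * \<bar>supp x q\<bar> \<le> w x * (radius x * norm q)"
          using order_trans[OF abs_supp_le[OF x] asupp_le_radius[OF x]] wpos[OF x] by (intro mult_left_mono) auto
        then show "norm (w x * supp x q) \<le> norm (norm q * (radius x * w x))"
          using wpos[OF x] rw[OF x] radius_nonneg[OF x] by (simp add: abs_mult ac_simps)
      qed
    qed
    have iZ: "integrable M (\<lambda>x. w x * (Z x \<bullet> q))"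
      using ZI(1)[of "space M" q] by (simp cong: Bochner_Integration.integrable_cong)
    \<comment> \<open>The support function is positively homogeneous, so domination at
      \<open>(indicator E x * w x) *\<^sub>R q\<close> compares the two integrals over E, for every
      measurable set E.\<close>
    have "AE x in M. w x * (Z x \<bullet> q) \<le> w x * supp x q"
    proof (rule AE_le_if_set_integrals_le[OF iZ iq])
      fix E assume E: "E \<in> sets M"
      have "(\<integral>x. indicator E x * (w x * (Z x \<bullet> q)) \<partial>M) \<le> (\<integral>x. supp x ((indicator E x * w x) *\<^sub>R q) \<partial>M)"
        unfolding ZI(2)[OF E] by (rule \<phi>le[OF ip[OF E]])
      also have "\<dots> = (\<integral>x. indicator E x * (w x * supp x q) \<partial>M)"
        by (intro Bochner_Integration.integral_cong refl) (simp add: supp_scaleR wpos less_imp_le mult.assoc)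
      finally show "(\<integral>x. indicator E x * (w x * (Z x \<bullet> q)) \<partial>M) \<le> (\<integral>x. indicator E x * (w x * supp x q) \<partial>M)" .
    qed
    with AE_space show "AE x in M. Z x \<bullet> q \<le> supp x q"
      by eventually_elim (use wpos in auto)
  qed
  then have Z: "Z \<in> measurable_selections M G" using Zm by (simp add: measurable_selections_def)
  define \<psi> where "\<psi> = restrict (\<lambda>q. \<integral>x. Z x \<bullet> q x \<partial>M) pairable"
  have \<psi>: "\<psi> \<in> dominated_functionals" unfolding \<psi>_def by (rule selection_functional_dominated[OF Z])
  have "\<phi> q - \<psi> q = 0" if q: "q \<in> pairable" for q
  proof (rule dominated_functional_eq_0[where \<delta> = "\<lambda>q. \<phi> q - \<psi> q", OF _ _ wm wpos irw _ q])
    show "\<phi> (\<lambda>x. q x + r x) - \<psi> (\<lambda>x. q x + r x) = (\<phi> q - \<psi> q) + (\<phi> r - \<psi> r)"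
      if "q \<in> pairable" "r \<in> pairable" for q r
      using \<phi>add[OF that] \<psi> that by (simp add: dominated_functionals_def)
    show "\<bar>\<phi> q - \<psi> q\<bar> \<le> 2 * (\<integral>x. asupp x (q x) \<partial>M)" if "q \<in> pairable" for q
      using \<phi>abs[OF that] dominated_functionals_abs_le[OF \<psi> that] by linarith
    show "\<phi> (\<lambda>x. (indicator A x * w x) *\<^sub>R c) - \<psi> (\<lambda>x. (indicator A x * w x) *\<^sub>R c) = 0"
      if A: "A \<in> sets M" for A c
      using ZI(2)[OF A, of c] ip[OF A, of c] by (simp add: \<psi>_def mult.assoc)
  qed
  then have "\<phi> = \<psi>" using \<phi>ext \<psi> by (auto simp: dominated_functionals_def intro!: extensionalityI)
  then show ?thesis using Z that unfolding \<psi>_def by blast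
qed

lemma dominated_functionals_eq:
  "dominated_functionals = (\<lambda>z. restrict (\<lambda>q. \<integral>x. z x \<bullet> q x \<partial>M) pairable) ` measurable_selections M G"
proof (intro equalityI subsetI)
  fix \<phi> assume "\<phi> \<in> dominated_functionals"
  then show "\<phi> \<in> (\<lambda>z. restrict (\<lambda>q. \<integral>x. z x \<bullet> q x \<partial>M) pairable) ` measurable_selections M G"
    by (rule dominated_functional_representation) blast
next
  fix \<phi> assume "\<phi> \<in> (\<lambda>z. restrict (\<lambda>q. \<integral>x. z x \<bullet> q x \<partial>M) pairable) ` measurable_selections M G"
  then show "\<phi> \<in> dominated_functionals" using selection_functional_dominated by blast
qed

lemma compactin_dominated_functionals:
  "compactin (product_topology (\<lambda>_. euclideanreal) pairable) dominated_functionals"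
proof -
  let ?X = "product_topology (\<lambda>_ :: 'a \<Rightarrow> 'b. euclideanreal) pairable"
  define B where "B q = (\<integral>x. asupp x (q x) \<partial>M)" for q
  have T: "topspace ?X = extensional pairable" by (simp add: PiE_def)
  have ev: "continuous_map ?X euclideanreal (\<lambda>\<phi>. \<phi> q)" if "q \<in> pairable" for q
    using continuous_map_product_projection[OF that, of "\<lambda>_. euclideanreal"] by simp
  \<comment> \<open>Every clause of the definition has this shape: a continuous combination of
    finitely many evaluations lies in a closed set. The empty index set is split off because
    \<open>closedin_INT\<close> excludes it.\<close>
  have cl: "closedin ?X {\<phi> \<in> topspace ?X. \<forall>i\<in>I. h i \<phi> \<in> C i}"
    if "\<And>i. i \<in> I \<Longrightarrow> continuous_map ?X euclideanreal (h i)" "\<And>i. i \<in> I \<Longrightarrow> closed (C i)"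
    for I :: "'i set" and h C
  proof (cases "I = {}")
    case False
    have "closedin ?X (\<Inter>i\<in>I. {\<phi> \<in> topspace ?X. h i \<phi> \<in> C i})"
      by (rule closedin_INT[OF False], rule closedin_continuous_map_preimage[OF that(1)])
         (use that(2) in auto)
    moreover have "(\<Inter>i\<in>I. {\<phi> \<in> topspace ?X. h i \<phi> \<in> C i}) = {\<phi> \<in> topspace ?X. \<forall>i\<in>I. h i \<phi> \<in> C i}"
      using False by blast
    ultimately show ?thesis by simp
  next
    case True
    then have "{\<phi> \<in> topspace ?X. \<forall>i\<in>I. h i \<phi> \<in> C i} = topspace ?X" by blast
    then show ?thesis by (simp only: closedin_topspace)
  qed
  have "closedin ?X ({\<phi> \<in> topspace ?X. \<forall>i\<in>pairable \<times> pairable.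
        \<phi> (\<lambda>x. fst i x + snd i x) - (\<phi> (fst i) + \<phi> (snd i)) \<in> {0}} \<inter>
      {\<phi> \<in> topspace ?X. \<forall>i\<in>UNIV \<times> pairable. \<phi> (\<lambda>x. fst i *\<^sub>R snd i x) - fst i * \<phi> (snd i) \<in> {0}} \<inter>
      {\<phi> \<in> topspace ?X. \<forall>q\<in>pairable. \<phi> q \<in> {..(\<integral>x. supp x (q x) \<partial>M)}})"
    by (intro closedin_Int cl continuous_map_diff continuous_map_add continuous_map_real_mult_left ev
        closed_singleton closed_atMost) (auto intro!: pairable_add pairable_scale)
  moreover have "({\<phi> \<in> topspace ?X. \<forall>i\<in>pairable \<times> pairable.
        \<phi> (\<lambda>x. fst i x + snd i x) - (\<phi> (fst i) + \<phi> (snd i)) \<in> {0}} \<inter>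
      {\<phi> \<in> topspace ?X. \<forall>i\<in>UNIV \<times> pairable. \<phi> (\<lambda>x. fst i *\<^sub>R snd i x) - fst i * \<phi> (snd i) \<in> {0}} \<inter>
      {\<phi> \<in> topspace ?X. \<forall>q\<in>pairable. \<phi> q \<in> {..(\<integral>x. supp x (q x) \<partial>M)}})
      = dominated_functionals" (is "?L = ?R")
  proof (rule set_eqI)
    fix \<phi>
    show "\<phi> \<in> ?L \<longleftrightarrow> \<phi> \<in> ?R" unfolding T dominated_functionals_def by simp blast
  qed
  ultimately have closed: "closedin ?X dominated_functionals" by (simp only:)
  have cK: "compactin ?X (PiE pairable (\<lambda>q. {- B q..B q}))"
    by (subst compactin_PiE) auto
  have sub: "dominated_functionals \<subseteq> PiE pairable (\<lambda>q. {- B q..B q})"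
  proof
    fix \<phi> assume \<phi>: "\<phi> \<in> dominated_functionals"
    show "\<phi> \<in> PiE pairable (\<lambda>q. {- B q..B q})"
    proof (rule PiE_I)
      fix q assume "q \<in> pairable"
      from dominated_functionals_abs_le[OF \<phi> this] show "\<phi> q \<in> {- B q..B q}"
        by (auto simp: B_def)
    qed (use \<phi> in \<open>auto simp: dominated_functionals_def extensional_def\<close>)
  qed
  show ?thesis by (rule closed_compactin[OF cK sub closed])
qed

end

section \<open>Codifferentials in Euclidean spaces\<close>

text \<open>Codifferentiability controls increments only in forward directions and need not give a
  derivative, so the usual mean value theorem does not apply. Instead let m be the infimum of the
  points where the \<epsilon>-weakened estimate fails: by continuity the estimate holds at m, and
  the local bound at m carries it past m.\<close>

lemma abs_increment_le_if_dini_bound: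
  fixes g :: "real \<Rightarrow> real"
  assumes cont: "continuous_on {0..1} g"
    and dini: "\<And>t \<epsilon>. 0 \<le> t \<Longrightarrow> t < 1 \<Longrightarrow> 0 < \<epsilon> \<Longrightarrow>
      \<forall>\<^sub>F \<alpha> in at_right 0. \<bar>g (t + \<alpha>) - g t\<bar> \<le> (K + \<epsilon>) * \<alpha>"
  shows "\<bar>g 1 - g 0\<bar> \<le> K"
proof (rule field_le_epsilon)
  fix \<epsilon> :: real assume \<epsilon>: "\<epsilon> > 0"
  show "\<bar>g 1 - g 0\<bar> \<le> K + \<epsilon>"
  proof (rule ccontr)
    assume bad1: "\<not> \<bar>g 1 - g 0\<bar> \<le> K + \<epsilon>"
    define k where "k t = \<bar>g t - g 0\<bar> - (K + \<epsilon>) * t" for t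
    define B where "B = {t \<in> {0..1}. 0 < k t}"
    have kc: "continuous_on {0..1} k" unfolding k_def using cont by (intro continuous_intros)
    have B: "1 \<in> B" "bdd_below B" using bad1 by (auto simp: B_def k_def intro!: bdd_belowI[of _ 0])
    define m where "m = Inf B"
    have m: "0 \<le> m" "m \<le> 1" using B by (auto simp: m_def B_def intro!: cInf_greatest cInf_lower)
    have good: "k t \<le> 0" if "0 \<le> t" "t < m" for t
      using cInf_lower[OF _ B(2), of t] that m by (force simp: B_def m_def not_le)
    have gm: "k m \<le> 0"
    proof (cases "m = 0")
      case False
      then have "m > 0" using m by simp
      have "closed {t \<in> {0..m}. k t \<le> 0}"
        using continuous_on_subset[OF kc, of "{0..m}"] m
        by (intro continuous_on_closed_Collect_le) (auto intro: continuous_intros)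
      moreover have "{0..<m} \<subseteq> {t \<in> {0..m}. k t \<le> 0}" using good by auto
      ultimately have "closure {0..<m} \<subseteq> {t \<in> {0..m}. k t \<le> 0}" by (rule closure_minimal[rotated])
      moreover have "m \<in> closure {0..<m}" using \<open>m > 0\<close> by simp
      ultimately show ?thesis by blast
    qed (simp add: k_def)
    have "m < 1" using gm B(1) m by (cases "m = 1") (auto simp: B_def)
    from dini[OF m(1) this \<epsilon>] obtain b where b: "b > 0"
      "\<And>\<alpha>. 0 < \<alpha> \<Longrightarrow> \<alpha> < b \<Longrightarrow> \<bar>g (m + \<alpha>) - g m\<bar> \<le> (K + \<epsilon>) * \<alpha>"
      by (auto simp: eventually_at_right_field)
    have "m + b \<le> t" if t: "t \<in> B" for t
    proof (rule ccontr)
      assume "\<not> m + b \<le> t"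
      moreover have "m \<le> t" using cInf_lower[OF t B(2)] by (simp add: m_def)
      moreover have "t \<noteq> m" using t gm by (auto simp: B_def)
      ultimately have "\<bar>g t - g m\<bar> \<le> (K + \<epsilon>) * (t - m)" using b(2)[of "t - m"] by auto
      then have "k t \<le> 0" using gm unfolding k_def by (simp add: right_diff_distrib)
      then show False using t by (simp add: B_def)
    qed
    then have "m + b \<le> m" unfolding m_def using B(1) by (intro cInf_greatest) auto
    then show False using b(1) by simp
  qed
qed

lemma hypo_fun_riesz: "hypo_fun (riesz ` A) h = (SUP (a, v)\<in>A. a + v \<bullet> h)"
  unfolding hypo_fun_def riesz_def by (simp add: image_image case_prod_unfold)

lemma hyper_fun_riesz: "hyper_fun (riesz ` A) h = (INF (a, v)\<in>A. a + v \<bullet> h)"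
  unfolding hyper_fun_def riesz_def by (simp add: image_image case_prod_unfold)

lemma convex_if_convex_riesz:
  assumes "convex_real_dual UNIV (riesz ` A)" shows "convex A"
proof (rule convexI)
  fix x y and s t :: real assume x: "x \<in> A" "y \<in> A" and st: "0 \<le> s" "0 \<le> t" "s + t = 1"
  obtain a v b w where xy: "x = (a, v)" "y = (b, w)" by (cases x, cases y)
  have s: "s = 1 - t" using st by simp
  have "riesz x \<in> riesz ` A" "riesz y \<in> riesz ` A" "t \<in> {0..1}" using x st by auto
  then have "((1 - t) * a + t * b, restrict (\<lambda>h. (1 - t) * (v \<bullet> h) + t * (w \<bullet> h)) UNIV) \<in> riesz ` A"
    using assms unfolding convex_real_dual_def riesz_def xy by fastforce
  then obtain c y' where c: "(c, y') \<in> A" "c = (1 - t) * a + t * b"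
      "restrict (\<lambda>h. (1 - t) * (v \<bullet> h) + t * (w \<bullet> h)) UNIV = (\<lambda>h. y' \<bullet> h)"
    by (auto simp: riesz_def)
  have "y' \<bullet> h = ((1 - t) *\<^sub>R v + t *\<^sub>R w) \<bullet> h" for h
    using fun_cong[OF c(3), of h] by (simp add: inner_add_left)
  then have "y' = (1 - t) *\<^sub>R v + t *\<^sub>R w" by (metis vector_eq_rdot)
  then show "s *\<^sub>R x + t *\<^sub>R y \<in> A" using c by (simp add: xy s)
qed

text \<open>\<open>riesz\<close> is inverted by reading off the values of a functional at the basis
  vectors, and these evaluations are continuous for the weak* topology.\<close>

lemma compact_if_compactin_riesz:
  fixes A :: "(real \<times> 'a::euclidean_space) set"
  assumes "compactin (prod_topology euclideanreal (weak_star UNIV norm)) (riesz ` A)"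
  shows "compact A"
proof -
  let ?T = "prod_topology euclideanreal (weak_star UNIV (norm :: 'a \<Rightarrow> real))"
  define \<iota> :: "real \<times> ('a \<Rightarrow> real) \<Rightarrow> real \<times> 'a" where "\<iota> p = (fst p, \<Sum>b\<in>Basis. snd p b *\<^sub>R b)" for p
  have ev: "continuous_map ?T euclideanreal (\<lambda>p. snd p b)" for b
  proof -
    have "continuous_map (weak_star UNIV norm) euclideanreal (\<lambda>\<phi> :: 'a \<Rightarrow> real. \<phi> b)"
      unfolding weak_star_def by (intro continuous_map_from_subtopology) 
        (use continuous_map_product_projection[of b UNIV "\<lambda>_. euclideanreal"] in simp)
    from continuous_map_compose[OF continuous_map_snd this] show ?thesis by (simp add: o_def)
  qed
  have "continuous_map ?T (prod_topology euclideanreal euclidean) \<iota>"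
  proof (unfold continuous_map_pairwise, intro conjI)
    show "continuous_map ?T euclideanreal (fst \<circ> \<iota>)"
      using continuous_map_fst[of euclideanreal "weak_star UNIV (norm :: 'a \<Rightarrow> real)"] by (simp add: o_def \<iota>_def)
    have "continuous_map ?T euclidean (\<lambda>p. \<Sum>b\<in>Basis. snd p b *\<^sub>R b :: 'a)"
    proof (intro continuous_map_sum continuous_map_compose[OF ev, unfolded o_def])
      show "continuous_map euclideanreal euclidean (\<lambda>r. r *\<^sub>R b :: 'a)" for b
        by (simp add: continuous_intros)
    qed auto
    then show "continuous_map ?T euclidean (snd \<circ> \<iota>)" by (simp add: o_def \<iota>_def)
  qed
  from image_compactin[OF assms this] have "compactin euclidean (\<iota> ` riesz ` A)"
    by (simp add: euclidean_product_topology)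
  moreover have "\<iota> (riesz x) = x" for x
    by (cases x) (simp add: \<iota>_def riesz_def euclidean_representation)
  ultimately show ?thesis by (simp add: image_image)
qed

lemma euclidean_codifferentialD:
  assumes "is_euclidean_codifferential F x A B"
  shows "A \<noteq> {}" "convex A" "compact A" "B \<noteq> {}" "convex B" "compact B"
    "(SUP (a, v)\<in>A. a) = 0" "(INF (b, w)\<in>B. b) = 0"
    "((\<lambda>\<alpha>. 1 / \<alpha> * \<bar>F (x + \<alpha> *\<^sub>R h) - F x - (SUP (a, v)\<in>A. a + v \<bullet> (\<alpha> *\<^sub>R h))
       - (INF (b, w)\<in>B. b + w \<bullet> (\<alpha> *\<^sub>R h))\<bar>) \<longlongrightarrow> 0) (at_right 0)"
  using assms unfolding is_euclidean_codifferential_def is_codifferential_def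
  by (auto simp: hypo_fun_riesz hyper_fun_riesz dest: convex_if_convex_riesz compact_if_compactin_riesz)

text \<open>The normalisation forces a \<le> 0 on A with equality at some point, so the constant
  terms do not spoil the estimate: the supremum is at most L and at least the value of v \<bullet> h
  at that point. This makes the codifferential terms of first order in h.\<close>

lemma abs_SUP_affine_le:
  fixes A :: "(real \<times> 'a::euclidean_space) set"
  assumes A: "A \<noteq> {}" "compact A" "(SUP (a, v)\<in>A. a) = 0"
    and L: "\<And>a v. (a, v) \<in> A \<Longrightarrow> \<bar>v \<bullet> h\<bar> \<le> L"
  shows "\<bar>SUP (a, v)\<in>A. a + v \<bullet> h\<bar> \<le> L"
proof -
  have "continuous_on A fst" by (intro continuous_intros)
  from continuous_attains_sup[OF A(2,1) this] obtain a0 v0 where a0: "(a0, v0) \<in> A" "\<And>a v. (a, v) \<in> A \<Longrightarrow> a \<le> a0"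
    by fastforce
  have "(SUP (a, v)\<in>A. a) = a0" by (rule cSup_eq_maximum) (use a0 in force)+
  then have [simp]: "a0 = 0" using A(3) by simp
  have u: "a + v \<bullet> h \<le> L" if "(a, v) \<in> A" for a v using L[OF that] a0(2)[OF that] by simp
  have "(SUP (a, v)\<in>A. a + v \<bullet> h) \<le> L" using A(1) u by (intro cSUP_least) auto
  moreover have "0 + v0 \<bullet> h \<le> (SUP (a, v)\<in>A. a + v \<bullet> h)"
    using a0(1) u by (intro cSUP_upper2[where x = "(0, v0)"] bdd_aboveI2[where M = L]) auto
  ultimately show ?thesis using L[of 0 v0] a0(1) by auto
qed

lemma INF_affine_eq:
  fixes B :: "(real \<times> 'a::euclidean_space) set"
  shows "(INF (b, w)\<in>B. b + w \<bullet> h) = - (SUP (a, v)\<in>uminus ` B. a + v \<bullet> h)"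
  by (simp add: Inf_real_def image_image case_prod_unfold)

lemma abs_INF_affine_le:
  fixes B :: "(real \<times> 'a::euclidean_space) set"
  assumes B: "B \<noteq> {}" "compact B" "(INF (b, w)\<in>B. b) = 0"
    and L: "\<And>b w. (b, w) \<in> B \<Longrightarrow> \<bar>w \<bullet> h\<bar> \<le> L"
  shows "\<bar>INF (b, w)\<in>B. b + w \<bullet> h\<bar> \<le> L"
proof -
  have "\<bar>SUP (a, v)\<in>uminus ` B. a + v \<bullet> h\<bar> \<le> L"
  proof (rule abs_SUP_affine_le)
    show "compact (uminus ` B)" using B(2) by (intro compact_continuous_image continuous_intros)
    show "(SUP (a, v)\<in>uminus ` B. a) = 0" using B(3) INF_affine_eq[of 0 B] by (simp add: case_prod_unfold)
    show "\<bar>v \<bullet> h\<bar> \<le> L" if "(a, v) \<in> uminus ` B" for a v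
      using that L by force
  qed (use B in auto)
  then show ?thesis unfolding INF_affine_eq by simp
qed

text \<open>Along the segment the hypodifferential and the hyperdifferential contribute L each to
  the right Dini bound, hence the factor 2.\<close>

lemma codifferentiable_abs_increment_le:
  fixes F :: "'a::euclidean_space \<Rightarrow> real"
  assumes cont: "continuous_on UNIV F"
    and cod: "\<And>y. is_euclidean_codifferential F y (A y) (B y)"
    and L: "\<And>s a v. 0 \<le> s \<Longrightarrow> s \<le> 1 \<Longrightarrow> (a, v) \<in> A (x + s *\<^sub>R h) \<union> B (x + s *\<^sub>R h) \<Longrightarrow> \<bar>v \<bullet> h\<bar> \<le> L"
  shows "\<bar>F (x + h) - F x\<bar> \<le> 2 * L"
proof -
  have "\<bar>F (x + 1 *\<^sub>R h) - F (x + 0 *\<^sub>R h)\<bar> \<le> 2 * L"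
  proof (rule abs_increment_le_if_dini_bound)
    show "continuous_on {0..1} (\<lambda>t. F (x + t *\<^sub>R h))"
      by (intro continuous_on_compose2[OF cont] continuous_intros) auto
    fix t \<epsilon> :: real assume t: "0 \<le> t" "t < 1" and \<epsilon>: "0 < \<epsilon>"
    let ?y = "x + t *\<^sub>R h"
    note D = euclidean_codifferentialD[OF cod[of ?y]]
    have "\<forall>\<^sub>F \<alpha> in at_right 0. 1 / \<alpha> * \<bar>F (?y + \<alpha> *\<^sub>R h) - F ?y - (SUP (a, v)\<in>A ?y. a + v \<bullet> (\<alpha> *\<^sub>R h))
       - (INF (b, w)\<in>B ?y. b + w \<bullet> (\<alpha> *\<^sub>R h))\<bar> < \<epsilon>"
      by (rule order_tendstoD(2)[OF D(9) \<epsilon>])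
    moreover have "\<forall>\<^sub>F \<alpha> in at_right (0::real). 0 < \<alpha>" by (simp add: eventually_at_filter)
    ultimately show "\<forall>\<^sub>F \<alpha> in at_right 0. \<bar>F (x + (t + \<alpha>) *\<^sub>R h) - F (x + t *\<^sub>R h)\<bar> \<le> (2 * L + \<epsilon>) * \<alpha>"
    proof eventually_elim
      case (elim \<alpha>)
      have "\<bar>SUP (a, v)\<in>A ?y. a + v \<bullet> (\<alpha> *\<^sub>R h)\<bar> \<le> \<alpha> * L"
        by (rule abs_SUP_affine_le[OF D(1,3,7)]) (use L[of t] t elim in \<open>auto simp: abs_mult intro!: mult_left_mono\<close>)
      moreover have "\<bar>INF (b, w)\<in>B ?y. b + w \<bullet> (\<alpha> *\<^sub>R h)\<bar> \<le> \<alpha> * L"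
        by (rule abs_INF_affine_le[OF D(4,6,8)]) (use L[of t] t elim in \<open>auto simp: abs_mult intro!: mult_left_mono\<close>)
      moreover have "\<bar>F (?y + \<alpha> *\<^sub>R h) - F ?y - (SUP (a, v)\<in>A ?y. a + v \<bullet> (\<alpha> *\<^sub>R h))
       - (INF (b, w)\<in>B ?y. b + w \<bullet> (\<alpha> *\<^sub>R h))\<bar> < \<epsilon> * \<alpha>"
        using elim by (simp add: field_simps)
      ultimately have "\<bar>F (?y + \<alpha> *\<^sub>R h) - F ?y\<bar> \<le> \<alpha> * L + \<alpha> * L + \<epsilon> * \<alpha>" by linarith
      then show ?case by (simp add: algebra_simps)
    qed
  qed
  then show ?thesis by simp
qed

section \<open>Uniqueness of weak gradients\<close>

lemma Ck_const: "Ck k (\<lambda>x. c)"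
proof (induction k arbitrary: c)
  case (Suc k)
  show ?case unfolding Ck.simps
    by (rule exI[of _ "\<lambda>x. 0"]) (auto intro!: derivative_eq_intros Suc)
qed simp

text \<open>\<open>Ck (Suc k)\<close> speaks of the partial derivatives only, so lowering the order
  takes an induction. The product rule needs it, since each factor reappears undifferentiated beside
  the gradient of the other.\<close>

lemma Ck_Suc: "Ck (Suc k) \<phi> \<Longrightarrow> Ck k \<phi>"
proof (induction k arbitrary: \<phi>)
  case 0
  then have "\<forall>x. \<phi> differentiable at x" by (auto simp: differentiable_def)
  then show ?case using differentiable_imp_continuous_within by (auto simp: continuous_on_eq_continuous_within)
next
  case (Suc k)
  then obtain G where G: "\<And>x. (\<phi> has_derivative (\<lambda>h. G x \<bullet> h)) (at x)" "\<And>j. Ck (Suc k) (\<lambda>x. G x $ j)"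
    by (auto simp only: Ck.simps)
  show ?case unfolding Ck.simps using G(1) Suc.IH[OF G(2)] by blast
qed

lemma Ck_add: "Ck k \<phi> \<Longrightarrow> Ck k \<psi> \<Longrightarrow> Ck k (\<lambda>x. \<phi> x + \<psi> x)"
proof (induction k arbitrary: \<phi> \<psi>)
  case 0 then show ?case by (auto intro: continuous_on_add)
next
  case (Suc k)
  obtain G where G: "\<And>x. (\<phi> has_derivative (\<lambda>h. G x \<bullet> h)) (at x)" "\<And>j. Ck k (\<lambda>x. G x $ j)"
    using Suc.prems by auto
  obtain H where H: "\<And>x. (\<psi> has_derivative (\<lambda>h. H x \<bullet> h)) (at x)" "\<And>j. Ck k (\<lambda>x. H x $ j)"
    using Suc.prems by auto
  show ?case unfolding Ck.simps
    by (rule exI[of _ "\<lambda>x. G x + H x"])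
       (auto simp: inner_add_left intro!: derivative_eq_intros G(1) H(1) Suc.IH G(2) H(2))
qed

lemma Ck_mult: "Ck k \<phi> \<Longrightarrow> Ck k \<psi> \<Longrightarrow> Ck k (\<lambda>x. \<phi> x * \<psi> x)"
proof (induction k arbitrary: \<phi> \<psi>)
  case 0 then show ?case by (auto intro: continuous_on_mult)
next
  case (Suc k)
  obtain G where G: "\<And>x. (\<phi> has_derivative (\<lambda>h. G x \<bullet> h)) (at x)" "\<And>j. Ck k (\<lambda>x. G x $ j)"
    using Suc.prems by auto
  obtain H where H: "\<And>x. (\<psi> has_derivative (\<lambda>h. H x \<bullet> h)) (at x)" "\<And>j. Ck k (\<lambda>x. H x $ j)"
    using Suc.prems by auto
  have k: "Ck k \<phi>" "Ck k \<psi>" using Suc.prems Ck_Suc by blast+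
  show ?case unfolding Ck.simps
  proof (intro exI[of _ "\<lambda>x. \<phi> x *\<^sub>R H x + \<psi> x *\<^sub>R G x"] conjI allI)
    show "((\<lambda>x. \<phi> x * \<psi> x) has_derivative (\<lambda>h. (\<phi> x *\<^sub>R H x + \<psi> x *\<^sub>R G x) \<bullet> h)) (at x)" for x
      by (auto simp: inner_add_left algebra_simps intro!: derivative_eq_intros G(1) H(1))
    show "Ck k (\<lambda>x. (\<phi> x *\<^sub>R H x + \<psi> x *\<^sub>R G x) $ j)" for j
      using Ck_add[OF Suc.IH[OF k(1) H(2)] Suc.IH[OF k(2) G(2)]] by simp
  qed
qed

lemma Ck_prod: "finite I \<Longrightarrow> (\<And>i. i \<in> I \<Longrightarrow> Ck k (\<phi> i)) \<Longrightarrow> Ck k (\<lambda>x. \<Prod>i\<in>I. \<phi> i x)"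
  by (induction I rule: finite_induct) (auto intro: Ck_const Ck_mult)

section \<open>Smooth bump functions on boxes\<close>

text \<open>For n = 0 the usual smooth function that is flat at 0. The factor t^(-n) is carried
  along because the linear span of these functions is then closed under differentiation, which makes
  smoothness an induction with n arbitrary.\<close>

definition flat_exp :: "nat \<Rightarrow> real \<Rightarrow> real" where
  "flat_exp n t = (if t \<le> 0 then 0 else (1 / t) ^ n * exp (- (1 / t)))"

lemma flat_exp_tendsto_0: "(flat_exp n \<longlongrightarrow> 0) (at 0)"
proof -
  have "((\<lambda>t::real. (1 / t) ^ n / exp (1 / t)) \<longlongrightarrow> 0) (at_right 0)"
    using filterlim_compose[OF tendsto_power_div_exp_0 filterlim_inverse_at_top_right]
    by (simp add: inverse_eq_divide)
  then have "(flat_exp n \<longlongrightarrow> 0) (at_right 0)"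
    by (rule Lim_transform_eventually)
       (auto simp: flat_exp_def eventually_at_filter exp_minus inverse_eq_divide)
  moreover have "(flat_exp n \<longlongrightarrow> 0) (at_left 0)"
    by (rule tendsto_eventually) (auto simp: flat_exp_def eventually_at_filter)
  ultimately show ?thesis by (simp add: filterlim_at_split)
qed

lemma DERIV_flat_exp: "(flat_exp n has_field_derivative (flat_exp (n + 2) t - real n * flat_exp (n + 1) t)) (at t)"
proof (cases t "0 :: real" rule: linorder_cases)
  case less
  have "((\<lambda>t. 0) has_field_derivative 0) (at t)" by simp
  then have "(flat_exp n has_field_derivative 0) (at t)"
    by (rule has_field_derivative_transform_within_open[where S = "{..<0}"]) (use less in \<open>auto simp: flat_exp_def\<close>)
  then show ?thesis using less by (simp add: flat_exp_def)
next
  case equal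
  \<comment> \<open>The difference quotient at 0 coincides with \<open>flat_exp (Suc n)\<close>,
    which tends to 0.\<close>
  have "((\<lambda>h. (flat_exp n (0 + h) - flat_exp n 0) / h) \<longlongrightarrow> 0) (at 0)"
    by (rule Lim_transform_eventually[OF flat_exp_tendsto_0[of "Suc n"]])
       (auto simp: flat_exp_def eventually_at_filter)
  then show ?thesis using equal by (simp add: DERIV_def flat_exp_def)
next
  case greater
  have "((\<lambda>t. (1 / t) ^ n * exp (- (1 / t))) has_field_derivative
      (flat_exp (n + 2) t - real n * flat_exp (n + 1) t)) (at t)"
  proof -
    have 1: "((\<lambda>y. y ^ n * exp (- y)) has_field_derivative
        (real n * y ^ (n - 1) * exp (- y) - y ^ n * exp (- y))) (at y)" for y :: real
      by (auto intro!: derivative_eq_intros)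
    have 2: "((\<lambda>t. 1 / t) has_field_derivative - ((1 / t) ^ 2)) (at t)"
      using greater by (auto intro!: derivative_eq_intros simp: power2_eq_square)
    have "(real n * (1 / t) ^ (n - 1) * exp (- (1 / t)) - (1 / t) ^ n * exp (- (1 / t))) * - ((1 / t) ^ 2)
        = flat_exp (n + 2) t - real n * flat_exp (n + 1) t"
      using greater by (cases n) (simp_all add: flat_exp_def power_add power2_eq_square field_simps del: power_one_over)
    then show ?thesis using DERIV_chain2[OF 1 2] by simp
  qed
  then show ?thesis
    by (rule has_field_derivative_transform_within_open[where S = "{0<..}"]) (use greater in \<open>auto simp: flat_exp_def\<close>)
qed

lemma Ck_flat_exp: "Ck k (\<lambda>x :: real^'d. flat_exp n (c + s * x $ i))"
proof (induction k arbitrary: n)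
  case 0
  have "isCont (flat_exp n) t" for t using DERIV_isCont[OF DERIV_flat_exp] .
  then have "continuous_on UNIV (flat_exp n)" by (simp add: continuous_at_imp_continuous_on)
  then show ?case
    unfolding Ck.simps by (rule continuous_on_compose2) (auto intro!: continuous_intros)
next
  case (Suc k)
  define g' where "g' t = flat_exp (n + 2) t + - real n * flat_exp (n + 1) t" for t
  show ?case unfolding Ck.simps
  proof (intro exI[of _ "\<lambda>x. axis i (g' (c + s * x $ i) * s)"] conjI allI)
    fix x :: "real^'d"
    have 1: "(flat_exp n has_derivative (\<lambda>h. g' (c + s * x $ i) * h)) (at (c + s * x $ i))"
      using DERIV_flat_exp unfolding g'_def has_field_derivative_def by simp
    have 2: "((\<lambda>x :: real^'d. c + s * x $ i) has_derivative (\<lambda>h. s * h $ i)) (at x)"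
      by (auto intro!: derivative_eq_intros bounded_linear.has_derivative[OF bounded_linear_vec_nth])
    from has_derivative_compose[OF 2 1]
    show "((\<lambda>x. flat_exp n (c + s * x $ i)) has_derivative (\<lambda>h. axis i (g' (c + s * x $ i) * s) \<bullet> h)) (at x)"
      by (simp add: inner_axis' mult.assoc)
  next
    fix j
    have "Ck k (\<lambda>x. g' (c + s * x $ i) * (if j = i then s else 0))"
      unfolding g'_def by (intro Ck_mult Ck_add Suc Ck_const)
    moreover have "(\<lambda>x :: real^'d. axis i (g' (c + s * x $ i) * s) $ j)
        = (\<lambda>x. g' (c + s * x $ i) * (if j = i then s else 0))" by (auto simp: axis_def)
    ultimately show "Ck k (\<lambda>x :: real^'d. axis i (g' (c + s * x $ i) * s) $ j)" by simp
  qed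
qed

text \<open>A product of one-dimensional profiles that is positive exactly inside the box; the
  factor \<open>Suc n\<close> steepens the edges, so that the functions approach the indicator of
  \<open>box a b\<close>.\<close>

definition box_bump :: "real^'d \<Rightarrow> real^'d \<Rightarrow> nat \<Rightarrow> real^'d \<Rightarrow> real" where
  "box_bump a b n x = (\<Prod>i\<in>UNIV. flat_exp 0 (real (Suc n) * (x $ i - a $ i)) * flat_exp 0 (real (Suc n) * (b $ i - x $ i)))"

lemma box_bump_eq_0: "x \<notin> box a b \<Longrightarrow> box_bump a b n x = 0"
  by (auto simp: box_bump_def mem_box_cart flat_exp_def not_less mult_le_0_iff)

lemma box_bump_bounds: "0 \<le> box_bump a b n x" "box_bump a b n x \<le> 1"
  unfolding box_bump_def
  by (auto intro!: prod_nonneg prod_le_1 mult_le_one simp: flat_exp_def)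

lemma box_bump_tendsto:
  fixes x :: "real^'d"
  assumes x: "x \<in> box a b"
  shows "(\<lambda>n. box_bump a b n x) \<longlonglongrightarrow> 1"
proof -
  have "(\<lambda>n. flat_exp 0 (real (Suc n) * t)) \<longlonglongrightarrow> 1" if "t > 0" for t
  proof -
    have "(\<lambda>n. - (1 / t * (1 / real (Suc n)))) \<longlonglongrightarrow> - (1 / t * 0)"
      by (intro tendsto_intros LIMSEQ_Suc[OF lim_1_over_n])
    then have "(\<lambda>n. exp (- (1 / t * (1 / real (Suc n))))) \<longlonglongrightarrow> exp (- (1 / t * 0))" by (rule tendsto_exp)
    moreover have "flat_exp 0 (real (Suc n) * t) = exp (- (1 / t * (1 / real (Suc n))))" for n
    proof -
      have "0 < real (Suc n) * t" using that by simp
      then show ?thesis by (simp add: flat_exp_def field_simps)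
    qed
    ultimately show ?thesis by simp
  qed
  note flat = this
  have "(\<lambda>n. box_bump a b n x) \<longlonglongrightarrow> (\<Prod>i\<in>(UNIV :: 'd set). 1 * 1)"
    unfolding box_bump_def by (intro tendsto_prod tendsto_mult flat) (use x in \<open>auto simp: mem_box_cart\<close>)
  then show ?thesis by simp
qed

lemma box_bump_test_function:
  assumes "cbox a b \<subseteq> \<Omega>" shows "box_bump a b n \<in> test_functions \<Omega>"
proof -
  have "Ck k (\<lambda>x. flat_exp 0 (real (Suc n) * (x $ i - a $ i)) * flat_exp 0 (real (Suc n) * (b $ i - x $ i)))" for k i
    using Ck_mult[OF Ck_flat_exp[of k 0 "- real (Suc n) * a $ i" "real (Suc n)" i]
        Ck_flat_exp[of k 0 "real (Suc n) * b $ i" "- real (Suc n)" i]]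
    by (simp add: algebra_simps)
  then have "Ck k (box_bump a b n)" for k unfolding box_bump_def[abs_def] by (intro Ck_prod) auto
  moreover have cl: "closure {x. box_bump a b n x \<noteq> 0} \<subseteq> cbox a b"
    by (rule closure_minimal[OF _ closed_cbox]) (use box_bump_eq_0 box_subset_cbox in blast)
  moreover have "compact (closure {x. box_bump a b n x \<noteq> 0})"
    using cl by (meson bounded_cbox bounded_subset closed_closure compact_eq_bounded_closed)
  ultimately show ?thesis using assms unfolding test_functions_def by blast
qed

section \<open>The fundamental lemma of the calculus of variations\<close>

text \<open>Open boxes form an intersection-stable generator of the Borel sets, so vanishing
  integrals propagate from boxes to all Borel sets, and comparison of set integrals with those of 0
  bounds the function on both sides.\<close>

lemma AE_eq_0_if_box_integrals_eq_0:
  fixes f :: "'a::euclidean_space \<Rightarrow> real"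
  assumes f: "f absolutely_integrable_on cbox a b"
    and zero: "\<And>c d. cbox c d \<subseteq> cbox a b \<Longrightarrow> (\<integral>x. indicator (box c d) x * f x \<partial>lebesgue) = 0"
  shows "AE x in lebesgue. x \<in> box a b \<longrightarrow> f x = 0"
proof -
  define F where "F x = indicator (box a b) x * f x" for x
  have "f absolutely_integrable_on box a b"
    by (rule set_integrable_subset[OF f]) (auto simp: box_subset_cbox)
  then have Fi: "integrable lebesgue F" by (simp add: set_integrable_def F_def[abs_def])
  \<comment> \<open>The induction over the generated sigma-algebra reaches Borel sets only, whereas
    the sets used in the almost everywhere comparison come from the function itself; hence a Borel
    representative.\<close>
  then have "F \<in> borel_measurable (completion lborel)" by auto
  from completion_ex_borel_measurable_real[OF this] obtain F' where
    F': "F' \<in> borel_measurable lborel" "AE x in lborel. F x = F' x" by auto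
  have AE': "AE x in lebesgue. F x = F' x" using F'(2) by (rule AE_completion)
  have I': "integrable lborel F'"
  proof -
    have "integrable lebesgue F'"
      using Fi AE' F'(1) by (subst integrable_cong_AE[where g = F]) (auto elim: eventually_mono intro: measurable_completion)
    then show ?thesis using F'(1) by (simp add: integrable_completion)
  qed
  have eq: "(\<integral>x. indicator E x * F' x \<partial>lborel) = (\<integral>x. indicator E x * F x \<partial>lebesgue)"
    if E: "E \<in> sets borel" for E
  proof -
    have "(\<integral>x. indicator E x * F' x \<partial>lborel) = (\<integral>x. indicator E x * F' x \<partial>lebesgue)"
      using F'(1) E by (subst integral_completion) auto
    also have "\<dots> = (\<integral>x. indicator E x * F x \<partial>lebesgue)"
    proof (rule integral_cong_AE)
      show "AE x in lebesgue. indicator E x * F' x = indicator E x * F x"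
        using AE' by eventually_elim simp
      have El: "E \<in> sets lebesgue" using E by auto
      show "(\<lambda>x. indicator E x * F' x) \<in> borel_measurable lebesgue"
        using F'(1) El by (intro borel_measurable_times borel_measurable_indicator measurable_completion) auto
      show "(\<lambda>x. indicator E x * F x) \<in> borel_measurable lebesgue"
        using Fi El by (intro borel_measurable_times borel_measurable_indicator) auto
    qed
    finally show ?thesis .
  qed
  have box0: "(\<integral>x. indicator (box c d) x * F' x \<partial>lborel) = 0" for c d
  proof -
    \<comment> \<open>The corners of the intersection of \<open>box c d\<close> with
      \<open>box a b\<close>; F vanishes off the latter, so only the intersection
      contributes.\<close>
    let ?c = "\<Sum>i\<in>Basis. max (c \<bullet> i) (a \<bullet> i) *\<^sub>R i" and ?d = "\<Sum>i\<in>Basis. min (d \<bullet> i) (b \<bullet> i) *\<^sub>R i"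
    have "(\<integral>x. indicator (box c d) x * F x \<partial>lebesgue) = (\<integral>x. indicator (box ?c ?d) x * f x \<partial>lebesgue)"
      unfolding box_Int_box[symmetric] F_def
      by (intro Bochner_Integration.integral_cong) (auto simp: indicator_def)
    also have "\<dots> = 0" by (rule zero) (auto simp: Int_interval[symmetric])
    finally show ?thesis by (subst eq) auto
  qed
  have bor: "(\<integral>x. indicator E x * F' x \<partial>lborel) = 0" if "E \<in> sets borel" for E
  proof -
    let ?\<G> = "range (\<lambda>(a, b). box a b :: 'a set)"
    have i: "integrable lborel (\<lambda>x. indicator A x * F' x)" if "A \<in> sets borel" for A
      using integrable_mult_indicator[of A lborel F'] I' that by auto
    have sb: "sigma_sets UNIV ?\<G> = sets borel" by (subst borel_eq_box) (simp add: sets_measure_of)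
    have "Int_stable ?\<G>" by (auto simp: Int_stable_def box_Int_box)
    moreover have "?\<G> \<subseteq> Pow UNIV" by simp
    moreover have "E \<in> sigma_sets UNIV ?\<G>" using that by (simp add: sb)
    ultimately show ?thesis
    proof (induction rule: sigma_sets_induct_disjoint)
      case (basic A) then show ?case using box0 by auto
    next
      case empty then show ?case by simp
    next
      case (compl A)
      then have A: "A \<in> sets borel" by (simp add: sb)
      have "(\<integral>x. F' x \<partial>lborel) = (\<integral>x. indicator UNIV x * F' x \<partial>lborel)" by simp
      also have "\<dots> = (\<integral>x. indicator UNIV x * F x \<partial>lebesgue)" by (rule eq) simp
      also have "\<dots> = (\<integral>x. indicator (box a b) x * F x \<partial>lebesgue)"
        by (intro Bochner_Integration.integral_cong) (auto simp: F_def indicator_def)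
      also have "\<dots> = 0" using box0[of a b] by (subst (asm) eq) auto
      finally have "(\<integral>x. F' x \<partial>lborel) = 0" .
      moreover have "(\<integral>x. indicator (UNIV - A) x * F' x \<partial>lborel) = (\<integral>x. F' x - indicator A x * F' x \<partial>lborel)"
        by (intro Bochner_Integration.integral_cong) (auto simp: indicator_def)
      ultimately show ?case using compl I' i[OF A] by simp
    next
      case (union A)
      then have A: "A i \<in> sets borel" for i by (auto simp: sb)
      have UA: "(\<Union>i. A i) \<in> sets borel" using A by auto
      have "(LINT x:(\<Union>i. A i)|lborel. F' x) = (\<Sum>i. (LINT x:(A i)|lborel. F' x))"
      proof (rule lebesgue_integral_countable_add)
        show "set_integrable lborel (\<Union>i. A i) F'" unfolding set_integrable_def using i[OF UA] by simp
        show "A i \<inter> A j = {}" if "i \<noteq> j" for i j using union(1) that by (auto simp: disjoint_family_on_def)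
      qed (use A in auto)
      then show ?case using union by (simp add: set_lebesgue_integral_def)
    qed
  qed
  have "AE x in lborel. F' x \<le> 0" "AE x in lborel. 0 \<le> F' x"
    by (rule AE_le_if_set_integrals_le; use I' bor in simp)+
  then have "AE x in lborel. F' x = 0" by eventually_elim simp
  from AE_completion[OF this] AE' show ?thesis by eventually_elim (auto simp: F_def)
qed

lemma test_function_continuous: "\<phi> \<in> test_functions \<Omega> \<Longrightarrow> continuous_on UNIV \<phi>"
  unfolding test_functions_def by (metis (mono_tags, lifting) Ck.simps(1) mem_Collect_eq)

lemma integrable_mult_compact_support:
  fixes f \<phi> :: "real^'d \<Rightarrow> real"
  assumes \<Omega>: "open \<Omega>" and f: "locally_integrable \<Omega> f" and \<phi>: "continuous_on UNIV \<phi>"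
    and K: "compact K" "K \<subseteq> \<Omega>" "\<And>x. x \<notin> K \<Longrightarrow> \<phi> x = 0"
  shows "integrable (lebesgue_on \<Omega>) (\<lambda>x. f x * \<phi> x)"
proof -
  have fK: "integrable lebesgue (\<lambda>x. indicator K x * f x)"
    using f K by (simp add: locally_integrable_def set_integrable_def)
  obtain B where B: "\<And>x. x \<in> K \<Longrightarrow> \<bar>\<phi> x\<bar> \<le> B"
    using compact_imp_bounded[OF compact_continuous_image[OF continuous_on_subset[OF \<phi> subset_UNIV] K(1)]]
    by (auto simp: bounded_iff)
  have eq: "indicator \<Omega> x *\<^sub>R (f x * \<phi> x) = (indicator K x * f x) * \<phi> x" for x
    using K by (auto simp: indicator_def)
  have "integrable lebesgue (\<lambda>x. (indicator K x * f x) * \<phi> x)"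
  proof (rule Bochner_Integration.integrable_bound)
    show "integrable lebesgue (\<lambda>x. B * (indicator K x * f x))" using fK by auto
    have "\<phi> \<in> borel_measurable borel" using \<phi> by (simp add: borel_measurable_continuous_onI)
    then have "\<phi> \<in> borel_measurable lebesgue" by (simp add: borel_measurable_if_lebesgue_on measurable_completion)
    then show "(\<lambda>x. (indicator K x * f x) * \<phi> x) \<in> borel_measurable lebesgue" using fK by auto
    show "AE x in lebesgue. norm ((indicator K x * f x) * \<phi> x) \<le> norm (B * (indicator K x * f x))"
    proof (rule AE_I2)
      fix x
      show "norm ((indicator K x * f x) * \<phi> x) \<le> norm (B * (indicator K x * f x))"
        using B[of x] by (cases "x \<in> K") (auto simp: abs_mult mult.commute intro!: mult_right_mono)
    qed
  qed
  then show ?thesis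
    using \<Omega> by (subst integrable_restrict_space) (auto simp: eq simp del: real_scaleR_def)
qed

text \<open>Bumps converging to the indicator of a box turn the hypothesis into vanishing box
  integrals by dominated convergence. The open boxes whose closed boxes lie in \<Omega> cover it,
  and the Lindelof property leaves countably many exceptional null sets.\<close>

lemma fundamental_lemma:
  fixes f :: "real^'d \<Rightarrow> real"
  assumes \<Omega>: "open \<Omega>" and f: "locally_integrable \<Omega> f"
    and zero: "\<And>\<phi>. \<phi> \<in> test_functions \<Omega> \<Longrightarrow> (\<integral>x. f x * \<phi> x \<partial>lebesgue_on \<Omega>) = 0"
  shows "AE x in lebesgue_on \<Omega>. f x = 0"
proof -
  have box: "AE x in lebesgue. x \<in> box a b \<longrightarrow> f x = 0" if ab: "cbox a b \<subseteq> \<Omega>" for a b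
  proof (rule AE_eq_0_if_box_integrals_eq_0)
    show "f absolutely_integrable_on cbox a b" using f ab by (auto simp: locally_integrable_def)
    fix c d assume cd: "cbox c d \<subseteq> cbox a b"
    have fi: "integrable lebesgue (\<lambda>x. indicator (cbox c d) x * f x)"
      using f cd ab by (auto simp: locally_integrable_def set_integrable_def)
    let ?g = "\<lambda>n x. (indicator (cbox c d) x * f x) * box_bump c d n x"
    have "(\<lambda>n. \<integral>x. ?g n x \<partial>lebesgue) \<longlonglongrightarrow> (\<integral>x. indicator (box c d) x * f x \<partial>lebesgue)"
    proof (rule integral_dominated_convergence)
      show "integrable lebesgue (\<lambda>x. norm (indicator (cbox c d) x * f x))" using fi by (rule integrable_norm)
      have bm: "box_bump c d n \<in> borel_measurable lebesgue" for n
        using test_function_continuous[OF box_bump_test_function[OF order_refl[of "cbox c d"]]]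
        by (simp add: borel_measurable_continuous_onI measurable_completion)
      show "?g n \<in> borel_measurable lebesgue" for n
        using borel_measurable_integrable[OF fi] bm by (rule borel_measurable_times)
      have "f absolutely_integrable_on box c d"
        by (rule set_integrable_subset[of _ "cbox c d"])
           (use f cd ab in \<open>auto simp: locally_integrable_def box_subset_cbox intro: subsetD[OF box_subset_cbox]\<close>)
      then show "(\<lambda>x. indicator (box c d) x * f x) \<in> borel_measurable lebesgue"
        by (auto simp: set_integrable_def)
      show "AE x in lebesgue. (\<lambda>n. ?g n x) \<longlonglongrightarrow> indicator (box c d) x * f x"
      proof (rule AE_I2)
        fix x
        show "(\<lambda>n. ?g n x) \<longlonglongrightarrow> indicator (box c d) x * f x"
        proof (cases "x \<in> box c d")
          case True
          have "(\<lambda>n. f x * box_bump c d n x) \<longlonglongrightarrow> f x * 1" by (intro tendsto_intros box_bump_tendsto True)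
          then show ?thesis using True box_subset_cbox[of c d] by auto
        qed (simp add: box_bump_eq_0)
      qed
      show "AE x in lebesgue. norm (?g n x) \<le> norm (indicator (cbox c d) x * f x)" for n
        using box_bump_bounds[of c d n] by (intro AE_I2) (auto simp: abs_mult intro!: mult_left_le)
    qed
    moreover have "(\<integral>x. ?g n x \<partial>lebesgue) = 0" for n
    proof -
      have "cbox c d \<subseteq> \<Omega>" using cd ab by simp
      from zero[OF box_bump_test_function[OF this]]
      have "(\<integral>x. f x * box_bump c d n x \<partial>lebesgue_on \<Omega>) = 0" .
      also have "(\<integral>x. f x * box_bump c d n x \<partial>lebesgue_on \<Omega>) = (\<integral>x. indicator \<Omega> x *\<^sub>R (f x * box_bump c d n x) \<partial>lebesgue)"
        using \<Omega> by (intro integral_restrict_space) auto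
      also have "\<dots> = (\<integral>x. ?g n x \<partial>lebesgue)"
        using \<open>cbox c d \<subseteq> \<Omega>\<close> box_subset_cbox[of c d] box_bump_eq_0[of _ c d n]
        by (intro Bochner_Integration.integral_cong) (auto simp: indicator_def)
      finally show ?thesis .
    qed
    ultimately show "(\<integral>x. indicator (box c d) x * f x \<partial>lebesgue) = 0" by (simp add: LIMSEQ_const_iff)
  qed
  define \<F> where "\<F> = {box a b | a b. cbox a b \<subseteq> \<Omega>}"
  obtain \<F>' where \<F>': "\<F>' \<subseteq> \<F>" "countable \<F>'" "\<Union>\<F>' = \<Union>\<F>"
  proof (rule Lindelof[of \<F>])
    show "open S" if "S \<in> \<F>" for S using that by (auto simp: \<F>_def open_box)
  qed
  have "\<Omega> \<subseteq> \<Union>\<F>'"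
  proof
    fix x assume "x \<in> \<Omega>"
    then obtain a b where "cbox a b \<subseteq> \<Omega>" "x \<in> box a b" using open_contains_cbox[OF \<Omega>] by metis
    then show "x \<in> \<Union>\<F>'" unfolding \<F>'(3) by (auto simp: \<F>_def)
  qed
  have "AE x in lebesgue. \<forall>X\<in>\<F>'. x \<in> X \<longrightarrow> f x = 0"
    using \<F>' box by (subst AE_ball_countable) (auto simp: \<F>_def)
  then have "AE x in lebesgue. x \<in> \<Omega> \<longrightarrow> f x = 0"
  proof eventually_elim
    case (elim x)
    then show ?case using \<open>\<Omega> \<subseteq> \<Union>\<F>'\<close> by blast
  qed
  then show ?thesis using \<Omega> by (subst AE_restrict_space_iff) auto
qed

text \<open>Holds because Lebesgue measure is complete; it lets measurability pass between almost
  everywhere equal representatives.\<close>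

lemma borel_measurable_lebesgue_on_AE:
  fixes f g :: "'a::euclidean_space \<Rightarrow> 'b::euclidean_space"
  assumes \<Omega>: "\<Omega> \<in> sets lebesgue" and f: "f \<in> borel_measurable (lebesgue_on \<Omega>)"
    and eq: "AE x in lebesgue_on \<Omega>. f x = g x"
  shows "g \<in> borel_measurable (lebesgue_on \<Omega>)"
proof -
  have "(\<lambda>x. if x \<in> \<Omega> then f x else 0) \<in> borel_measurable lebesgue"
    using f by (simp add: borel_measurable_if \<Omega>)
  moreover have "AE x in lebesgue. (if x \<in> \<Omega> then f x else 0) = (if x \<in> \<Omega> then g x else 0)"
    using eq \<Omega> by (subst (asm) AE_restrict_space_iff) (auto elim!: eventually_mono)
  ultimately have "(\<lambda>x. if x \<in> \<Omega> then g x else 0) \<in> borel_measurable lebesgue"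
    by (rule borel_measurable_AE)
  then show ?thesis by (simp add: borel_measurable_if \<Omega>)
qed

lemma locally_integrable_linear:
  fixes u :: "real^'d \<Rightarrow> 'b::euclidean_space" and L :: "'b \<Rightarrow> 'c::euclidean_space"
  assumes "locally_integrable \<Omega> u" "bounded_linear L"
  shows "locally_integrable \<Omega> (\<lambda>x. L (u x))"
  using absolutely_integrable_linear[OF _ assms(2)] assms(1)
  by (auto simp: locally_integrable_def o_def)

lemma locally_integrable_add:
  "locally_integrable \<Omega> u \<Longrightarrow> locally_integrable \<Omega> w \<Longrightarrow> locally_integrable \<Omega> (\<lambda>x. u x + w x)"
  by (auto simp: locally_integrable_def)

lemma locally_integrable_cong_AE:
  fixes u w :: "real^'d \<Rightarrow> 'b::euclidean_space"
  assumes u: "locally_integrable \<Omega> u" and eq: "AE x in lebesgue_on \<Omega>. u x = w x" and \<Omega>: "open \<Omega>"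
  shows "locally_integrable \<Omega> w"
  unfolding locally_integrable_def
proof (intro allI impI)
  fix K assume K: "compact K" "K \<subseteq> \<Omega>"
  have "AE x in lebesgue. x \<in> \<Omega> \<longrightarrow> u x = w x"
    using eq \<Omega> by (subst (asm) AE_restrict_space_iff) auto
  then obtain N where N: "{x. \<not> (x \<in> \<Omega> \<longrightarrow> u x = w x)} \<subseteq> N" "N \<in> null_sets lebesgue"
    by (auto simp: eventually_ae_filter)
  show "w absolutely_integrable_on K"
  proof (rule absolutely_integrable_spike)
    show "u absolutely_integrable_on K" using u K by (simp add: locally_integrable_def)
    show "negligible N" using N(2) by (simp add: negligible_iff_null_sets)
    show "w x = u x" if "x \<in> K - N" for x using that N(1) K by auto
  qed
qed

lemma test_function_partial:
  fixes \<phi> :: "real^'d \<Rightarrow> real"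
  assumes "\<phi> \<in> test_functions \<Omega>"
  shows "continuous_on UNIV (\<lambda>x. frechet_derivative \<phi> (at x) (axis j 1))"
    and "x \<notin> closure {x. \<phi> x \<noteq> 0} \<Longrightarrow> frechet_derivative \<phi> (at x) (axis j 1) = 0"
proof -
  have "Ck (Suc 0) \<phi>" using assms unfolding test_functions_def by blast
  then obtain G where G: "\<And>x. (\<phi> has_derivative (\<lambda>h. G x \<bullet> h)) (at x)" "\<And>j. continuous_on UNIV (\<lambda>x. G x $ j)"
    by auto
  have eq: "frechet_derivative \<phi> (at x) = (\<lambda>h. G x \<bullet> h)" for x
    using frechet_derivative_at[OF G(1)] by simp
  show "continuous_on UNIV (\<lambda>x. frechet_derivative \<phi> (at x) (axis j 1))"
    by (simp add: eq inner_axis G(2))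
  assume x: "x \<notin> closure {x. \<phi> x \<noteq> 0}"
  have "((\<lambda>x. 0) has_derivative (\<lambda>h. 0 :: real)) (at x)" by simp
  then have "(\<phi> has_derivative (\<lambda>h. 0)) (at x)"
  proof (rule has_derivative_transform_within_open)
    show "open (- closure {x. \<phi> x \<noteq> 0})" "x \<in> - closure {x. \<phi> x \<noteq> 0}" using x by auto
    show "0 = \<phi> y" if "y \<in> - closure {x. \<phi> x \<noteq> 0}" for y
      using that closure_subset[of "{x. \<phi> x \<noteq> 0}"] by auto
  qed
  from frechet_derivative_at[OF this, symmetric] show "frechet_derivative \<phi> (at x) (axis j 1) = 0" by simp
qed

lemma integrable_mult_test_function:
  fixes f :: "real^'d \<Rightarrow> real"
  assumes \<Omega>: "open \<Omega>" and f: "locally_integrable \<Omega> f" and \<phi>: "\<phi> \<in> test_functions \<Omega>"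
  shows "integrable (lebesgue_on \<Omega>) (\<lambda>x. f x * \<phi> x)"
    and "integrable (lebesgue_on \<Omega>) (\<lambda>x. f x * frechet_derivative \<phi> (at x) (axis j 1))"
proof -
  have K: "compact (closure {x. \<phi> x \<noteq> 0})" "closure {x. \<phi> x \<noteq> 0} \<subseteq> \<Omega>"
    using \<phi> by (auto simp: test_functions_def)
  have z: "\<phi> x = 0" if "x \<notin> closure {x. \<phi> x \<noteq> 0}" for x
    using that closure_subset[of "{x. \<phi> x \<noteq> 0}"] by auto
  show "integrable (lebesgue_on \<Omega>) (\<lambda>x. f x * \<phi> x)"
    by (rule integrable_mult_compact_support[OF \<Omega> f test_function_continuous[OF \<phi>] K z])
  show "integrable (lebesgue_on \<Omega>) (\<lambda>x. f x * frechet_derivative \<phi> (at x) (axis j 1))"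
    by (rule integrable_mult_compact_support[OF \<Omega> f test_function_partial(1)[OF \<phi>] K test_function_partial(2)[OF \<phi>]])
qed

section \<open>Calculus of weak gradients\<close>

lemma weak_gradient_components:
  fixes g :: "real^'d \<Rightarrow> real^'d^'m" and u :: "real^'d \<Rightarrow> real^'m"
  assumes "is_weak_gradient \<Omega> u g"
  shows "locally_integrable \<Omega> (\<lambda>x. u x $ i)" "locally_integrable \<Omega> (\<lambda>x. g x $ i $ j)"
proof -
  have "bounded_linear (\<lambda>g :: real^'d^'m. g $ i $ j)"
    by (intro bounded_linear_compose[OF bounded_linear_vec_nth bounded_linear_vec_nth])
  then show "locally_integrable \<Omega> (\<lambda>x. g x $ i $ j)"
    using assms by (auto simp: is_weak_gradient_def intro: locally_integrable_linear)
  show "locally_integrable \<Omega> (\<lambda>x. u x $ i)"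
    using assms by (auto simp: is_weak_gradient_def intro: locally_integrable_linear bounded_linear_vec_nth)
qed

text \<open>An entry of g - g' integrates to 0 against every test function, since the defining
  identities have the same integral of u on the other side. Two representatives u and u' are allowed
  because a class modulo null sets has no canonical one.\<close>

lemma weak_gradient_unique:
  fixes g g' :: "real^'d \<Rightarrow> real^'d^'m"
  assumes \<Omega>: "open \<Omega>" and g: "is_weak_gradient \<Omega> u g" "is_weak_gradient \<Omega> u' g'"
    and eq: "AE x in lebesgue_on \<Omega>. u x = u' x"
  shows "AE x in lebesgue_on \<Omega>. g x = g' x"
proof -
  have "AE x in lebesgue_on \<Omega>. g x $ i $ j - g' x $ i $ j = 0" for i j
  proof (rule fundamental_lemma[OF \<Omega>])
    note li = weak_gradient_components[OF g(1)] weak_gradient_components[OF g(2)]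
    show "locally_integrable \<Omega> (\<lambda>x. g x $ i $ j - g' x $ i $ j)"
      using li(2,4)[of i j] by (auto simp: locally_integrable_def)
    fix \<phi> :: "real^'d \<Rightarrow> real" assume \<phi>: "\<phi> \<in> test_functions \<Omega>"
    have "(\<integral>x. g x $ i $ j * \<phi> x \<partial>lebesgue_on \<Omega>) = - (\<integral>x. u x $ i * frechet_derivative \<phi> (at x) (axis j 1) \<partial>lebesgue_on \<Omega>)"
      using g(1) \<phi> by (simp add: is_weak_gradient_def)
    also have "(\<integral>x. u x $ i * frechet_derivative \<phi> (at x) (axis j 1) \<partial>lebesgue_on \<Omega>)
        = (\<integral>x. u' x $ i * frechet_derivative \<phi> (at x) (axis j 1) \<partial>lebesgue_on \<Omega>)"
      by (rule integral_cong_AE)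
         (use eq integrable_mult_test_function(2)[OF \<Omega> li(1) \<phi>] integrable_mult_test_function(2)[OF \<Omega> li(3) \<phi>]
           in \<open>auto elim!: eventually_mono dest: borel_measurable_integrable\<close>)
    also have "- \<dots> = (\<integral>x. g' x $ i $ j * \<phi> x \<partial>lebesgue_on \<Omega>)"
      using g(2) \<phi> by (simp add: is_weak_gradient_def)
    finally show "(\<integral>x. (g x $ i $ j - g' x $ i $ j) * \<phi> x \<partial>lebesgue_on \<Omega>) = 0"
      using integrable_mult_test_function(1)[OF \<Omega> li(2) \<phi>] integrable_mult_test_function(1)[OF \<Omega> li(4) \<phi>]
      by (simp add: left_diff_distrib)
  qed
  then have "AE x in lebesgue_on \<Omega>. \<forall>i j. g x $ i $ j - g' x $ i $ j = 0" by (simp add: AE_all_countable)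
  then show ?thesis by eventually_elim (simp add: vec_eq_iff)
qed

lemma is_weak_gradient_cong:
  fixes g :: "real^'d \<Rightarrow> real^'d^'m"
  assumes \<Omega>: "open \<Omega>" and g: "is_weak_gradient \<Omega> u g" and eq: "AE x in lebesgue_on \<Omega>. u x = u' x"
  shows "is_weak_gradient \<Omega> u' g"
proof -
  have u': "locally_integrable \<Omega> u'"
    using g eq \<Omega> by (auto simp: is_weak_gradient_def intro: locally_integrable_cong_AE)
  have "(\<integral>x. u x $ i * frechet_derivative \<phi> (at x) (axis j 1) \<partial>lebesgue_on \<Omega>)
        = (\<integral>x. u' x $ i * frechet_derivative \<phi> (at x) (axis j 1) \<partial>lebesgue_on \<Omega>)"
    if \<phi>: "\<phi> \<in> test_functions \<Omega>" for \<phi> i j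
    using eq integrable_mult_test_function(2)[OF \<Omega> weak_gradient_components(1)[OF g] \<phi>]
      integrable_mult_test_function(2)[OF \<Omega> locally_integrable_linear[OF u' bounded_linear_vec_nth] \<phi>]
    by (intro integral_cong_AE) (auto elim!: eventually_mono dest: borel_measurable_integrable)
  then show ?thesis using g u' by (simp add: is_weak_gradient_def)
qed

lemma is_weak_gradient_add:
  fixes g g' :: "real^'d \<Rightarrow> real^'d^'m"
  assumes \<Omega>: "open \<Omega>" and g: "is_weak_gradient \<Omega> u g" "is_weak_gradient \<Omega> u' g'"
  shows "is_weak_gradient \<Omega> (\<lambda>x. u x + u' x) (\<lambda>x. g x + g' x)"
proof -
  note li = weak_gradient_components[OF g(1)] weak_gradient_components[OF g(2)]
  show ?thesis
    unfolding is_weak_gradient_def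
  proof (intro conjI ballI allI)
    fix \<phi> :: "real^'d \<Rightarrow> real" and i :: 'm and j :: 'd assume \<phi>: "\<phi> \<in> test_functions \<Omega>"
    note it = integrable_mult_test_function[OF \<Omega> _ \<phi>]
    have "(\<integral>x. u x $ i * frechet_derivative \<phi> (at x) (axis j 1) \<partial>lebesgue_on \<Omega>) = - (\<integral>x. g x $ i $ j * \<phi> x \<partial>lebesgue_on \<Omega>)"
      "(\<integral>x. u' x $ i * frechet_derivative \<phi> (at x) (axis j 1) \<partial>lebesgue_on \<Omega>) = - (\<integral>x. g' x $ i $ j * \<phi> x \<partial>lebesgue_on \<Omega>)"
      using g \<phi> by (simp_all add: is_weak_gradient_def)
    then show "(\<integral>x. (u x + u' x) $ i * frechet_derivative \<phi> (at x) (axis j 1) \<partial>lebesgue_on \<Omega>)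
        = - (\<integral>x. (g x + g' x) $ i $ j * \<phi> x \<partial>lebesgue_on \<Omega>)"
      using it(2)[OF li(1)] it(2)[OF li(3)] it(1)[OF li(2)] it(1)[OF li(4)]
      by (simp add: distrib_right)
  qed (use g in \<open>auto simp: is_weak_gradient_def intro: locally_integrable_add\<close>)
qed

lemma is_weak_gradient_scaleR:
  fixes g :: "real^'d \<Rightarrow> real^'d^'m"
  assumes g: "is_weak_gradient \<Omega> u g"
  shows "is_weak_gradient \<Omega> (\<lambda>x. c *\<^sub>R u x) (\<lambda>x. c *\<^sub>R g x)"
  unfolding is_weak_gradient_def
proof (intro conjI ballI allI)
  fix \<phi> :: "real^'d \<Rightarrow> real" and i :: 'm and j :: 'd assume \<phi>: "\<phi> \<in> test_functions \<Omega>"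
  have "(\<integral>x. u x $ i * frechet_derivative \<phi> (at x) (axis j 1) \<partial>lebesgue_on \<Omega>) = - (\<integral>x. g x $ i $ j * \<phi> x \<partial>lebesgue_on \<Omega>)"
    using g \<phi> by (simp add: is_weak_gradient_def)
  then show "(\<integral>x. (c *\<^sub>R u x) $ i * frechet_derivative \<phi> (at x) (axis j 1) \<partial>lebesgue_on \<Omega>)
        = - (\<integral>x. (c *\<^sub>R g x) $ i $ j * \<phi> x \<partial>lebesgue_on \<Omega>)"
    by (simp add: mult.assoc)
qed (use g in \<open>auto simp: is_weak_gradient_def intro: locally_integrable_linear bounded_linear_scaleR_right\<close>)

section \<open>The Sobolev space and its jets\<close>

lemma Holder_inequality:
  fixes f g :: "'a \<Rightarrow> real"
  assumes pq: "1 < p" "1 < q" "1 / p + 1 / q = 1"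
    and f: "f \<in> borel_measurable M" "AE x in M. 0 \<le> f x" "integrable M (\<lambda>x. f x powr p)"
    and g: "g \<in> borel_measurable M" "AE x in M. 0 \<le> g x" "integrable M (\<lambda>x. g x powr q)"
  shows "integrable M (\<lambda>x. f x * g x)"
    and "(\<integral>x. f x * g x \<partial>M) \<le> (\<integral>x. f x powr p \<partial>M) powr (1 / p) * (\<integral>x. g x powr q \<partial>M) powr (1 / q)"
proof -
  note [measurable] = f(1) g(1)
  have Y: "a * b \<le> a powr p + b powr q" if "0 \<le> a" "0 \<le> b" for a b :: real
  proof -
    have "a * b \<le> a powr p / p + b powr q / q" by (rule Youngs_inequality) (use that pq in auto)
    also have "\<dots> \<le> a powr p + b powr q" using pq by (intro add_mono) (auto simp: divide_le_eq mult_le_cancel_left1)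
    finally show ?thesis .
  qed
  show i: "integrable M (\<lambda>x. f x * g x)"
  proof (rule Bochner_Integration.integrable_bound)
    show "integrable M (\<lambda>x. f x powr p + g x powr q)" using f g by simp
    show "AE x in M. norm (f x * g x) \<le> norm (f x powr p + g x powr q)"
      using f(2) g(2) by eventually_elim (use Y in \<open>simp add: abs_mult\<close>)
  qed simp
  define A where "A = (\<integral>x. f x powr p \<partial>M)"
  define B where "B = (\<integral>x. g x powr q \<partial>M)"
  have AB: "0 \<le> A" "0 \<le> B" unfolding A_def B_def by (auto intro!: integral_nonneg_AE)
  show "(\<integral>x. f x * g x \<partial>M) \<le> A powr (1 / p) * B powr (1 / q)"
  proof (cases "A = 0 \<or> B = 0")
    case True
    have "AE x in M. f x * g x = 0"
    proof (cases "A = 0")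
      case True
      then have "AE x in M. f x powr p = 0"
        using integral_nonneg_eq_0_iff_AE[OF f(3)] by (simp add: A_def)
      then show ?thesis by eventually_elim simp
    next
      case False
      then have "AE x in M. g x powr q = 0"
        using True integral_nonneg_eq_0_iff_AE[OF g(3)] by (simp add: B_def)
      then show ?thesis by eventually_elim simp
    qed
    then have "(\<integral>x. f x * g x \<partial>M) = (\<integral>x. 0 \<partial>M)" by (intro integral_cong_AE) auto
    then show ?thesis by simp
  next
    case False
    then have pos: "A > 0" "B > 0" using AB by auto
    define a b where "a = A powr (1 / p)" and "b = B powr (1 / q)"
    have ab: "a > 0" "b > 0" "a powr p = A" "b powr q = B"
      using pos pq by (auto simp: a_def b_def powr_powr)
    have "(\<integral>x. f x * g x / (a * b) \<partial>M) \<le> (\<integral>x. f x powr p / (p * A) + g x powr q / (q * B) \<partial>M)"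
    proof (rule integral_mono_AE)
      show "AE x in M. f x * g x / (a * b) \<le> f x powr p / (p * A) + g x powr q / (q * B)"
        using f(2) g(2)
      proof eventually_elim
        case (elim x)
        have "(f x / a) * (g x / b) \<le> (f x / a) powr p / p + (g x / b) powr q / q"
          by (rule Youngs_inequality) (use elim ab pq in auto)
        then show ?case using elim ab by (simp add: powr_divide mult.commute)
      qed
    qed (use i f g in auto)
    also have "\<dots> = 1"
      using f(3) g(3) pos pq by (simp add: A_def[symmetric] B_def[symmetric])
    finally show ?thesis using ab by (simp add: a_def[symmetric] b_def[symmetric] field_simps)
  qed
qed

text \<open>Compares the sum with twice the maximum. The constant is crude and is the origin of the
  factor 2 in the jet bounds for finite p.\<close>

lemma powr_add_le:
  fixes a b P :: real
  assumes "0 \<le> a" "0 \<le> b" "0 \<le> P"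
  shows "(a + b) powr P \<le> 2 powr P * (a powr P + b powr P)"
proof -
  have "(a + b) powr P \<le> (2 * max a b) powr P" using assms by (intro powr_mono2) auto
  also have "\<dots> = 2 powr P * max a b powr P" using assms by (simp add: powr_mult)
  also have "\<dots> \<le> 2 powr P * (a powr P + b powr P)" by (intro mult_left_mono) (auto simp: max_def)
  finally show ?thesis .
qed

lemma rep_abs_aefun: "AE x in lebesgue. rep_aefun (abs_aefun f) x = f x"
proof -
  have "abs_aefun (rep_aefun (abs_aefun f)) = abs_aefun f" by (rule Quotient3_abs_rep[OF Quotient3_aefun])
  then show ?thesis by (simp add: aefun.abs_eq_iff)
qed

lemma rep_aefun_add: "AE x in lebesgue. rep_aefun (u + w) x = rep_aefun u x + rep_aefun w x"
proof -
  have "u + w = abs_aefun (\<lambda>x. rep_aefun u x + rep_aefun w x)"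
    by (metis plus_aefun.abs_eq Quotient3_abs_rep[OF Quotient3_aefun])
  then show ?thesis using rep_abs_aefun by metis
qed

lemma rep_aefun_scaleR: "AE x in lebesgue. rep_aefun (c *\<^sub>R u) x = c *\<^sub>R rep_aefun u x"
proof -
  have "c *\<^sub>R u = abs_aefun (\<lambda>x. c *\<^sub>R rep_aefun u x)"
    by (metis scaleR_aefun.abs_eq Quotient3_abs_rep[OF Quotient3_aefun])
  then show ?thesis using rep_abs_aefun by metis
qed

lemma AE_lebesgue_onI: "open \<Omega> \<Longrightarrow> AE x in lebesgue. P x \<Longrightarrow> AE x in lebesgue_on \<Omega>. P x"
  by (subst AE_restrict_space_iff) (auto elim: eventually_mono)

lemma Lp_add:
  fixes f g :: "'a \<Rightarrow> 'b::euclidean_space"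
  assumes "f \<in> Lp p M" "g \<in> Lp p M"
  shows "(\<lambda>x. f x + g x) \<in> Lp p M"
proof (cases "p = \<infinity>")
  case True
  then obtain K L where "AE x in M. norm (f x) \<le> K" "AE x in M. norm (g x) \<le> L"
    using assms by (auto simp: Lp_def)
  then have "AE x in M. norm (f x + g x) \<le> K + L"
    by eventually_elim (meson add_mono norm_triangle_ineq order_trans)
  then show ?thesis using True assms by (auto simp: Lp_def)
next
  case False
  have m[measurable]: "f \<in> borel_measurable M" "g \<in> borel_measurable M" using assms by (auto simp: Lp_def)
  let ?P = "enn2real p"
  have "integrable M (\<lambda>x. norm (f x + g x) powr ?P)"
  proof (rule Bochner_Integration.integrable_bound)
    show "integrable M (\<lambda>x. 2 powr ?P * (norm (f x) powr ?P + norm (g x) powr ?P))"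
      using assms False by (auto simp: Lp_def)
    show "AE x in M. norm (norm (f x + g x) powr ?P) \<le> norm (2 powr ?P * (norm (f x) powr ?P + norm (g x) powr ?P))"
    proof (rule AE_I2)
      fix x
      have "norm (f x + g x) powr ?P \<le> (norm (f x) + norm (g x)) powr ?P"
        by (intro powr_mono2 norm_triangle_ineq) auto
      also have "\<dots> \<le> 2 powr ?P * (norm (f x) powr ?P + norm (g x) powr ?P)" by (rule powr_add_le) auto
      finally show "norm (norm (f x + g x) powr ?P) \<le> norm (2 powr ?P * (norm (f x) powr ?P + norm (g x) powr ?P))"
        by simp
    qed
  qed simp
  then show ?thesis using False m by (simp add: Lp_def)
qed

lemma Lp_scaleR:
  fixes f :: "'a \<Rightarrow> 'b::euclidean_space"
  assumes "f \<in> Lp p M"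
  shows "(\<lambda>x. c *\<^sub>R f x) \<in> Lp p M"
proof (cases "p = \<infinity>")
  case True
  then obtain K where "AE x in M. norm (f x) \<le> K" using assms by (auto simp: Lp_def)
  then have "AE x in M. norm (c *\<^sub>R f x) \<le> \<bar>c\<bar> * K" by eventually_elim (simp add: mult_left_mono)
  then show ?thesis using True assms by (auto simp: Lp_def)
next
  case False
  then show ?thesis using assms by (auto simp: Lp_def powr_mult)
qed

lemma Lp_cong_AE:
  fixes f g :: "real^'d \<Rightarrow> 'b::euclidean_space"
  assumes \<Omega>: "open \<Omega>" and f: "f \<in> Lp p (lebesgue_on \<Omega>)" and eq: "AE x in lebesgue_on \<Omega>. f x = g x"
  shows "g \<in> Lp p (lebesgue_on \<Omega>)"
proof -
  have fm: "f \<in> borel_measurable (lebesgue_on \<Omega>)" using f by (auto simp: Lp_def)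
  have gm: "g \<in> borel_measurable (lebesgue_on \<Omega>)"
    by (rule borel_measurable_lebesgue_on_AE[OF _ fm eq]) (use \<Omega> in simp)
  show ?thesis
  proof (cases "p = \<infinity>")
    case True
    then obtain K where "AE x in lebesgue_on \<Omega>. norm (f x) \<le> K" using f by (auto simp: Lp_def)
    with eq have "AE x in lebesgue_on \<Omega>. norm (g x) \<le> K" by eventually_elim simp
    then show ?thesis using True gm by (auto simp: Lp_def)
  next
    case False
    have "integrable (lebesgue_on \<Omega>) (\<lambda>x. norm (g x) powr enn2real p)"
      by (subst integrable_cong_AE[where g = "\<lambda>x. norm (f x) powr enn2real p"])
         (use f False gm fm eq in \<open>auto simp: Lp_def elim!: eventually_mono\<close>)
    then show ?thesis using False gm by (simp add: Lp_def)
  qed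
qed

text \<open>Joins the arguments u and \<xi> of the integrand to one point of a Euclidean space,
  whose inner product is the sum of the two pairings in the formula for the functionals. The values
  are meaningful almost everywhere only, both components being chosen representatives.\<close>

definition jet :: "(real^'d) set \<Rightarrow> (real^'d, real^'m) aefun \<Rightarrow> real^'d \<Rightarrow> (real^'m) \<times> (real^'d^'m)" where
  "jet \<Omega> u x = (rep_aefun u x, weak_gradient \<Omega> u x)"

lemma
  fixes u :: "(real^'d, real^'m) aefun"
  assumes \<Omega>: "open \<Omega>" and u: "u \<in> sobolev p \<Omega>"
  shows sobolev_weak_gradient: "is_weak_gradient \<Omega> (rep_aefun u) (weak_gradient \<Omega> u)"
    and sobolev_weak_gradient_Lp: "weak_gradient \<Omega> u \<in> Lp p (lebesgue_on \<Omega>)"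
proof -
  obtain g where g: "is_weak_gradient \<Omega> (rep_aefun u) g" "g \<in> Lp p (lebesgue_on \<Omega>)"
    using u by (auto simp: sobolev_def)
  show 1: "is_weak_gradient \<Omega> (rep_aefun u) (weak_gradient \<Omega> u)"
    unfolding weak_gradient_def by (rule someI[of _ g]) (rule g(1))
  show "weak_gradient \<Omega> u \<in> Lp p (lebesgue_on \<Omega>)"
    by (rule Lp_cong_AE[OF \<Omega> g(2) weak_gradient_unique[OF \<Omega> g(1) 1]]) simp
qed

text \<open>The gradient of the sum is again an arbitrary choice, so additivity of jets is an almost
  everywhere statement and rests on \<open>weak_gradient_unique\<close>.\<close>

lemma sobolev_addI:
  fixes u w :: "(real^'d, real^'m) aefun"
  assumes \<Omega>: "open \<Omega>" and u: "u \<in> sobolev p \<Omega>" and w: "w \<in> sobolev p \<Omega>"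
  shows "u + w \<in> sobolev p \<Omega>"
    and "AE x in lebesgue_on \<Omega>. jet \<Omega> (u + w) x = jet \<Omega> u x + jet \<Omega> w x"
proof -
  have eq: "AE x in lebesgue_on \<Omega>. rep_aefun u x + rep_aefun w x = rep_aefun (u + w) x"
    using AE_lebesgue_onI[OF \<Omega> rep_aefun_add[of u w]] by eventually_elim simp
  let ?g = "\<lambda>x. weak_gradient \<Omega> u x + weak_gradient \<Omega> w x"
  have g: "is_weak_gradient \<Omega> (rep_aefun (u + w)) ?g"
    by (rule is_weak_gradient_cong[OF \<Omega> is_weak_gradient_add[OF \<Omega>] eq])
       (use sobolev_weak_gradient[OF \<Omega>] u w in auto)
  have "AE x in lebesgue. x \<notin> \<Omega> \<longrightarrow> rep_aefun u x = 0" "AE x in lebesgue. x \<notin> \<Omega> \<longrightarrow> rep_aefun w x = 0"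
    using u w by (auto simp: sobolev_def)
  then have "AE x in lebesgue. x \<notin> \<Omega> \<longrightarrow> rep_aefun (u + w) x = 0"
    using rep_aefun_add[of u w] by eventually_elim simp
  moreover have "rep_aefun (u + w) \<in> Lp p (lebesgue_on \<Omega>)"
    by (rule Lp_cong_AE[OF \<Omega> Lp_add eq]) (use u w in \<open>auto simp: sobolev_def\<close>)
  moreover have "?g \<in> Lp p (lebesgue_on \<Omega>)" using sobolev_weak_gradient_Lp[OF \<Omega>] u w by (blast intro: Lp_add)
  ultimately show s: "u + w \<in> sobolev p \<Omega>" using g by (auto simp: sobolev_def)
  have "AE x in lebesgue_on \<Omega>. weak_gradient \<Omega> (u + w) x = ?g x"
    by (rule weak_gradient_unique[OF \<Omega> sobolev_weak_gradient[OF \<Omega> s] g]) simp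
  with eq show "AE x in lebesgue_on \<Omega>. jet \<Omega> (u + w) x = jet \<Omega> u x + jet \<Omega> w x"
    by eventually_elim (simp add: jet_def)
qed

lemma sobolev_scaleRI:
  fixes u :: "(real^'d, real^'m) aefun"
  assumes \<Omega>: "open \<Omega>" and u: "u \<in> sobolev p \<Omega>"
  shows "c *\<^sub>R u \<in> sobolev p \<Omega>"
    and "AE x in lebesgue_on \<Omega>. jet \<Omega> (c *\<^sub>R u) x = c *\<^sub>R jet \<Omega> u x"
proof -
  have eq: "AE x in lebesgue_on \<Omega>. c *\<^sub>R rep_aefun u x = rep_aefun (c *\<^sub>R u) x"
    using AE_lebesgue_onI[OF \<Omega> rep_aefun_scaleR[of c u]] by eventually_elim simp
  let ?g = "\<lambda>x. c *\<^sub>R weak_gradient \<Omega> u x"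
  have g: "is_weak_gradient \<Omega> (rep_aefun (c *\<^sub>R u)) ?g"
    by (rule is_weak_gradient_cong[OF \<Omega> is_weak_gradient_scaleR eq])
       (use sobolev_weak_gradient[OF \<Omega>] u in auto)
  have "AE x in lebesgue. x \<notin> \<Omega> \<longrightarrow> rep_aefun u x = 0" using u by (auto simp: sobolev_def)
  then have "AE x in lebesgue. x \<notin> \<Omega> \<longrightarrow> rep_aefun (c *\<^sub>R u) x = 0"
    using rep_aefun_scaleR[of c u] by eventually_elim simp
  moreover have "rep_aefun (c *\<^sub>R u) \<in> Lp p (lebesgue_on \<Omega>)"
    by (rule Lp_cong_AE[OF \<Omega> Lp_scaleR eq]) (use u in \<open>auto simp: sobolev_def\<close>)
  moreover have "?g \<in> Lp p (lebesgue_on \<Omega>)" using sobolev_weak_gradient_Lp[OF \<Omega>] u by (blast intro: Lp_scaleR)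
  ultimately show s: "c *\<^sub>R u \<in> sobolev p \<Omega>" using g by (auto simp: sobolev_def)
  have "AE x in lebesgue_on \<Omega>. weak_gradient \<Omega> (c *\<^sub>R u) x = ?g x"
    by (rule weak_gradient_unique[OF \<Omega> sobolev_weak_gradient[OF \<Omega> s] g]) simp
  with eq show "AE x in lebesgue_on \<Omega>. jet \<Omega> (c *\<^sub>R u) x = c *\<^sub>R jet \<Omega> u x"
    by eventually_elim (simp add: jet_def)
qed

lemma sobolev_zero:
  assumes \<Omega>: "open \<Omega>" shows "(0 :: (real^'d, real^'m) aefun) \<in> sobolev p \<Omega>"
proof -
  have z: "AE x in lebesgue. rep_aefun (0 :: (real^'d, real^'m) aefun) x = 0"
    using rep_aefun_scaleR[of 0 "0 :: (real^'d, real^'m) aefun"] by simp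
  then have eq: "AE x in lebesgue_on \<Omega>. (0 :: real^'m) = rep_aefun (0 :: (real^'d, real^'m) aefun) x"
    using AE_lebesgue_onI[OF \<Omega>] by fastforce
  have L0: "(\<lambda>x. 0 :: 'z::euclidean_space) \<in> Lp p (lebesgue_on \<Omega>)" by (auto simp: Lp_def)
  have "is_weak_gradient \<Omega> (\<lambda>x. 0 :: real^'m) (\<lambda>x. 0)" by (simp add: is_weak_gradient_def locally_integrable_def)
  from is_weak_gradient_cong[OF \<Omega> this eq] Lp_cong_AE[OF \<Omega> L0 eq] L0 z
  show ?thesis unfolding sobolev_def by (auto elim!: eventually_mono)
qed

lemma jet_measurable:
  fixes u :: "(real^'d, real^'m) aefun"
  assumes "open \<Omega>" "u \<in> sobolev p \<Omega>" shows "jet \<Omega> u \<in> borel_measurable (lebesgue_on \<Omega>)"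
  unfolding jet_def[abs_def] using sobolev_weak_gradient_Lp[OF assms] assms(2)
  by (auto simp: Lp_def sobolev_def intro!: borel_measurable_Pair)

lemma norm_jet_le: "norm (jet \<Omega> u x) \<le> norm (rep_aefun u x) + norm (weak_gradient \<Omega> u x)"
  unfolding jet_def by (rule norm_Pair_le)

lemma jet_powr_integrable:
  fixes u :: "(real^'d, real^'m) aefun"
  assumes \<Omega>: "open \<Omega>" and u: "u \<in> sobolev p \<Omega>" and p: "1 \<le> p" "p < \<infinity>"
  defines "P \<equiv> enn2real p"
  shows "integrable (lebesgue_on \<Omega>) (\<lambda>x. norm (jet \<Omega> u x) powr P)"
    and "(\<integral>x. norm (jet \<Omega> u x) powr P \<partial>lebesgue_on \<Omega>) \<le> (2 * sobolev_norm p \<Omega> u) powr P"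
proof -
  have P: "P \<ge> 1" unfolding P_def using p by (metis enn2real_mono enn2real_1 top.not_eq_extremum infinity_ennreal_def)
  let ?M = "lebesgue_on \<Omega>"
  let ?f = "\<lambda>x. norm (rep_aefun u x) powr P" and ?g = "\<lambda>x. norm (weak_gradient \<Omega> u x) powr P"
  have fi: "integrable ?M ?f" and gi: "integrable ?M ?g"
    using u sobolev_weak_gradient_Lp[OF \<Omega> u] p by (auto simp: sobolev_def Lp_def P_def)
  have le: "norm (jet \<Omega> u x) powr P \<le> 2 powr P * (?f x + ?g x)" for x
    using powr_mono2[OF _ _ norm_jet_le[of \<Omega> u x], of P] P
      powr_add_le[of "norm (rep_aefun u x)" "norm (weak_gradient \<Omega> u x)" P] by simp
  show i: "integrable ?M (\<lambda>x. norm (jet \<Omega> u x) powr P)"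
  proof (rule Bochner_Integration.integrable_bound)
    show "integrable ?M (\<lambda>x. 2 powr P * (?f x + ?g x))" using fi gi by auto
    show "(\<lambda>x. norm (jet \<Omega> u x) powr P) \<in> borel_measurable ?M" using jet_measurable[OF \<Omega> u] by measurable
    show "AE x in ?M. norm (norm (jet \<Omega> u x) powr P) \<le> norm (2 powr P * (?f x + ?g x))"
      using le by (intro AE_I2) (smt (verit) powr_ge_zero real_norm_def)
  qed
  have "(\<integral>x. norm (jet \<Omega> u x) powr P \<partial>?M) \<le> (\<integral>x. 2 powr P * (?f x + ?g x) \<partial>?M)"
    using fi gi i le by (intro integral_mono) auto
  also have "\<dots> = 2 powr P * ((\<integral>x. ?f x \<partial>?M) + (\<integral>x. ?g x \<partial>?M))" using fi gi by simp
  also have "(\<integral>x. ?f x \<partial>?M) + (\<integral>x. ?g x \<partial>?M) = sobolev_norm p \<Omega> u powr P"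
  proof -
    have "0 \<le> (\<integral>x. ?f x \<partial>?M)" "0 \<le> (\<integral>x. ?g x \<partial>?M)" by (auto intro!: integral_nonneg_AE)
    moreover have "p \<noteq> top" using p by auto
    ultimately show ?thesis using P
      by (simp add: sobolev_norm_def Let_def Lp_norm_def P_def[symmetric] powr_powr)
  qed
  also have "2 powr P * sobolev_norm p \<Omega> u powr P = (2 * sobolev_norm p \<Omega> u) powr P"
    using p by (subst powr_mult) (auto simp: sobolev_norm_def Let_def)
  finally show "(\<integral>x. norm (jet \<Omega> u x) powr P \<partial>?M) \<le> (2 * sobolev_norm p \<Omega> u) powr P" .
qed

text \<open>The infimum is itself an essential bound: it suffices to intersect the countably many
  sets of full measure belonging to the bounds Inf + 1 / (n + 1).\<close>

lemma Lp_norm_infinity: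
  assumes "f \<in> Lp \<infinity> M"
  shows "0 \<le> Lp_norm \<infinity> M f" "AE x in M. norm (f x) \<le> Lp_norm \<infinity> M f"
proof -
  let ?S = "{K. 0 \<le> K \<and> (AE x in M. norm (f x) \<le> K)}"
  obtain K where "AE x in M. norm (f x) \<le> K" using assms by (auto simp: Lp_def)
  then have "AE x in M. norm (f x) \<le> max 0 K" by eventually_elim simp
  then have ne: "?S \<noteq> {}" by (intro ex_in_conv[THEN iffD1] exI[of _ "max 0 K"]) auto
  have bd: "bdd_below ?S" by (rule bdd_belowI[of _ 0]) auto
  show "0 \<le> Lp_norm \<infinity> M f" unfolding Lp_norm_def using ne by (auto intro!: cInf_greatest)
  have "AE x in M. norm (f x) \<le> Inf ?S + 1 / real (Suc n)" for n
  proof -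
    have "Inf ?S < Inf ?S + 1 / real (Suc n)" by simp
    from cInf_lessD[OF ne this] obtain K where "K < Inf ?S + 1 / real (Suc n)" "AE x in M. norm (f x) \<le> K" by auto
    from this(2) show ?thesis by eventually_elim (use \<open>K < _\<close> in auto)
  qed
  then have "AE x in M. \<forall>n. norm (f x) \<le> Inf ?S + 1 / real (Suc n)" by (simp add: AE_all_countable)
  then have "AE x in M. norm (f x) \<le> Inf ?S"
  proof eventually_elim
    case (elim x)
    have "(\<lambda>n. Inf ?S + 1 / real (Suc n)) \<longlonglongrightarrow> Inf ?S + 0" by (intro tendsto_intros LIMSEQ_Suc[OF lim_1_over_n])
    then have "norm (f x) \<le> Inf ?S + 0" by (rule LIMSEQ_le_const) (use elim in auto)
    then show ?case by simp
  qed
  then show "AE x in M. norm (f x) \<le> Lp_norm \<infinity> M f" unfolding Lp_norm_def by simp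
qed

lemma sobolev_norm_nonneg:
  assumes "open \<Omega>" "u \<in> sobolev p \<Omega>" shows "0 \<le> sobolev_norm p \<Omega> u"
  using Lp_norm_infinity(1)[of "rep_aefun u" "lebesgue_on \<Omega>"] assms(2)
  by (auto simp: sobolev_norm_def Let_def sobolev_def le_max_iff_disj)

lemma jet_infinity_bound:
  fixes u :: "(real^'d, real^'m) aefun"
  assumes \<Omega>: "open \<Omega>" and u: "u \<in> sobolev \<infinity> \<Omega>"
  shows "AE x in lebesgue_on \<Omega>. norm (jet \<Omega> u x) \<le> 2 * sobolev_norm \<infinity> \<Omega> u"
proof -
  have "rep_aefun u \<in> Lp \<infinity> (lebesgue_on \<Omega>)" using u by (simp add: sobolev_def)
  from Lp_norm_infinity(2)[OF this] Lp_norm_infinity(2)[OF sobolev_weak_gradient_Lp[OF \<Omega> u]]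
  show ?thesis
  proof eventually_elim
    case (elim x)
    then show ?case using norm_jet_le[of \<Omega> u x] by (simp add: sobolev_norm_def Let_def)
  qed
qed

section \<open>Integral functionals of jets\<close>

text \<open>What the argument uses of Sobolev spaces. \<open>V\<close> is a set because the space
  depends on \<Omega> and p, which a type cannot; \<open>J\<close> is linear almost everywhere only;
  the factor 2 comes from |(u, g)| \<le> |u| + |g| and is the same for all p.\<close>

locale jets = sigma_finite_measure M for M :: "'a measure" +
  fixes p :: ennreal and V :: "'v::real_vector set" and N :: "'v \<Rightarrow> real"
    and J :: "'v \<Rightarrow> 'a \<Rightarrow> 'e::euclidean_space"
  assumes p_ge_1: "1 \<le> p"
    and V_zero: "0 \<in> V"
    and V_add: "u \<in> V \<Longrightarrow> w \<in> V \<Longrightarrow> u + w \<in> V"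
    and V_scaleR: "u \<in> V \<Longrightarrow> c *\<^sub>R u \<in> V"
    and J_measurable: "u \<in> V \<Longrightarrow> J u \<in> borel_measurable M"
    and J_add: "u \<in> V \<Longrightarrow> w \<in> V \<Longrightarrow> AE x in M. J (u + w) x = J u x + J w x"
    and J_scaleR: "u \<in> V \<Longrightarrow> AE x in M. J (c *\<^sub>R u) x = c *\<^sub>R J u x"
    and N_zero: "N 0 = 0"
    and N_nonneg: "u \<in> V \<Longrightarrow> 0 \<le> N u"
    and J_powr_integrable: "p < \<infinity> \<Longrightarrow> u \<in> V \<Longrightarrow> integrable M (\<lambda>x. norm (J u x) powr enn2real p)"
    and J_powr_integral_le: "p < \<infinity> \<Longrightarrow> u \<in> V \<Longrightarrow>
      (\<integral>x. norm (J u x) powr enn2real p \<partial>M) \<le> (2 * N u) powr enn2real p"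
    and J_infinity_le: "p = \<infinity> \<Longrightarrow> u \<in> V \<Longrightarrow> AE x in M. norm (J u x) \<le> 2 * N u"
begin

text \<open>The nonnegative functions in \<open>L\<^sup>p\<close>, which bound jets, and those in the dual space
  \<open>L\<^bsup>p'\<^esup>\<close>, which bound the second components of the hypo- and hyperdifferentials.\<close>

definition radii :: "('a \<Rightarrow> real) set" where
  "radii = {r \<in> borel_measurable M. (AE x in M. 0 \<le> r x) \<and>
     (if p = \<infinity> then \<exists>K. AE x in M. r x \<le> K else integrable M (\<lambda>x. r x powr enn2real p))}"

definition weights :: "('a \<Rightarrow> real) set" where
  "weights = {k \<in> borel_measurable M. (AE x in M. 0 \<le> k x) \<and>
     (if p = \<infinity> then integrable M k else if p = 1 then \<exists>K. AE x in M. k x \<le> K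
      else integrable M (\<lambda>x. k x powr (enn2real p / (enn2real p - 1))))}"

lemma p_real: "p < \<infinity> \<Longrightarrow> 1 \<le> enn2real p" "p < \<infinity> \<Longrightarrow> p \<noteq> 1 \<Longrightarrow> 1 < enn2real p"
proof -
  assume "p < \<infinity>"
  then obtain P where P: "p = ennreal P" "0 \<le> P" by (cases p) auto
  with p_ge_1 show "1 \<le> enn2real p" by simp
  assume "p \<noteq> 1"
  with P \<open>1 \<le> enn2real p\<close> show "1 < enn2real p" by (auto simp: less_le)
qed

lemma conjugate_exponent:
  assumes "p < \<infinity>" "p \<noteq> 1"
  shows "1 < enn2real p / (enn2real p - 1)" "1 / (enn2real p / (enn2real p - 1)) + 1 / enn2real p = 1"
  using p_real(2)[OF assms] by (auto simp: field_simps)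

text \<open>Hoelder's inequality in its three regimes: the weight lies in L^1, in L^\<infinity>, or
  in L^p' with 1 < p' < \<infinity>.\<close>

lemma weights_pairing:
  assumes k: "k \<in> weights"
  obtains K where "0 \<le> K" "\<And>h. h \<in> V \<Longrightarrow> integrable M (\<lambda>x. k x * norm (J h x))"
    "\<And>h. h \<in> V \<Longrightarrow> (\<integral>x. k x * norm (J h x) \<partial>M) \<le> K * N h"
proof -
  have km[measurable]: "k \<in> borel_measurable M" and k0: "AE x in M. 0 \<le> k x"
    using k by (auto simp: weights_def)
  note [measurable] = J_measurable
  consider "p = \<infinity>" | "p < \<infinity>" "p = 1" | "p < \<infinity>" "p \<noteq> 1" by (cases "p = \<infinity>") (auto simp: top.not_eq_extremum)
  then show ?thesis
  proof cases
    case 1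
    then have ki: "integrable M k" using k[unfolded weights_def] by simp
    have le: "AE x in M. k x * norm (J h x) \<le> k x * (2 * N h)" if "h \<in> V" for h
      using k0 J_infinity_le[OF 1 that] by eventually_elim (rule mult_left_mono)
    have i: "integrable M (\<lambda>x. k x * norm (J h x))" if h: "h \<in> V" for h
    proof (rule Bochner_Integration.integrable_bound)
      show "integrable M (\<lambda>x. k x * (2 * N h))" using ki by simp
      show "AE x in M. norm (k x * norm (J h x)) \<le> norm (k x * (2 * N h))"
        using k0 le[OF h] by eventually_elim simp
    qed (use h in measurable)
    have "(\<integral>x. k x * norm (J h x) \<partial>M) \<le> (2 * (\<integral>x. k x \<partial>M)) * N h" if h: "h \<in> V" for h
    proof -
      have "(\<integral>x. k x * norm (J h x) \<partial>M) \<le> (\<integral>x. k x * (2 * N h) \<partial>M)"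
        using ki i[OF h] le[OF h] by (intro integral_mono_AE) auto
      then show ?thesis by (simp add: mult_ac)
    qed
    moreover have "0 \<le> 2 * (\<integral>x. k x \<partial>M)" using integral_nonneg_AE[OF k0] by simp
    ultimately show ?thesis using i that by blast
  next
    case 2
    then obtain K where "AE x in M. k x \<le> K" using k[unfolded weights_def] by auto
    then have K: "AE x in M. k x \<le> max 0 K" by eventually_elim simp
    have Ji: "integrable M (\<lambda>x. norm (J h x))" "(\<integral>x. norm (J h x) \<partial>M) \<le> 2 * N h" if "h \<in> V" for h
      using J_powr_integrable[OF 2(1) that] J_powr_integral_le[OF 2(1) that] 2 N_nonneg[OF that] by auto
    have le: "AE x in M. k x * norm (J h x) \<le> max 0 K * norm (J h x)" for h
      using K by eventually_elim (rule mult_right_mono, auto)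
    have i: "integrable M (\<lambda>x. k x * norm (J h x))" if h: "h \<in> V" for h
    proof (rule Bochner_Integration.integrable_bound)
      show "integrable M (\<lambda>x. max 0 K * norm (J h x))" using Ji[OF h] by simp
      show "AE x in M. norm (k x * norm (J h x)) \<le> norm (max 0 K * norm (J h x))"
        using k0 le[of h] by eventually_elim simp
    qed (use h in measurable)
    have "(\<integral>x. k x * norm (J h x) \<partial>M) \<le> (max 0 K * 2) * N h" if h: "h \<in> V" for h
    proof -
      have "(\<integral>x. k x * norm (J h x) \<partial>M) \<le> (\<integral>x. max 0 K * norm (J h x) \<partial>M)"
        using Ji[OF h] i[OF h] le[of h] by (intro integral_mono_AE) auto
      also have "\<dots> \<le> max 0 K * (2 * N h)" using Ji(2)[OF h] by (simp add: mult_left_mono)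
      finally show ?thesis by (simp add: mult_ac)
    qed
    then show ?thesis using i that[of "max 0 K * 2"] by simp
  next
    case 3
    define P where "P = enn2real p"
    define q where "q = P / (P - 1)"
    have kq: "integrable M (\<lambda>x. k x powr q)" using 3 k by (auto simp: weights_def P_def q_def)
    have P: "P > 1" "q > 1" "1 / q + 1 / P = 1"
      using p_real(2)[OF 3] conjugate_exponent[OF 3] by (auto simp: P_def q_def)
    have H: "integrable M (\<lambda>x. k x * norm (J h x))"
       "(\<integral>x. k x * norm (J h x) \<partial>M) \<le> (\<integral>x. k x powr q \<partial>M) powr (1 / q) * (\<integral>x. norm (J h x) powr P \<partial>M) powr (1 / P)"
      if h: "h \<in> V" for h
      using Holder_inequality[OF P(2,1,3) km k0 kq, of "\<lambda>x. norm (J h x)"] J_powr_integrable[OF 3(1) h] J_measurable[OF h]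
      by (auto simp: P_def)
    have "(\<integral>x. k x * norm (J h x) \<partial>M) \<le> ((\<integral>x. k x powr q \<partial>M) powr (1 / q) * 2) * N h" if h: "h \<in> V" for h
    proof -
      have "(\<integral>x. norm (J h x) powr P \<partial>M) powr (1 / P) \<le> ((2 * N h) powr P) powr (1 / P)"
        using J_powr_integral_le[OF 3(1) h] P by (intro powr_mono2) (auto simp: P_def intro!: integral_nonneg_AE)
      also have "\<dots> = 2 * N h" using P N_nonneg[OF h] by (simp add: powr_powr)
      finally have "(\<integral>x. norm (J h x) powr P \<partial>M) powr (1 / P) \<le> 2 * N h" .
      from mult_left_mono[OF this, of "(\<integral>x. k x powr q \<partial>M) powr (1 / q)"] H(2)[OF h] show ?thesis
        by (simp add: mult_ac)
    qed
    then show ?thesis using H(1) that[of "(\<integral>x. k x powr q \<partial>M) powr (1 / q) * 2"] by simp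
  qed
qed

text \<open>Dominated convergence gives e n \<rightarrow> 0 in L^p', and Hoelder's inequality makes
  the pairing small uniformly on the unit ball. For p = 1 the first half is lost, as dominated
  convergence fails in L^\<infinity>.\<close>

lemma weights_pairing_tendsto_0:
  assumes p: "1 < p" and k: "k \<in> weights"
    and e: "\<And>n. e n \<in> borel_measurable M" "\<And>n. AE x in M. 0 \<le> e n x" "\<And>n. AE x in M. e n x \<le> k x"
      "AE x in M. (\<lambda>n. e n x) \<longlonglongrightarrow> 0"
    and \<epsilon>: "\<epsilon> > 0"
  shows "\<forall>\<^sub>F n in sequentially. \<forall>h\<in>V. N h \<le> 1 \<longrightarrow> (\<integral>x. e n x * norm (J h x) \<partial>M) \<le> \<epsilon>"
proof -
  have km[measurable]: "k \<in> borel_measurable M" and k0: "AE x in M. 0 \<le> k x"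
    using k by (auto simp: weights_def)
  note [measurable] = J_measurable e(1)
  consider "p = \<infinity>" | "p < \<infinity>" "p \<noteq> 1" using p by (cases "p = \<infinity>") (auto simp: top.not_eq_extremum)
  then show ?thesis
  proof cases
    case 1
    then have ki: "integrable M k" using k[unfolded weights_def] by simp
    have ei: "integrable M (e n)" for n
      by (rule Bochner_Integration.integrable_bound[OF ki]) (use e(2,3)[of n] in \<open>auto elim: eventually_elim2\<close>)
    have "(\<lambda>n. \<integral>x. e n x \<partial>M) \<longlonglongrightarrow> (\<integral>x. 0 \<partial>M)"
    proof (rule integral_dominated_convergence[OF _ _ ki e(4)])
      show "AE x in M. norm (e n x) \<le> k x" for n using e(2,3)[of n] by eventually_elim simp
    qed auto
    then have "\<forall>\<^sub>F n in sequentially. (\<integral>x. e n x \<partial>M) < \<epsilon> / 2" using \<epsilon> by (intro order_tendstoD) auto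
    then show ?thesis
    proof eventually_elim
      case (elim n)
      show ?case
      proof (intro ballI impI)
        fix h assume h: "h \<in> V" "N h \<le> 1"
        have le: "AE x in M. e n x * norm (J h x) \<le> e n x * 2"
          using e(2)[of n] J_infinity_le[OF 1 h(1)]
          by eventually_elim (rule mult_left_mono, use h(2) in auto)
        have "(\<integral>x. e n x * norm (J h x) \<partial>M) \<le> (\<integral>x. e n x * 2 \<partial>M)"
        proof (rule integral_mono_AE[OF _ _ le])
          show "integrable M (\<lambda>x. e n x * 2)" using ei by simp
          then show "integrable M (\<lambda>x. e n x * norm (J h x))"
            by (rule Bochner_Integration.integrable_bound)
               (use h le e(2)[of n] in \<open>auto elim: eventually_elim2\<close>)
        qed
        then show "(\<integral>x. e n x * norm (J h x) \<partial>M) \<le> \<epsilon>" using elim by simp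
      qed
    qed
  next
    case 2
    define P where "P = enn2real p"
    define q where "q = P / (P - 1)"
    have p2: "p \<noteq> top" "p \<noteq> 1" using 2 by auto
    have kq: "integrable M (\<lambda>x. k x powr q)" using p2 k by (auto simp: weights_def P_def q_def)
    have P: "P > 1" "q > 1" "1 / q + 1 / P = 1"
      using p_real(2)[OF 2] conjugate_exponent[OF 2] by (auto simp: P_def q_def)
    have le: "AE x in M. e n x powr q \<le> k x powr q" for n
      using e(2,3)[of n] by eventually_elim (use P in \<open>auto intro!: powr_mono2\<close>)
    have ei: "integrable M (\<lambda>x. e n x powr q)" for n
      by (rule Bochner_Integration.integrable_bound[OF kq]) (use le[of n] in auto)
    have "(\<lambda>n. \<integral>x. e n x powr q \<partial>M) \<longlonglongrightarrow> (\<integral>x. 0 \<partial>M)"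
    proof (rule integral_dominated_convergence[OF _ _ kq])
      show "AE x in M. norm (e n x powr q) \<le> k x powr q" for n using le[of n] by simp
      have "AE x in M. \<forall>n. 0 \<le> e n x" using e(2) by (simp add: AE_all_countable)
      with e(4) show "AE x in M. (\<lambda>n. e n x powr q) \<longlonglongrightarrow> 0"
      proof eventually_elim
        case (elim x)
        have "(\<lambda>n. e n x powr q) \<longlonglongrightarrow> 0 powr q"
          by (rule tendsto_powr') (use elim P in auto)
        then show ?case by simp
      qed
    qed auto
    then have "(\<lambda>n. (\<integral>x. e n x powr q \<partial>M) powr (1 / q) * 2) \<longlonglongrightarrow> (0 powr (1 / q)) * 2"
      using P by (intro tendsto_mult tendsto_const tendsto_powr')
        (auto intro!: always_eventually integral_nonneg_AE)
    then have "\<forall>\<^sub>F n in sequentially. (\<integral>x. e n x powr q \<partial>M) powr (1 / q) * 2 < \<epsilon>"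
      using \<epsilon> by (intro order_tendstoD) auto
    then show ?thesis
    proof eventually_elim
      case (elim n)
      show ?case
      proof (intro ballI impI)
        fix h assume h: "h \<in> V" "N h \<le> 1"
        have "(\<integral>x. e n x * norm (J h x) \<partial>M)
            \<le> (\<integral>x. e n x powr q \<partial>M) powr (1 / q) * (\<integral>x. norm (J h x) powr P \<partial>M) powr (1 / P)"
          using J_powr_integrable[OF 2(1) h(1)] J_measurable[OF h(1)]
          by (intro Holder_inequality(2)[OF P(2,1,3) e(1,2) ei]) (auto simp: P_def)
        also have "(\<integral>x. norm (J h x) powr P \<partial>M) powr (1 / P) \<le> ((2 * N h) powr P) powr (1 / P)"
          using J_powr_integral_le[OF 2(1) h(1)] P by (intro powr_mono2) (auto simp: P_def intro!: integral_nonneg_AE)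
        also have "\<dots> = 2 * N h" using P N_nonneg[OF h(1)] by (simp add: powr_powr)
        also have "\<dots> \<le> 2" using h by simp
        finally have "(\<integral>x. e n x * norm (J h x) \<partial>M) \<le> (\<integral>x. e n x powr q \<partial>M) powr (1 / q) * 2"
          by (simp add: mult_left_mono)
        then show "(\<integral>x. e n x * norm (J h x) \<partial>M) \<le> \<epsilon>" using elim by simp
      qed
    qed
  qed
qed

lemma norm_jet_radii: "u \<in> V \<Longrightarrow> (\<lambda>x. norm (J u x)) \<in> radii"
  using J_measurable J_powr_integrable J_infinity_le
  by (auto simp: radii_def top.not_eq_extremum)

lemma radii_add:
  assumes "r \<in> radii" "s \<in> radii" shows "(\<lambda>x. r x + s x) \<in> radii"
proof -
  have m[measurable]: "r \<in> borel_measurable M" "s \<in> borel_measurable M"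
    and nn: "AE x in M. 0 \<le> r x" "AE x in M. 0 \<le> s x"
    using assms by (auto simp: radii_def)
  have nn': "AE x in M. 0 \<le> r x + s x" using nn by eventually_elim simp
  show ?thesis
  proof (cases "p = \<infinity>")
    case True
    then obtain K L where "AE x in M. r x \<le> K" "AE x in M. s x \<le> L" using assms[unfolded radii_def] by auto
    then have "AE x in M. r x + s x \<le> K + L" by eventually_elim simp
    then show ?thesis unfolding radii_def using True nn' m by auto
  next
    case False
    let ?P = "enn2real p"
    have "integrable M (\<lambda>x. (r x + s x) powr ?P)"
    proof (rule Bochner_Integration.integrable_bound)
      show "integrable M (\<lambda>x. 2 powr ?P * (r x powr ?P + s x powr ?P))"
        using assms False by (auto simp: radii_def)
      show "AE x in M. norm ((r x + s x) powr ?P) \<le> norm (2 powr ?P * (r x powr ?P + s x powr ?P))"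
        using nn by eventually_elim (use powr_add_le in simp)
    qed simp
    then show ?thesis using False nn' m by (auto simp: radii_def)
  qed
qed

text \<open>Convergence at a geometric rate makes \<open>\<Sum>n. norm (J (w n - u) x) powr p\<close> integrable, which yields both
  the almost everywhere limit and the dominating function without passing to a subsequence.\<close>

lemma radii_dominating_sequence:
  assumes u: "u \<in> V" and w: "\<And>n. w n \<in> V" and lim: "\<And>n. N (w n - u) \<le> (1 / 2) ^ n / 2"
  obtains r where "r \<in> radii" "AE x in M. \<forall>n. norm (J (w n) x) \<le> r x" "AE x in M. norm (J u x) \<le> r x"
    "AE x in M. (\<lambda>n. J (w n) x) \<longlonglongrightarrow> J u x"
proof -
  have d: "w n - u \<in> V" for n using V_add[OF w V_scaleR[OF u, of "-1"]] by simp
  have "AE x in M. J (w n) x = J u x + J (w n - u) x" for n using J_add[OF u d[of n]] by simp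
  then have Jd: "AE x in M. \<forall>n. J (w n) x = J u x + J (w n - u) x" by (simp add: AE_all_countable)
  have half: "(\<lambda>n. (1 / 2) ^ n :: real) \<longlonglongrightarrow> 0" by (rule LIMSEQ_realpow_zero) auto
  have "\<exists>s. s \<in> radii \<and> (AE x in M. 0 \<le> s x) \<and> (AE x in M. \<forall>n. norm (J (w n - u) x) \<le> s x) \<and>
      (AE x in M. (\<lambda>n. norm (J (w n - u) x)) \<longlonglongrightarrow> 0)"
  proof (cases "p = \<infinity>")
    case True
    have "AE x in M. norm (J (w n - u) x) \<le> (1 / 2) ^ n" for n
      using J_infinity_le[OF True d[of n]] lim[of n] by (auto elim: eventually_mono)
    then have b: "AE x in M. \<forall>n. norm (J (w n - u) x) \<le> (1 / 2) ^ n" by (simp add: AE_all_countable)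
    have "AE x in M. (\<lambda>n. norm (J (w n - u) x)) \<longlonglongrightarrow> 0"
      using b by eventually_elim (rule tendsto_sandwich[OF _ _ tendsto_const half], auto)
    moreover have "AE x in M. \<forall>n. norm (J (w n - u) x) \<le> 1"
      using b
    proof eventually_elim
      case (elim x)
      have "(1 / 2) ^ n \<le> (1 :: real)" for n by (simp add: power_le_one)
      with elim show ?case by (meson order_trans)
    qed
    moreover have "(\<lambda>_. 1) \<in> radii" unfolding radii_def using True by auto
    ultimately show ?thesis by (intro exI[of _ "\<lambda>_. 1"]) auto
  next
    case False
    then have pf: "p < \<infinity>" by (simp add: top.not_eq_extremum)
    define P where "P = enn2real p"
    have P: "P \<ge> 1" using p_real(1)[OF pf] by (simp add: P_def)
    define s where "s n x = norm (J (w n - u) x) powr P" for n x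
    have si: "integrable M (s n)" for n unfolding s_def P_def by (rule J_powr_integrable[OF pf d])
    have s0: "0 \<le> s n x" for n x by (simp add: s_def)
    \<comment> \<open>The extra division by 2 in \<open>lim\<close> cancels the factor 2 of the jet
      bound. The base is then at most 1, so the exponent P may be lowered to 1, which leaves a
      summable geometric sequence.\<close>
    have sle: "(\<integral>x. s n x \<partial>M) \<le> (1 / 2) ^ n" for n
    proof -
      have "(\<integral>x. s n x \<partial>M) \<le> (2 * N (w n - u)) powr P"
        unfolding s_def P_def by (rule J_powr_integral_le[OF pf d])
      also have "\<dots> \<le> ((1 / 2) ^ n) powr P" using lim[of n] P N_nonneg[OF d[of n]] by (intro powr_mono2) auto
      also have "\<dots> \<le> ((1 / 2) ^ n) powr 1" using P by (intro powr_mono') (auto simp: power_le_one)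
      finally show ?thesis by simp
    qed
    have sum1: "summable (\<lambda>n. \<integral>x. norm (s n x) \<partial>M)"
      by (rule summable_comparison_test'[of "\<lambda>n. (1 / 2) ^ n" 0])
         (use sle s0 in \<open>auto simp: abs_of_nonneg integral_nonneg_AE\<close>)
    have "(\<integral>\<^sup>+x. (\<Sum>n. ennreal (s n x)) \<partial>M) = (\<Sum>n. \<integral>\<^sup>+x. ennreal (s n x) \<partial>M)"
      using si by (intro nn_integral_suminf) auto
    also have "\<dots> = (\<Sum>n. ennreal (\<integral>x. s n x \<partial>M))"
      using si s0 by (intro suminf_cong nn_integral_eq_integral) auto
    also have "\<dots> = ennreal (\<Sum>n. (\<integral>x. s n x \<partial>M))"
      using sum1 s0 by (intro suminf_ennreal2) (auto intro!: integral_nonneg_AE)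
    finally have "(\<integral>\<^sup>+x. (\<Sum>n. ennreal (s n x)) \<partial>M) \<noteq> \<infinity>" by simp
    then have "AE x in M. (\<Sum>n. ennreal (s n x)) \<noteq> \<infinity>"
      using si by (intro nn_integral_PInf_AE) auto
    then have sumAE: "AE x in M. summable (\<lambda>n. s n x)"
      by eventually_elim (use s0 in \<open>auto intro!: summable_suminf_not_top\<close>)
    define S where "S x = (\<Sum>n. s n x)" for x
    have Si: "integrable M S"
      unfolding S_def using sumAE s0 by (intro integrable_suminf[OF si _ sum1]) auto
    have S0: "AE x in M. 0 \<le> S x" using sumAE unfolding S_def by eventually_elim (rule suminf_nonneg, use s0 in auto)
    have "AE x in M. \<forall>n. s n x \<le> S x" using sumAE unfolding S_def
    proof eventually_elim
      case (elim x)
      show ?case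
      proof
        fix n show "s n x \<le> (\<Sum>n. s n x)"
          using sum_le_suminf[OF elim, of "{n}"] s0 by simp
      qed
    qed
    then have b: "AE x in M. \<forall>n. norm (J (w n - u) x) \<le> S x powr (1 / P)"
    proof eventually_elim
      case (elim x)
      show ?case
      proof
        fix n
        have "norm (J (w n - u) x) = s n x powr (1 / P)" using P by (simp add: s_def powr_powr)
        also have "\<dots> \<le> S x powr (1 / P)" using elim s0 P by (intro powr_mono2) auto
        finally show "norm (J (w n - u) x) \<le> S x powr (1 / P)" .
      qed
    qed
    have "AE x in M. (\<lambda>n. norm (J (w n - u) x)) \<longlonglongrightarrow> 0"
      using sumAE
    proof eventually_elim
      case (elim x)
      have "(\<lambda>n. s n x powr (1 / P)) \<longlonglongrightarrow> 0 powr (1 / P)"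
        using summable_LIMSEQ_zero[OF elim] P s0 by (intro tendsto_powr') (auto intro!: always_eventually)
      then show ?case using P by (simp add: s_def powr_powr)
    qed
    moreover have "(\<lambda>x. S x powr (1 / P)) \<in> radii"
    proof -
      have "integrable M (\<lambda>x. (S x powr (1 / P)) powr P)"
        by (subst integrable_cong_AE[where g = S])
           (use Si S0 P in \<open>auto simp: powr_powr elim!: eventually_mono\<close>)
      then show ?thesis using False Si by (auto simp: radii_def P_def)
    qed
    ultimately show ?thesis using b by (intro exI[of _ "\<lambda>x. S x powr (1 / P)"]) auto
  qed
  then obtain s where s: "s \<in> radii" "AE x in M. 0 \<le> s x" "AE x in M. \<forall>n. norm (J (w n - u) x) \<le> s x"
      "AE x in M. (\<lambda>n. norm (J (w n - u) x)) \<longlonglongrightarrow> 0" by blast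
  show ?thesis
  proof
    show "(\<lambda>x. norm (J u x) + s x) \<in> radii" by (rule radii_add[OF norm_jet_radii[OF u] s(1)])
    show "AE x in M. \<forall>n. norm (J (w n) x) \<le> norm (J u x) + s x"
      using Jd s(3) by eventually_elim (metis add_left_mono norm_triangle_ineq order_trans)
    show "AE x in M. norm (J u x) \<le> norm (J u x) + s x" using s(2) by eventually_elim simp
    show "AE x in M. (\<lambda>n. J (w n) x) \<longlonglongrightarrow> J u x"
      using Jd s(4)
    proof eventually_elim
      case (elim x)
      then have "(\<lambda>n. J u x + J (w n - u) x) \<longlonglongrightarrow> J u x + 0"
        by (intro tendsto_add tendsto_const) (simp add: tendsto_norm_zero_iff)
      then show ?case using elim by simp
    qed
  qed
qed

end

section \<open>Hausdorff distance, dual norm and differentials given by selections\<close>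

lemma hausdorff_dist_lessD:
  assumes "hausdorff_dist dist A B < ennreal \<epsilon>"
  shows "a \<in> A \<Longrightarrow> \<exists>b\<in>B. dist a b < \<epsilon>" and "b \<in> B \<Longrightarrow> \<exists>a\<in>A. dist a b < \<epsilon>"
proof -
  have 1: "(SUP x\<in>A. INF y\<in>B. ennreal (dist x y)) < ennreal \<epsilon>" "(SUP y\<in>B. INF x\<in>A. ennreal (dist x y)) < ennreal \<epsilon>"
    using assms by (auto simp: hausdorff_dist_def)
  show "\<exists>b\<in>B. dist a b < \<epsilon>" if "a \<in> A"
  proof -
    have "(INF y\<in>B. ennreal (dist a y)) < ennreal \<epsilon>"
      using 1(1) that by (meson SUP_upper le_less_trans)
    then show ?thesis by (auto simp: INF_less_iff ennreal_less_iff)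
  qed
  show "\<exists>a\<in>A. dist a b < \<epsilon>" if "b \<in> B"
  proof -
    have "(INF x\<in>A. ennreal (dist x b)) < ennreal \<epsilon>"
      using 1(2) that by (meson SUP_upper le_less_trans)
    then show ?thesis by (auto simp: INF_less_iff ennreal_less_iff)
  qed
qed

lemma infdist_le_add_if_near:
  assumes "A \<noteq> {}" "\<And>a. a \<in> A \<Longrightarrow> \<exists>b\<in>B. dist a b < \<epsilon>"
  shows "infdist z B \<le> infdist z A + \<epsilon>"
proof -
  have "infdist z B - \<epsilon> \<le> infdist z A"
    unfolding infdist_notempty[OF assms(1)]
  proof (rule cINF_greatest[OF assms(1)])
    fix a assume "a \<in> A"
    then obtain b where b: "b \<in> B" "dist a b < \<epsilon>" using assms(2) by blast
    then have "infdist z B \<le> dist z b" by (simp add: infdist_le)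
    then show "infdist z B - \<epsilon> \<le> dist z a" using b(2) dist_triangle[of z b a] by linarith
  qed
  then show ?thesis by simp
qed

text \<open>Reduces the composition of a Caratheodory multifunction with a measurable function to
  the single-valued composition lemma, applied to the distance functions.\<close>

lemma continuous_on_infdist_hausdorff:
  fixes G :: "'x::metric_space \<Rightarrow> 'y::metric_space set"
  assumes G: "hausdorff_continuous_on UNIV dist dist G" and ne: "\<And>y. G y \<noteq> {}"
  shows "continuous_on UNIV (\<lambda>y. infdist z (G y))"
  unfolding continuous_on_iff
proof (intro ballI allI impI)
  fix y :: 'x and \<epsilon> :: real assume "\<epsilon> > 0"
  then obtain \<delta> where \<delta>: "\<delta> > 0" "\<And>w. dist w y < \<delta> \<Longrightarrow> hausdorff_dist dist (G w) (G y) < ennreal (\<epsilon> / 2)"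
    using G unfolding hausdorff_continuous_on_def by (meson UNIV_I half_gt_zero)
  have "dist (infdist z (G w)) (infdist z (G y)) < \<epsilon>" if w: "dist w y < \<delta>" for w
  proof -
    note near = hausdorff_dist_lessD[OF \<delta>(2)[OF w]]
    have "infdist z (G y) \<le> infdist z (G w) + \<epsilon> / 2" by (rule infdist_le_add_if_near[OF ne near(1)])
    moreover have "infdist z (G w) \<le> infdist z (G y) + \<epsilon> / 2"
      by (rule infdist_le_add_if_near[OF ne]) (metis near(2) dist_commute)
    ultimately show ?thesis using \<open>\<epsilon> > 0\<close> unfolding dist_real_def by linarith
  qed
  then show "\<exists>d>0. \<forall>x'\<in>UNIV. dist x' y < d \<longrightarrow> dist (infdist z (G x')) (infdist z (G y)) < \<epsilon>"
    using \<delta>(1) by blast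
qed

lemma dual_norm_le:
  assumes "0 \<in> V" "N 0 = 0" "\<And>h. h \<in> V \<Longrightarrow> N h \<le> 1 \<Longrightarrow> \<bar>\<phi> h\<bar> \<le> \<epsilon>"
  shows "0 \<le> dual_norm V N \<phi>" "dual_norm V N \<phi> \<le> \<epsilon>"
proof -
  have ne: "{h \<in> V. N h \<le> 1} \<noteq> {}" using assms by force
  show "dual_norm V N \<phi> \<le> \<epsilon>" unfolding dual_norm_def using assms by (intro cSUP_least[OF ne]) auto
  show "0 \<le> dual_norm V N \<phi>" unfolding dual_norm_def
    using assms by (intro cSUP_upper2[where x = 0] bdd_aboveI2[where M = \<epsilon>]) auto
qed

lemma real_dual_dist_le:
  assumes "0 \<in> V" "N 0 = 0" "\<And>h. h \<in> V \<Longrightarrow> N h \<le> 1 \<Longrightarrow> \<bar>\<phi> h - \<psi> h\<bar> \<le> \<epsilon>" "\<bar>a - b\<bar> \<le> \<delta>"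
  shows "real_dual_dist V N (a, \<phi>) (b, \<psi>) \<le> \<delta> + \<epsilon>"
proof -
  note d = dual_norm_le[of V N "\<lambda>h. \<phi> h - \<psi> h", OF assms(1,2,3)]
  have "sqrt (\<bar>a - b\<bar>\<^sup>2 + (dual_norm V N (\<lambda>h. \<phi> h - \<psi> h))\<^sup>2) \<le> \<bar>a - b\<bar> + dual_norm V N (\<lambda>h. \<phi> h - \<psi> h)"
    using d(1) by (intro sqrt_sum_squares_le_sum) auto
  then show ?thesis using d(2) assms(4) by (simp add: real_dual_dist_def)
qed

context jets
begin

text \<open>The abstract form of \<open>integral_differential\<close>, with a pair of a scalar and a
  jet covector in place of the triple;
  \<open>integral_differential_eq_selection_differential\<close> identifies the two.\<close>

definition selection_differential :: "('a \<Rightarrow> 'e \<Rightarrow> (real \<times> 'e) set) \<Rightarrow> 'v \<Rightarrow> (real \<times> ('v \<Rightarrow> real)) set" where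
  "selection_differential G u = {(A, \<phi>). \<phi> \<in> dual V N \<and>
     (\<exists>z\<in>measurable_selections M (\<lambda>x. G x (J u x)).
        A = (\<integral>x. fst (z x) \<partial>M) \<and> (\<forall>h\<in>V. \<phi> h = (\<integral>x. snd (z x) \<bullet> J h x \<partial>M)))}"

end

text \<open>The pointwise assumptions are made at every point of \<open>space M\<close>, which a
  modification on a null set will justify. \<open>G_controlled\<close> condenses the growth
  conditions for all p: arguments bounded by an admissible r admit an integrable bound and a dual
  weight.\<close>

locale jet_multifunction = jets M p V N J
  for M :: "'a measure" and p and V :: "'v::real_vector set" and N
    and J :: "'v \<Rightarrow> 'a \<Rightarrow> 'e::euclidean_space" +
  fixes G :: "'a \<Rightarrow> 'e \<Rightarrow> (real \<times> 'e) set"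
  assumes G_nonempty: "x \<in> space M \<Longrightarrow> G x y \<noteq> {}"
    and G_compact: "x \<in> space M \<Longrightarrow> compact (G x y)"
    and G_convex: "x \<in> space M \<Longrightarrow> convex (G x y)"
    and G_infdist: "(\<lambda>x. infdist z (G x y)) \<in> borel_measurable M"
    and G_continuous: "x \<in> space M \<Longrightarrow> hausdorff_continuous_on UNIV dist dist (G x)"
    and G_controlled: "r \<in> radii \<Longrightarrow> \<exists>\<beta> k. integrable M \<beta> \<and> k \<in> weights \<and>
      (AE x in M. \<forall>y. norm y \<le> r x \<longrightarrow> (\<forall>(a, v)\<in>G x y. \<bar>a\<bar> \<le> \<beta> x \<and> norm v \<le> k x))"
begin

lemma compact_convex_map_compose:
  assumes "c \<in> borel_measurable M"
  shows "compact_convex_map M (\<lambda>x. G x (c x))"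
proof
  show "(\<lambda>x. infdist z (G x (c x))) \<in> borel_measurable M" for z
    by (rule borel_measurable_caratheodory_compose[where g = "\<lambda>x y. infdist z (G x y)"])
       (use G_infdist assms continuous_on_infdist_hausdorff[OF G_continuous G_nonempty] in blast)+
qed (auto simp: G_nonempty G_compact G_convex)

lemma controlled_at:
  assumes "u \<in> V"
  obtains \<beta> k where "integrable M \<beta>" "k \<in> weights"
    "AE x in M. \<forall>(a, v)\<in>G x (J u x). \<bar>a\<bar> \<le> \<beta> x \<and> norm v \<le> k x"
proof -
  from G_controlled[OF norm_jet_radii[OF assms]] obtain \<beta> k where *: "integrable M \<beta>" "k \<in> weights"
    "AE x in M. \<forall>y. norm y \<le> norm (J u x) \<longrightarrow> (\<forall>(a, v)\<in>G x y. \<bar>a\<bar> \<le> \<beta> x \<and> norm v \<le> k x)" by blast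
  have "AE x in M. \<forall>(a, v)\<in>G x (J u x). \<bar>a\<bar> \<le> \<beta> x \<and> norm v \<le> k x"
    using *(3) by eventually_elim blast
  with * that show ?thesis by blast
qed

text \<open>The scalars (s, c) serve three uses: (1, 0) reads off the first components, (0, 1) the
  second ones, and (1, c) or (-1, -c) the affine expressions of the codifferential.\<close>

lemma pairable_jet:
  assumes u: "u \<in> V" and h: "h \<in> V"
  shows "(\<lambda>x. (s, c *\<^sub>R J h x)) \<in> compact_convex_map.pairable M (\<lambda>x. G x (J u x))"
proof -
  interpret U: compact_convex_map M "\<lambda>x. G x (J u x)" by (rule compact_convex_map_compose[OF J_measurable[OF u]])
  obtain \<beta> k where bk: "integrable M \<beta>" "k \<in> weights"
    "AE x in M. \<forall>(a, v)\<in>G x (J u x). \<bar>a\<bar> \<le> \<beta> x \<and> norm v \<le> k x" by (rule controlled_at[OF u])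
  obtain K where K: "\<And>h. h \<in> V \<Longrightarrow> integrable M (\<lambda>x. k x * norm (J h x))" by (rule weights_pairing[OF bk(2)]) blast
  show ?thesis
  proof (rule U.pairableI)
    show "(\<lambda>x. (s, c *\<^sub>R J h x)) \<in> borel_measurable M"
      using J_measurable[OF h] by (intro borel_measurable_Pair) auto
    show "integrable M (\<lambda>x. \<bar>s\<bar> * \<beta> x + \<bar>c\<bar> * (k x * norm (J h x)))" using bk(1) K[OF h] by auto
    show "AE x in M. U.asupp x (s, c *\<^sub>R J h x) \<le> \<bar>s\<bar> * \<beta> x + \<bar>c\<bar> * (k x * norm (J h x))"
      using bk(3) AE_space
    proof eventually_elim
      case (elim x)
      show ?case
      proof (rule U.asupp_least[OF elim(2)])
        fix z assume z: "z \<in> G x (J u x)"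
        obtain a v where av: "z = (a, v)" by force
        have "\<bar>z \<bullet> (s, c *\<^sub>R J h x)\<bar> \<le> \<bar>a * s\<bar> + \<bar>c\<bar> * \<bar>v \<bullet> J h x\<bar>" by (simp add: av abs_mult[symmetric])
        also have "\<dots> \<le> \<bar>s\<bar> * \<beta> x + \<bar>c\<bar> * (k x * norm (J h x))"
        proof (intro add_mono mult_left_mono)
          have "\<bar>a\<bar> \<le> \<beta> x" using elim(1) z by (auto simp: av)
          then show "\<bar>a * s\<bar> \<le> \<bar>s\<bar> * \<beta> x"
            using mult_left_mono[of "\<bar>a\<bar>" "\<beta> x" "\<bar>s\<bar>"] by (simp add: abs_mult mult.commute)
          have "\<bar>v \<bullet> J h x\<bar> \<le> norm v * norm (J h x)" by (rule Cauchy_Schwarz_ineq2)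
          also have "\<dots> \<le> k x * norm (J h x)" using elim(1) z by (intro mult_right_mono) (auto simp: av)
          finally show "\<bar>v \<bullet> J h x\<bar> \<le> k x * norm (J h x)" .
        qed auto
        finally show "\<bar>z \<bullet> (s, c *\<^sub>R J h x)\<bar> \<le> \<bar>s\<bar> * \<beta> x + \<bar>c\<bar> * (k x * norm (J h x))" .
      qed
    qed
  qed
qed

lemma
  assumes u: "u \<in> V" and h: "h \<in> V" and z: "z \<in> measurable_selections M (\<lambda>x. G x (J u x))"
  shows integrable_selection_fst: "integrable M (\<lambda>x. fst (z x))"
    and integrable_selection_snd: "integrable M (\<lambda>x. snd (z x) \<bullet> J h x)"
proof -
  interpret U: compact_convex_map M "\<lambda>x. G x (J u x)" by (rule compact_convex_map_compose[OF J_measurable[OF u]])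
  show "integrable M (\<lambda>x. fst (z x))"
    using U.integrable_selection[OF z pairable_jet[OF u h, of 1 0]] by (simp add: inner_prod_def)
  show "integrable M (\<lambda>x. snd (z x) \<bullet> J h x)"
    using U.integrable_selection[OF z pairable_jet[OF u h, of 0 1]] by (simp add: inner_prod_def)
qed

lemma selection_functional_dual:
  assumes u: "u \<in> V" and z: "z \<in> measurable_selections M (\<lambda>x. G x (J u x))"
  shows "restrict (\<lambda>h. \<integral>x. snd (z x) \<bullet> J h x \<partial>M) V \<in> dual V N"
proof -
  note i = integrable_selection_snd[OF u _ z]
  have zm[measurable]: "z \<in> borel_measurable M" using z by (simp add: measurable_selections_def)
  note [measurable] = J_measurable
  have add: "(\<integral>x. snd (z x) \<bullet> J (g + h) x \<partial>M) = (\<integral>x. snd (z x) \<bullet> J g x \<partial>M) + (\<integral>x. snd (z x) \<bullet> J h x \<partial>M)"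
    if "g \<in> V" "h \<in> V" for g h
  proof -
    have "(\<integral>x. snd (z x) \<bullet> J (g + h) x \<partial>M) = (\<integral>x. snd (z x) \<bullet> J g x + snd (z x) \<bullet> J h x \<partial>M)"
      using J_add[OF that] i[OF V_add[OF that]] i[OF that(1)] i[OF that(2)]
      by (intro integral_cong_AE) (auto elim!: eventually_mono simp: inner_add_right dest: borel_measurable_integrable)
    then show ?thesis using i[OF that(1)] i[OF that(2)] by simp
  qed
  have scale: "(\<integral>x. snd (z x) \<bullet> J (c *\<^sub>R h) x \<partial>M) = c * (\<integral>x. snd (z x) \<bullet> J h x \<partial>M)" if "h \<in> V" for c h
  proof -
    have "(\<integral>x. snd (z x) \<bullet> J (c *\<^sub>R h) x \<partial>M) = (\<integral>x. c * (snd (z x) \<bullet> J h x) \<partial>M)"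
      using J_scaleR[OF that, of c] i[OF V_scaleR[OF that]] i[OF that]
      by (intro integral_cong_AE) (auto elim!: eventually_mono dest: borel_measurable_integrable)
    then show ?thesis by simp
  qed
  obtain \<beta> k where bk: "integrable M \<beta>" "k \<in> weights"
    "AE x in M. \<forall>(a, v)\<in>G x (J u x). \<bar>a\<bar> \<le> \<beta> x \<and> norm v \<le> k x" by (rule controlled_at[OF u])
  obtain K where K: "\<And>h. h \<in> V \<Longrightarrow> integrable M (\<lambda>x. k x * norm (J h x))"
     "\<And>h. h \<in> V \<Longrightarrow> (\<integral>x. k x * norm (J h x) \<partial>M) \<le> K * N h" by (rule weights_pairing[OF bk(2)]) blast
  have "\<bar>\<integral>x. snd (z x) \<bullet> J h x \<partial>M\<bar> \<le> K * N h" if h: "h \<in> V" for h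
  proof -
    have "\<bar>\<integral>x. snd (z x) \<bullet> J h x \<partial>M\<bar> \<le> (\<integral>x. \<bar>snd (z x) \<bullet> J h x\<bar> \<partial>M)"
      using integral_norm_bound[of M "\<lambda>x. snd (z x) \<bullet> J h x"] by simp
    also have "\<dots> \<le> (\<integral>x. k x * norm (J h x) \<partial>M)"
    proof (rule integral_mono_AE[OF _ K(1)[OF h]])
      show "integrable M (\<lambda>x. \<bar>snd (z x) \<bullet> J h x\<bar>)" using i[OF h] by auto
      have "AE x in M. z x \<in> G x (J u x)" using z by (simp add: measurable_selections_def)
      with bk(3) show "AE x in M. \<bar>snd (z x) \<bullet> J h x\<bar> \<le> k x * norm (J h x)"
      proof eventually_elim
        case (elim x)
        then have "norm (snd (z x)) \<le> k x" by (auto simp: case_prod_unfold)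
        then show ?case
          using Cauchy_Schwarz_ineq2[of "snd (z x)" "J h x"]
            mult_right_mono[of "norm (snd (z x))" "k x" "norm (J h x)"] by simp
      qed
    qed
    also have "\<dots> \<le> K * N h" by (rule K(2)[OF h])
    finally show ?thesis .
  qed
  then show ?thesis
    unfolding dual_def by (auto simp: V_add V_scaleR add scale)
qed

lemma selection_differential_eq:
  assumes u: "u \<in> V"
  shows "selection_differential G u =
    (\<lambda>z. (\<integral>x. fst (z x) \<partial>M, restrict (\<lambda>h. \<integral>x. snd (z x) \<bullet> J h x \<partial>M) V)) ` measurable_selections M (\<lambda>x. G x (J u x))"
proof (intro equalityI subsetI)
  fix A\<phi> assume "A\<phi> \<in> selection_differential G u"
  then obtain A \<phi> z where *: "A\<phi> = (A, \<phi>)" "\<phi> \<in> dual V N" "z \<in> measurable_selections M (\<lambda>x. G x (J u x))"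
    "A = (\<integral>x. fst (z x) \<partial>M)" "\<forall>h\<in>V. \<phi> h = (\<integral>x. snd (z x) \<bullet> J h x \<partial>M)"
    by (auto simp: selection_differential_def)
  have "\<phi> = restrict (\<lambda>h. \<integral>x. snd (z x) \<bullet> J h x \<partial>M) V"
    using * by (intro extensionalityI[of _ V]) (auto simp: dual_def)
  with * show "A\<phi> \<in> (\<lambda>z. (\<integral>x. fst (z x) \<partial>M, restrict (\<lambda>h. \<integral>x. snd (z x) \<bullet> J h x \<partial>M) V)) ` measurable_selections M (\<lambda>x. G x (J u x))"
    by blast
qed (use selection_functional_dual[OF u] in \<open>auto simp: selection_differential_def\<close>)

lemma selection_differential_nonempty: "u \<in> V \<Longrightarrow> selection_differential G u \<noteq> {}"
  using compact_convex_map.closest_point_selection[OF compact_convex_map_compose[OF J_measurable], of u "\<lambda>_. 0"]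
  by (auto simp: selection_differential_eq)

lemma selection_differential_convex:
  assumes u: "u \<in> V" shows "convex_real_dual V (selection_differential G u)"
proof -
  interpret U: compact_convex_map M "\<lambda>x. G x (J u x)" by (rule compact_convex_map_compose[OF J_measurable[OF u]])
  have "((1 - t) * (\<integral>x. fst (y x) \<partial>M) + t * (\<integral>x. fst (z x) \<partial>M),
      restrict (\<lambda>h. (1 - t) * restrict (\<lambda>h. \<integral>x. snd (y x) \<bullet> J h x \<partial>M) V h + t * restrict (\<lambda>h. \<integral>x. snd (z x) \<bullet> J h x \<partial>M) V h) V)
      \<in> selection_differential G u"
    if y: "y \<in> measurable_selections M (\<lambda>x. G x (J u x))" and z: "z \<in> measurable_selections M (\<lambda>x. G x (J u x))"
      and t: "0 \<le> t" "t \<le> 1" for y z and t :: real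
  proof -
    define w where "w x = (1 - t) *\<^sub>R y x + t *\<^sub>R z x" for x
    have m: "y \<in> borel_measurable M" "z \<in> borel_measurable M"
      "AE x in M. y x \<in> G x (J u x)" "AE x in M. z x \<in> G x (J u x)"
      using y z by (auto simp: measurable_selections_def)
    have "AE x in M. w x \<in> G x (J u x)"
      using m(3,4) AE_space
    proof eventually_elim
      case (elim x)
      then show ?case using convexD[OF U.convex[of x], of "y x" "z x" "1 - t" t] t by (simp add: w_def)
    qed
    then have w: "w \<in> measurable_selections M (\<lambda>x. G x (J u x))"
      using m(1,2) unfolding measurable_selections_def w_def[abs_def] by auto
    note iy = integrable_selection_fst[OF u u y] integrable_selection_snd[OF u _ y]
    note iz = integrable_selection_fst[OF u u z] integrable_selection_snd[OF u _ z]
    have "(\<integral>x. fst (w x) \<partial>M) = (1 - t) * (\<integral>x. fst (y x) \<partial>M) + t * (\<integral>x. fst (z x) \<partial>M)"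
      using iy iz by (simp add: w_def)
    moreover have "restrict (\<lambda>h. \<integral>x. snd (w x) \<bullet> J h x \<partial>M) V = restrict (\<lambda>h. (1 - t) * restrict (\<lambda>h. \<integral>x. snd (y x) \<bullet> J h x \<partial>M) V h
        + t * restrict (\<lambda>h. \<integral>x. snd (z x) \<bullet> J h x \<partial>M) V h) V"
      using iy iz by (auto simp: w_def fun_eq_iff restrict_def inner_add_left)
    ultimately show ?thesis unfolding selection_differential_eq[OF u] using w by (auto intro!: image_eqI[of _ _ w])
  qed
  then show ?thesis
    unfolding convex_real_dual_def by (auto simp: selection_differential_eq[OF u])
qed

text \<open>The set is the image of \<open>dominated_functionals\<close> under evaluation at the
  constant function (1, 0) and at the functions (0, J h). This map is continuous because the weak*
  topology is itself induced by evaluations.\<close>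

lemma selection_differential_compact:
  assumes u: "u \<in> V"
  shows "compactin (prod_topology euclideanreal (weak_star V N)) (selection_differential G u)"
proof -
  interpret U: compact_convex_map M "\<lambda>x. G x (J u x)" by (rule compact_convex_map_compose[OF J_measurable[OF u]])
  let ?X = "subtopology (product_topology (\<lambda>_. euclideanreal) U.pairable) U.dominated_functionals"
  define T where "T \<phi> = (\<phi> (\<lambda>x. (1, 0 *\<^sub>R J u x)), restrict (\<lambda>h. \<phi> (\<lambda>x. (0, 1 *\<^sub>R J h x))) V)" for \<phi> :: "('a \<Rightarrow> real \<times> 'e) \<Rightarrow> real"
  have T: "T (restrict (\<lambda>q. \<integral>x. z x \<bullet> q x \<partial>M) U.pairable)
      = (\<integral>x. fst (z x) \<partial>M, restrict (\<lambda>h. \<integral>x. snd (z x) \<bullet> J h x \<partial>M) V)" for z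
    using pairable_jet[OF u u, of 1 0] pairable_jet[OF u, of _ 0 1]
    by (auto simp: T_def inner_prod_def fun_eq_iff restrict_def)
  have img: "T ` U.dominated_functionals = selection_differential G u"
    unfolding U.dominated_functionals_eq selection_differential_eq[OF u] by (simp add: image_image T)
  have ev: "continuous_map ?X euclideanreal (\<lambda>\<phi>. \<phi> q)" if "q \<in> U.pairable" for q
    using continuous_map_product_projection[OF that, of "\<lambda>_. euclideanreal"]
    by (auto intro: continuous_map_from_subtopology)
  have "continuous_map ?X (prod_topology euclideanreal (weak_star V N)) T"
    unfolding continuous_map_pairwise
  proof
    show "continuous_map ?X euclideanreal (fst \<circ> T)"
      using ev[OF pairable_jet[OF u u, of 1 0]] by (simp add: T_def o_def)
    show "continuous_map ?X (weak_star V N) (snd \<circ> T)"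
      unfolding weak_star_def continuous_map_in_subtopology
    proof
      show "continuous_map ?X (product_topology (\<lambda>_. euclideanreal) V) (snd \<circ> T)"
        unfolding continuous_map_componentwise
        using ev[OF pairable_jet[OF u, of _ 0 1]]
        by (auto simp: T_def o_def restrict_def extensional_def cong: if_cong)
      have "snd ` selection_differential G u \<subseteq> dual V N" by (auto simp: selection_differential_def)
      then show "snd \<circ> T \<in> topspace ?X \<rightarrow> dual V N"
      proof (intro Pi_I)
        fix \<phi> assume "\<phi> \<in> topspace ?X"
        then have "T \<phi> \<in> T ` U.dominated_functionals" by (simp add: topspace_subtopology)
        then show "(snd \<circ> T) \<phi> \<in> dual V N"
          unfolding img using \<open>snd ` selection_differential G u \<subseteq> dual V N\<close> by auto
      qed
    qed
  qed
  from image_compactin[OF _ this, of U.dominated_functionals] U.compactin_dominated_functionals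
  show ?thesis by (simp add: img compactin_subtopology)
qed

text \<open>The integrand contains \<open>c *\<^sub>R J h x\<close> and not
  \<open>J (c *\<^sub>R h) x\<close>: the two agree only off a null set depending on c, which would
  spoil pointwise limits in c. The hyperdifferential is treated as a supremum at the reflected
  argument.\<close>

lemma
  assumes u: "u \<in> V" and h: "h \<in> V"
  shows hypo_fun_selection_differential: "hypo_fun (selection_differential G u) (c *\<^sub>R h)
      = (\<integral>x. compact_convex_map.supp (\<lambda>x. G x (J u x)) x (1, c *\<^sub>R J h x) \<partial>M)"
    and hyper_fun_selection_differential: "hyper_fun (selection_differential G u) (c *\<^sub>R h)
      = - (\<integral>x. compact_convex_map.supp (\<lambda>x. G x (J u x)) x (- 1, - c *\<^sub>R J h x) \<partial>M)"
proof -
  interpret U: compact_convex_map M "\<lambda>x. G x (J u x)" by (rule compact_convex_map_compose[OF J_measurable[OF u]])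
  let ?S = "measurable_selections M (\<lambda>x. G x (J u x))"
  have ne: "?S \<noteq> {}" using selection_differential_nonempty[OF u] by (simp add: selection_differential_eq[OF u])
  have val: "(\<integral>x. fst (z x) \<partial>M) + restrict (\<lambda>h. \<integral>x. snd (z x) \<bullet> J h x \<partial>M) V (c *\<^sub>R h)
      = (\<integral>x. z x \<bullet> (1, c *\<^sub>R J h x) \<partial>M)" if z: "z \<in> ?S" for z
  proof -
    have "(\<integral>x. snd (z x) \<bullet> J (c *\<^sub>R h) x \<partial>M) = c * (\<integral>x. snd (z x) \<bullet> J h x \<partial>M)"
    proof -
      have "restrict (\<lambda>h. \<integral>x. snd (z x) \<bullet> J h x \<partial>M) V (c *\<^sub>R h)
          = c * restrict (\<lambda>h. \<integral>x. snd (z x) \<bullet> J h x \<partial>M) V h"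
        using selection_functional_dual[OF u z] h unfolding dual_def by blast
      then show ?thesis using h V_scaleR[OF h, of c] by simp
    qed
    then show ?thesis
      using V_scaleR[OF h, of c] integrable_selection_fst[OF u h z] integrable_selection_snd[OF u h z]
      by (simp add: inner_prod_def)
  qed
  have sup: "(SUP z\<in>?S. \<integral>x. z x \<bullet> q x \<partial>M) = (\<integral>x. U.supp x (q x) \<partial>M)" if q: "q \<in> U.pairable" for q
  proof (rule antisym)
    show "(SUP z\<in>?S. \<integral>x. z x \<bullet> q x \<partial>M) \<le> (\<integral>x. U.supp x (q x) \<partial>M)"
      by (rule cSUP_least[OF ne]) (rule U.integral_selection_le[OF _ q])
    show "(\<integral>x. U.supp x (q x) \<partial>M) \<le> (SUP z\<in>?S. \<integral>x. z x \<bullet> q x \<partial>M)"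
    proof (rule field_le_epsilon)
      fix \<epsilon> :: real assume "\<epsilon> > 0"
      from U.near_optimal_selection[OF q this] obtain z where z: "z \<in> ?S"
        "(\<integral>x. U.supp x (q x) \<partial>M) - \<epsilon> \<le> (\<integral>x. z x \<bullet> q x \<partial>M)" .
      have "(\<integral>x. z x \<bullet> q x \<partial>M) \<le> (SUP z\<in>?S. \<integral>x. z x \<bullet> q x \<partial>M)"
        by (rule cSUP_upper[OF z(1)]) (auto intro!: bdd_aboveI2 U.integral_selection_le[OF _ q])
      with z(2) show "(\<integral>x. U.supp x (q x) \<partial>M) \<le> (SUP z\<in>?S. \<integral>x. z x \<bullet> q x \<partial>M) + \<epsilon>" by simp
    qed
  qed
  show "hypo_fun (selection_differential G u) (c *\<^sub>R h) = (\<integral>x. U.supp x (1, c *\<^sub>R J h x) \<partial>M)"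
    unfolding hypo_fun_def selection_differential_eq[OF u] image_image
    using sup[OF pairable_jet[OF u h, of 1 c]] val by (simp cong: SUP_cong_simp)
  have "hyper_fun (selection_differential G u) (c *\<^sub>R h) = (INF z\<in>?S. \<integral>x. z x \<bullet> (1, c *\<^sub>R J h x) \<partial>M)"
    unfolding hyper_fun_def selection_differential_eq[OF u] image_image
    using val by (simp cong: INF_cong_simp)
  also have "\<dots> = - (SUP z\<in>?S. - (\<integral>x. z x \<bullet> (1, c *\<^sub>R J h x) \<partial>M))"
    by (simp add: Inf_real_def image_image)
  also have "(SUP z\<in>?S. - (\<integral>x. z x \<bullet> (1, c *\<^sub>R J h x) \<partial>M)) = (SUP z\<in>?S. \<integral>x. z x \<bullet> (- 1, - c *\<^sub>R J h x) \<partial>M)"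
    by (simp add: inner_prod_def flip: Bochner_Integration.integral_minus)
  also have "\<dots> = (\<integral>x. U.supp x (- 1, - c *\<^sub>R J h x) \<partial>M)" by (rule sup[OF pairable_jet[OF u h]])
  finally show "hyper_fun (selection_differential G u) (c *\<^sub>R h) = - (\<integral>x. U.supp x (- 1, - c *\<^sub>R J h x) \<partial>M)" .
qed

end

section \<open>Expansion of the integral functional\<close>

context jets
begin

lemma supp_eq_SUP:
  "compact_convex_map.supp G x (s, q) = (SUP (a, v)\<in>G x. a * s + v \<bullet> q)"
  if "compact_convex_map M G" for G :: "'a \<Rightarrow> (real \<times> 'e) set"
  unfolding compact_convex_map.supp_def[OF that] by (simp add: inner_prod_def case_prod_unfold)

text \<open>Since the hypo- and hyperdifferential terms are integrals of support functions, the
  remainder of the functional is the integral of the pointwise remainders, and the limit may be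
  taken under the integral.\<close>

theorem selection_differential_codifferential:
  fixes f :: "'a \<Rightarrow> 'e \<Rightarrow> real" and G H :: "'a \<Rightarrow> 'e \<Rightarrow> (real \<times> 'e) set"
  assumes G: "jet_multifunction M p V N J G" and H: "jet_multifunction M p V N J H"
    and f_meas: "\<And>y. (\<lambda>x. f x y) \<in> borel_measurable M"
    and f_cont: "\<And>x. x \<in> space M \<Longrightarrow> continuous_on UNIV (f x)"
    and f_codiff: "\<And>x y. x \<in> space M \<Longrightarrow> is_euclidean_codifferential (f x) y (G x y) (H x y)"
    and f_int: "\<And>u. u \<in> V \<Longrightarrow> integrable M (\<lambda>x. f x (J u x))"
    and u: "u \<in> V"
  shows "is_codifferential V N (\<lambda>u. \<integral>x. f x (J u x) \<partial>M) u
    (selection_differential G u) (selection_differential H u)"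
proof -
  interpret G: jet_multifunction M p V N J G by fact
  interpret H: jet_multifunction M p V N J H by fact
  interpret GU: compact_convex_map M "\<lambda>x. G x (J u x)" by (rule G.compact_convex_map_compose[OF J_measurable[OF u]])
  interpret HU: compact_convex_map M "\<lambda>x. H x (J u x)" by (rule H.compact_convex_map_compose[OF J_measurable[OF u]])
  note supG = supp_eq_SUP[OF GU.compact_convex_map_axioms]
  note supH = supp_eq_SUP[OF HU.compact_convex_map_axioms]
  have f_comp: "(\<lambda>x. f x (c x)) \<in> borel_measurable M" if "c \<in> borel_measurable M" for c
    by (rule borel_measurable_caratheodory_compose[OF f_meas f_cont that])
  have Gsup: "GU.supp x (1, q) = (SUP (a, v)\<in>G x (J u x). a + v \<bullet> q)" for x q
    by (simp add: supG)
  have Hsup: "- HU.supp x (- 1, - q) = (INF (a, v)\<in>H x (J u x). a + v \<bullet> q)" for x q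
    unfolding INF_affine_eq supH by (simp add: image_image case_prod_unfold)
  have zero: "hypo_fun (selection_differential G u) 0 = 0" "hyper_fun (selection_differential H u) 0 = 0"
  proof -
    have "hypo_fun (selection_differential G u) (0 *\<^sub>R u) = (\<integral>x. GU.supp x (1, 0 *\<^sub>R J u x) \<partial>M)"
      by (rule G.hypo_fun_selection_differential[OF u u])
    also have "\<dots> = (\<integral>x. 0 \<partial>M)"
    proof (rule Bochner_Integration.integral_cong[OF refl])
      fix x assume "x \<in> space M"
      from euclidean_codifferentialD(7)[OF f_codiff[OF this, of "J u x"]] show "GU.supp x (1, 0 *\<^sub>R J u x) = 0"
        unfolding Gsup by simp
    qed
    finally show "hypo_fun (selection_differential G u) 0 = 0" by simp
    have "hyper_fun (selection_differential H u) (0 *\<^sub>R u) = (\<integral>x. - HU.supp x (- 1, - (0 *\<^sub>R J u x)) \<partial>M)"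
      using H.hyper_fun_selection_differential[OF u u, of 0] by simp
    also have "\<dots> = (\<integral>x. 0 \<partial>M)"
    proof (rule Bochner_Integration.integral_cong[OF refl])
      fix x assume "x \<in> space M"
      from euclidean_codifferentialD(8)[OF f_codiff[OF this, of "J u x"]] show "- HU.supp x (- 1, - (0 *\<^sub>R J u x)) = 0"
        unfolding Hsup by simp
    qed
    finally show "hyper_fun (selection_differential H u) 0 = 0" by simp
  qed
  have limit: "((\<lambda>\<alpha>. 1 / \<alpha> * \<bar>(\<integral>x. f x (J (u + \<alpha> *\<^sub>R h) x) \<partial>M) - (\<integral>x. f x (J u x) \<partial>M)
      - hypo_fun (selection_differential G u) (\<alpha> *\<^sub>R h) - hyper_fun (selection_differential H u) (\<alpha> *\<^sub>R h)\<bar>) \<longlongrightarrow> 0) (at_right 0)"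
    (is "(?R \<longlongrightarrow> 0) _") if h: "h \<in> V" for h
  proof -
    \<comment> \<open>The increment uses \<open>J u x + \<alpha> *\<^sub>R J h x\<close>, a
      representative of the jet of \<open>u + \<alpha> *\<^sub>R h\<close> that is available at each
      x for all \<alpha> simultaneously.\<close>
    define g where "g \<alpha> x = f x (J u x + \<alpha> *\<^sub>R J h x) - f x (J u x) - GU.supp x (1, \<alpha> *\<^sub>R J h x)
       + HU.supp x (- 1, - \<alpha> *\<^sub>R J h x)" for \<alpha> x
    have uah: "u + \<alpha> *\<^sub>R h \<in> V" for \<alpha> using V_add[OF u V_scaleR[OF h]] .
    have Jeq: "AE x in M. J (u + \<alpha> *\<^sub>R h) x = J u x + \<alpha> *\<^sub>R J h x" for \<alpha>
      using J_add[OF u V_scaleR[OF h], of \<alpha>] J_scaleR[OF h, of \<alpha>] by eventually_elim simp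
    have Jm: "J u \<in> borel_measurable M" "J h \<in> borel_measurable M" using u h J_measurable by auto
    have fm: "(\<lambda>x. f x (J u x + \<alpha> *\<^sub>R J h x)) \<in> borel_measurable M" for \<alpha>
      using Jm by (intro f_comp) auto
    have feq: "AE x in M. f x (J (u + \<alpha> *\<^sub>R h) x) = f x (J u x + \<alpha> *\<^sub>R J h x)" for \<alpha>
      using Jeq[of \<alpha>] by eventually_elim simp
    have fi: "integrable M (\<lambda>x. f x (J u x + \<alpha> *\<^sub>R J h x))"
        "(\<integral>x. f x (J (u + \<alpha> *\<^sub>R h) x) \<partial>M) = (\<integral>x. f x (J u x + \<alpha> *\<^sub>R J h x) \<partial>M)" for \<alpha>
      using f_int[OF uah] feq[of \<alpha>] fm[of \<alpha>]
      by (auto intro: integral_cong_AE integrable_cong_AE_imp dest: borel_measurable_integrable)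
    have si: "integrable M (\<lambda>x. GU.supp x (1, \<alpha> *\<^sub>R J h x))" "integrable M (\<lambda>x. HU.supp x (- 1, - \<alpha> *\<^sub>R J h x))" for \<alpha>
      using GU.integrable_supp[OF G.pairable_jet[OF u h]] HU.integrable_supp[OF H.pairable_jet[OF u h, of "- 1" "- \<alpha>"]] by auto
    have gi: "integrable M (g \<alpha>)" for \<alpha>
      unfolding g_def using fi(1) f_int[OF u] si by auto
    have Req: "?R \<alpha> = 1 / \<alpha> * \<bar>\<integral>x. g \<alpha> x \<partial>M\<bar>" for \<alpha>
      unfolding g_def using fi[of \<alpha>] f_int[OF u] si[of \<alpha>]
      by (simp add: G.hypo_fun_selection_differential[OF u h] H.hyper_fun_selection_differential[OF u h])
    \<comment> \<open>Dominates the jets along the whole segment for 0 \<le> \<alpha> \<le> 1, so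
      that one pair of weights bounds the covectors at all intermediate points entering the mean
      value inequality.\<close>
    let ?r = "\<lambda>x. norm (J u x) + norm (J h x)"
    have r: "?r \<in> radii" by (rule radii_add[OF norm_jet_radii[OF u] norm_jet_radii[OF h]])
    obtain \<beta> k \<beta>' k' where k: "k \<in> weights" "k' \<in> weights"
      and bG: "AE x in M. \<forall>y. norm y \<le> ?r x \<longrightarrow> (\<forall>(a, v)\<in>G x y. \<bar>a\<bar> \<le> \<beta> x \<and> norm v \<le> k x)"
      and bH: "AE x in M. \<forall>y. norm y \<le> ?r x \<longrightarrow> (\<forall>(a, v)\<in>H x y. \<bar>a\<bar> \<le> \<beta>' x \<and> norm v \<le> k' x)"
      using G.G_controlled[OF r] H.G_controlled[OF r] by blast
    obtain K K' where "\<And>h. h \<in> V \<Longrightarrow> integrable M (\<lambda>x. k x * norm (J h x))"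
        "\<And>h. h \<in> V \<Longrightarrow> integrable M (\<lambda>x. k' x * norm (J h x))"
      using weights_pairing[OF k(1)] weights_pairing[OF k(2)] by metis
    then have ki: "integrable M (\<lambda>x. k x * norm (J h x))" "integrable M (\<lambda>x. k' x * norm (J h x))" using h by auto
    define L where "L x = (k x + k' x) * norm (J h x)" for x
    have Li: "integrable M L" unfolding L_def using ki by (simp add: distrib_right)
    have k0: "AE x in M. 0 \<le> k x" "AE x in M. 0 \<le> k' x" using k by (auto simp: weights_def)
    \<comment> \<open>The 4 consists of 2 from the increment of f and of 1 each from the
      hypodifferential and the hyperdifferential term.\<close>
    have dom: "AE x in M. \<forall>\<alpha>. 0 < \<alpha> \<longrightarrow> \<alpha> \<le> 1 \<longrightarrow> \<bar>1 / \<alpha> * g \<alpha> x\<bar> \<le> 4 * L x"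
      using bG bH k0 AE_space
    proof eventually_elim
      case (elim x)
      note cd = euclidean_codifferentialD[OF f_codiff[OF elim(5), of "J u x"]]
      have vL: "\<bar>v \<bullet> J h x\<bar> \<le> L x" if y: "norm y \<le> ?r x" and av: "(a, v) \<in> G x y \<union> H x y" for a v y
      proof -
        have "norm v \<le> k x + k' x" using elim(1-4) y av by fastforce
        then have "norm v * norm (J h x) \<le> L x" unfolding L_def by (rule mult_right_mono) simp
        then show ?thesis using Cauchy_Schwarz_ineq2[of v "J h x"] by simp
      qed
      show ?case
      proof (intro allI impI)
        fix \<alpha> :: real assume \<alpha>: "0 < \<alpha>" "\<alpha> \<le> 1"
        have "\<bar>f x (J u x + \<alpha> *\<^sub>R J h x) - f x (J u x)\<bar> \<le> 2 * (\<alpha> * L x)"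
        proof (rule codifferentiable_abs_increment_le[OF f_cont[OF elim(5)] f_codiff[OF elim(5)]])
          fix s a v assume s: "0 \<le> s" "(s::real) \<le> 1"
            and av: "(a, v) \<in> G x (J u x + s *\<^sub>R \<alpha> *\<^sub>R J h x) \<union> H x (J u x + s *\<^sub>R \<alpha> *\<^sub>R J h x)"
          have "norm (J u x + s *\<^sub>R \<alpha> *\<^sub>R J h x) \<le> norm (J u x) + (s * \<alpha>) * norm (J h x)"
            using norm_triangle_ineq[of "J u x" "s *\<^sub>R \<alpha> *\<^sub>R J h x"] s \<alpha> by (simp add: abs_mult)
          also have "\<dots> \<le> norm (J u x) + 1 * norm (J h x)"
            using s \<alpha> by (intro add_left_mono mult_right_mono) (auto intro: mult_le_one)
          finally have "\<bar>v \<bullet> J h x\<bar> \<le> L x" by (intro vL[OF _ av]) simp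
          then show "\<bar>v \<bullet> (\<alpha> *\<^sub>R J h x)\<bar> \<le> \<alpha> * L x" using \<alpha> by (simp add: abs_mult)
        qed
        moreover have "\<bar>GU.supp x (1, \<alpha> *\<^sub>R J h x)\<bar> \<le> \<alpha> * L x"
          unfolding Gsup
          by (rule abs_SUP_affine_le[OF cd(1,3,7)]) (use vL[of "J u x"] \<alpha> in \<open>auto simp: abs_mult\<close>)
        moreover have "\<bar>- HU.supp x (- 1, - (\<alpha> *\<^sub>R J h x))\<bar> \<le> \<alpha> * L x"
          unfolding Hsup
          by (rule abs_INF_affine_le[OF cd(4,6,8)]) (use vL[of "J u x"] \<alpha> in \<open>auto simp: abs_mult\<close>)
        ultimately have "\<bar>g \<alpha> x\<bar> \<le> \<alpha> * (4 * L x)" unfolding g_def by simp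
        then show "\<bar>1 / \<alpha> * g \<alpha> x\<bar> \<le> 4 * L x" using \<alpha> by (simp add: abs_mult field_simps)
      qed
    qed
    have ptw: "((\<lambda>\<alpha>. 1 / \<alpha> * g \<alpha> x) \<longlongrightarrow> 0) (at_right 0)" if x: "x \<in> space M" for x
    proof (rule tendsto_rabs_zero_cancel, rule Lim_transform_eventually)
      show "((\<lambda>\<alpha>. 1 / \<alpha> * \<bar>f x (J u x + \<alpha> *\<^sub>R J h x) - f x (J u x) - (SUP (a, v)\<in>G x (J u x). a + v \<bullet> (\<alpha> *\<^sub>R J h x))
         - (INF (b, w)\<in>H x (J u x). b + w \<bullet> (\<alpha> *\<^sub>R J h x))\<bar>) \<longlongrightarrow> 0) (at_right 0)"
        by (rule euclidean_codifferentialD(9)[OF f_codiff[OF x]])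
      show "\<forall>\<^sub>F \<alpha> in at_right 0. 1 / \<alpha> * \<bar>f x (J u x + \<alpha> *\<^sub>R J h x) - f x (J u x) - (SUP (a, v)\<in>G x (J u x). a + v \<bullet> (\<alpha> *\<^sub>R J h x))
         - (INF (b, w)\<in>H x (J u x). b + w \<bullet> (\<alpha> *\<^sub>R J h x))\<bar> = \<bar>1 / \<alpha> * g \<alpha> x\<bar>"
        unfolding g_def Gsup[symmetric] Hsup[symmetric]
        by (auto simp: eventually_at_filter abs_mult)
    qed
    show ?thesis
      unfolding tendsto_at_iff_sequentially
    proof (intro allI impI)
      fix X :: "nat \<Rightarrow> real" assume X: "\<forall>i. X i \<in> {0<..} - {0}" "X \<longlonglongrightarrow> 0"
      then have "\<forall>\<^sub>F i in sequentially. X i < 1" by (intro order_tendstoD(2)) auto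
      then obtain n0 where n0: "\<And>i. i \<ge> n0 \<Longrightarrow> X i < 1" by (auto simp: eventually_sequentially)
      \<comment> \<open>Dominated convergence is applied along sequences, and the first
        \<open>n0\<close> terms are dropped because the bound is available for \<alpha> \<le>
        1.\<close>
      define Y where "Y i = X (i + n0)" for i
      have Y: "0 < Y i" "Y i \<le> 1" for i using X(1) n0[of "i + n0"] by (auto simp: Y_def less_imp_le)
      have Y0: "Y \<longlonglongrightarrow> 0" unfolding Y_def by (rule LIMSEQ_ignore_initial_segment[OF X(2)])
      have Yr: "filterlim Y (at_right 0) sequentially"
        using Y0 Y(1) by (auto simp: filterlim_at less_imp_neq[THEN not_sym])
      have "(\<lambda>i. \<integral>x. 1 / Y i * g (Y i) x \<partial>M) \<longlonglongrightarrow> (\<integral>x. 0 \<partial>M)"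
      proof (rule integral_dominated_convergence)
        show "integrable M (\<lambda>x. 4 * L x)" using Li by simp
        show "(\<lambda>x. 1 / Y i * g (Y i) x) \<in> borel_measurable M" for i
          using borel_measurable_integrable[OF gi[of "Y i"]] by measurable
        show "AE x in M. norm (1 / Y i * g (Y i) x) \<le> 4 * L x" for i
          using dom by eventually_elim (use Y[of i] in auto)
        show "AE x in M. (\<lambda>i. 1 / Y i * g (Y i) x) \<longlonglongrightarrow> 0"
          by (rule AE_I2) (rule filterlim_compose[OF ptw Yr])
      qed simp
      then have "(\<lambda>i. \<bar>\<integral>x. 1 / Y i * g (Y i) x \<partial>M\<bar>) \<longlonglongrightarrow> 0" using tendsto_rabs_zero by fastforce
      moreover have "\<bar>\<integral>x. 1 / Y i * g (Y i) x \<partial>M\<bar> = ?R (Y i)" for i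
        unfolding Req using Y(1)[of i] by (simp add: abs_mult)
      ultimately have "(\<lambda>i. ?R (X (i + n0))) \<longlonglongrightarrow> 0" by (simp add: Y_def)
      then show "(?R \<circ> X) \<longlonglongrightarrow> 0" unfolding o_def by (rule LIMSEQ_offset)
    qed
  qed
  show ?thesis
    unfolding is_codifferential_def
    using zero limit G.selection_differential_nonempty[OF u] G.selection_differential_convex[OF u]
      G.selection_differential_compact[OF u] H.selection_differential_nonempty[OF u]
      H.selection_differential_convex[OF u] H.selection_differential_compact[OF u]
    by simp
qed

end

section \<open>Hausdorff continuity\<close>

text \<open>An open set is a countable union of balls with centres in a dense set and rational
  radii, and hitting such a ball is a strict inequality for the distance. Hitting open sets behaves
  well under images, which is how measurability of stretched sets is obtained.\<close>

lemma open_hit_measurable: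
  fixes G :: "'a \<Rightarrow> 'b::euclidean_space set"
  assumes ne: "\<And>x. x \<in> space M \<Longrightarrow> G x \<noteq> {}"
    and m: "\<And>y. (\<lambda>x. infdist y (G x)) \<in> borel_measurable M" and U: "open U"
  shows "{x \<in> space M. G x \<inter> U \<noteq> {}} \<in> sets M"
proof -
  obtain D :: "'b set" where D: "countable D" "\<And>X. open X \<Longrightarrow> X \<noteq> {} \<Longrightarrow> \<exists>d\<in>D. d \<in> X"
    using countable_dense_setE by metis
  define T where "T = {(d, q). d \<in> D \<and> q \<in> \<rat> \<and> ball d q \<subseteq> U}"
  have "T \<subseteq> D \<times> \<rat>" by (auto simp: T_def)
  then have "countable T" using D(1) countable_rat by (meson countable_SIGMA countable_subset)
  have "{x \<in> space M. G x \<inter> U \<noteq> {}} = (\<Union>(d, q)\<in>T. {x \<in> space M. infdist d (G x) < q})"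
  proof (intro equalityI subsetI)
    fix x assume "x \<in> {x \<in> space M. G x \<inter> U \<noteq> {}}"
    then obtain z where z: "x \<in> space M" "z \<in> G x" "z \<in> U" by auto
    obtain e where e: "e > 0" "ball z e \<subseteq> U" using U z(3) open_contains_ball by blast
    obtain d where d: "d \<in> D" "d \<in> ball z (e / 3)" using D(2)[of "ball z (e / 3)"] e by auto
    obtain q where q: "q \<in> \<rat>" "e / 3 < q" "q < e / 2" using Rats_dense_in_real[of "e / 3" "e / 2"] e by auto
    have "ball d q \<subseteq> ball z e"
    proof
      fix y assume "y \<in> ball d q"
      then show "y \<in> ball z e" using d(2) q dist_triangle[of z y d] by auto
    qed
    moreover have "infdist d (G x) < q"
      using infdist_le[OF z(2), of d] d(2) q(2) by (simp add: dist_commute)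
    ultimately show "x \<in> (\<Union>(d, q)\<in>T. {x \<in> space M. infdist d (G x) < q})"
      using d q e z unfolding T_def by blast
  next
    fix x assume "x \<in> (\<Union>(d, q)\<in>T. {x \<in> space M. infdist d (G x) < q})"
    then obtain d q where dq: "ball d q \<subseteq> U" "x \<in> space M" "infdist d (G x) < q" by (auto simp: T_def)
    then have "(INF a\<in>G x. dist d a) < q" using ne by (simp add: infdist_notempty)
    then obtain a where "a \<in> G x" "dist d a < q"
      using ne[OF dq(2)] by (subst (asm) cINF_less_iff) (auto intro: bdd_belowI2[of _ 0])
    then show "x \<in> {x \<in> space M. G x \<inter> U \<noteq> {}}" using dq by auto
  qed
  also have "\<dots> \<in> sets M"
    using \<open>countable T\<close> m by (intro sets.countable_UN'') auto
  finally show ?thesis .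
qed

text \<open>The distance is below t exactly when the open ball of radius t is hit.\<close>

lemma infdist_measurable_if_open_hit_measurable:
  fixes G :: "'a \<Rightarrow> 'b::metric_space set"
  assumes ne: "\<And>x. x \<in> space M \<Longrightarrow> G x \<noteq> {}"
    and m: "\<And>U. open U \<Longrightarrow> {x \<in> space M. G x \<inter> U \<noteq> {}} \<in> sets M"
  shows "(\<lambda>x. infdist y (G x)) \<in> borel_measurable M"
proof (rule borel_measurableI_less)
  fix t
  have "{x \<in> space M. infdist y (G x) < t} = {x \<in> space M. G x \<inter> ball y t \<noteq> {}}"
  proof (intro Collect_cong conj_cong refl)
    fix x assume x: "x \<in> space M"
    have "infdist y (G x) < t \<longleftrightarrow> (\<exists>a\<in>G x. dist y a < t)"
      using ne[OF x] by (simp add: infdist_notempty) (subst cINF_less_iff, auto intro: bdd_belowI2[of _ 0])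
    then show "infdist y (G x) < t \<longleftrightarrow> G x \<inter> ball y t \<noteq> {}" by auto
  qed
  then show "{x \<in> space M. infdist y (G x) < t} \<in> sets M" using m[of "ball y t"] by simp
qed

lemma borel_measurable_fst:
  fixes f :: "'a \<Rightarrow> 'b::second_countable_topology \<times> 'c::second_countable_topology"
  assumes "f \<in> borel_measurable M" shows "(\<lambda>x. fst (f x)) \<in> borel_measurable M"
  using measurable_compose[OF assms borel_measurable_continuous_onI[of fst]] by (simp add: continuous_on_fst)

lemma borel_measurable_snd:
  fixes f :: "'a \<Rightarrow> 'b::second_countable_topology \<times> 'c::second_countable_topology"
  assumes "f \<in> borel_measurable M" shows "(\<lambda>x. snd (f x)) \<in> borel_measurable M"
  using measurable_compose[OF assms borel_measurable_continuous_onI[of snd]] by (simp add: continuous_on_snd)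

lemma borel_measurable_snd_diff:
  fixes f g :: "'a \<Rightarrow> 'b::second_countable_topology \<times> 'c::euclidean_space"
  assumes "f \<in> borel_measurable M" "g \<in> borel_measurable M"
  shows "(\<lambda>x. norm (snd (f x) - snd (g x))) \<in> borel_measurable M"
  using measurable_compose[OF borel_measurable_diff[OF assms[THEN borel_measurable_snd]] borel_measurable_norm] .

section \<open>Stability of selections\<close>

context jets
begin

text \<open>Isolates the step in which \<open>p > 1\<close> and \<open>p = 1\<close> differ. Two
  sequences j and k with a common limit are compared, rather than a sequence with its limit, so that
  both halves of the Hausdorff distance are instances.\<close>

definition selection_stable :: "('a \<Rightarrow> 'e \<Rightarrow> (real \<times> 'e) set) \<Rightarrow> bool" where
  "selection_stable G \<longleftrightarrow> (\<forall>j k y r z. r \<in> radii \<longrightarrow>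
     (\<forall>n. j n \<in> borel_measurable M \<and> k n \<in> borel_measurable M \<and>
        z n \<in> measurable_selections M (\<lambda>x. G x (j n x))) \<longrightarrow>
     (AE x in M. \<forall>n. norm (j n x) \<le> r x \<and> norm (k n x) \<le> r x) \<longrightarrow>
     (AE x in M. (\<lambda>n. j n x) \<longlonglongrightarrow> y x \<and> (\<lambda>n. k n x) \<longlonglongrightarrow> y x) \<longrightarrow>
     (\<exists>z'. (\<forall>n. z' n \<in> measurable_selections M (\<lambda>x. G x (k n x))) \<and>
        (\<lambda>n. \<integral>x. \<bar>fst (z n x) - fst (z' n x)\<bar> \<partial>M) \<longlonglongrightarrow> 0 \<and>
        (\<forall>\<epsilon>>0. \<forall>\<^sub>F n in sequentially. \<forall>h\<in>V. N h \<le> 1 \<longrightarrow>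
           (\<integral>x. norm (snd (z n x) - snd (z' n x)) * norm (J h x) \<partial>M) \<le> \<epsilon>)))"

lemma weights_double:
  assumes "k \<in> weights" shows "(\<lambda>x. 2 * k x) \<in> weights"
proof -
  have m: "k \<in> borel_measurable M" "AE x in M. 0 \<le> k x" using assms by (auto simp: weights_def)
  have nn: "AE x in M. 0 \<le> 2 * k x" using m(2) by eventually_elim simp
  consider "p = \<infinity>" | "p \<noteq> \<infinity>" "p = 1" | "p \<noteq> \<infinity>" "p \<noteq> 1" by blast
  then show ?thesis
  proof cases
    case 1 then show ?thesis using assms m nn unfolding weights_def by auto
  next
    case 2
    then obtain K where "AE x in M. k x \<le> K" using assms unfolding weights_def by auto
    then have "AE x in M. 2 * k x \<le> 2 * K" by eventually_elim simp
    then have "\<exists>K. AE x in M. 2 * k x \<le> K" by blast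
    then show ?thesis using 2 m nn unfolding weights_def by auto
  next
    case 3
    let ?q = "enn2real p / (enn2real p - 1)"
    have "integrable M (\<lambda>x. (2 * k x) powr ?q)"
    proof (subst integrable_cong_AE[where g = "\<lambda>x. 2 powr ?q * k x powr ?q"])
      show "AE x in M. (2 * k x) powr ?q = 2 powr ?q * k x powr ?q"
        using m(2) by eventually_elim (simp add: powr_mult)
      show "integrable M (\<lambda>x. 2 powr ?q * k x powr ?q)" using 3 assms unfolding weights_def by auto
    qed (use m in auto)
    then show ?thesis using 3 m nn unfolding weights_def by auto
  qed
qed

end

context jet_multifunction
begin

lemma selection_differences:
  assumes r: "r \<in> radii"
    and b: "AE x in M. \<forall>n :: nat. norm (j n x) \<le> r x \<and> norm (k n x) \<le> r x"
    and z: "\<And>n. z n \<in> measurable_selections M (\<lambda>x. G x (j n x))"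
      "\<And>n. z' n \<in> measurable_selections M (\<lambda>x. G x (k n x))"
  obtains \<beta> \<kappa> where "integrable M \<beta>" "\<kappa> \<in> weights"
    "\<And>n. AE x in M. \<bar>fst (z n x) - fst (z' n x)\<bar> \<le> \<beta> x"
    "\<And>n. AE x in M. norm (snd (z n x) - snd (z' n x)) \<le> \<kappa> x"
proof -
  obtain \<beta> \<kappa> where bk: "integrable M \<beta>" "\<kappa> \<in> weights"
      "AE x in M. \<forall>y. norm y \<le> r x \<longrightarrow> (\<forall>(a, v)\<in>G x y. \<bar>a\<bar> \<le> \<beta> x \<and> norm v \<le> \<kappa> x)"
    using G_controlled[OF r] by blast
  have *: "AE x in M. \<bar>fst (z n x) - fst (z' n x)\<bar> \<le> 2 * \<beta> x \<and> norm (snd (z n x) - snd (z' n x)) \<le> 2 * \<kappa> x" for n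
  proof -
    have "AE x in M. z n x \<in> G x (j n x)" "AE x in M. z' n x \<in> G x (k n x)"
      using z by (auto simp: measurable_selections_def)
    with b bk(3) show ?thesis
    proof eventually_elim
      case (elim x)
      have "norm (j n x) \<le> r x" "norm (k n x) \<le> r x" using elim(1) by auto
      then have "\<bar>fst (z n x)\<bar> \<le> \<beta> x \<and> norm (snd (z n x)) \<le> \<kappa> x" "\<bar>fst (z' n x)\<bar> \<le> \<beta> x \<and> norm (snd (z' n x)) \<le> \<kappa> x"
        using elim by (auto simp: case_prod_unfold)
      then show ?case using norm_triangle_ineq4[of "snd (z n x)" "snd (z' n x)"] by linarith
    qed
  qed
  show ?thesis
  proof (rule that[of "\<lambda>x. 2 * \<beta> x" "\<lambda>x. 2 * \<kappa> x"])
    show "integrable M (\<lambda>x. 2 * \<beta> x)" using bk by simp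
    show "(\<lambda>x. 2 * \<kappa> x) \<in> weights" by (rule weights_double[OF bk(2)])
    show "AE x in M. \<bar>fst (z n x) - fst (z' n x)\<bar> \<le> 2 * \<beta> x" for n using *[of n] by eventually_elim simp
    show "AE x in M. norm (snd (z n x) - snd (z' n x)) \<le> 2 * \<kappa> x" for n using *[of n] by eventually_elim simp
  qed
qed

lemma selection_integral_tendsto_0:
  fixes z z' :: "nat \<Rightarrow> 'a \<Rightarrow> real \<times> 'e"
  assumes z: "\<And>n. z n \<in> borel_measurable M" "\<And>n. z' n \<in> borel_measurable M"
    and \<beta>: "integrable M \<beta>" "\<And>n. AE x in M. \<bar>fst (z n x) - fst (z' n x)\<bar> \<le> \<beta> x"
    and lim: "AE x in M. (\<lambda>n. fst (z n x) - fst (z' n x)) \<longlonglongrightarrow> 0"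
  shows "(\<lambda>n. \<integral>x. \<bar>fst (z n x) - fst (z' n x)\<bar> \<partial>M) \<longlonglongrightarrow> 0"
proof -
  have "(\<lambda>n. \<integral>x. \<bar>fst (z n x) - fst (z' n x)\<bar> \<partial>M) \<longlonglongrightarrow> (\<integral>x. 0 \<partial>M)"
  proof (rule integral_dominated_convergence[OF _ _ \<beta>(1)])
    show "(\<lambda>x. \<bar>fst (z n x) - fst (z' n x)\<bar>) \<in> borel_measurable M" for n
      by (intro borel_measurable_abs borel_measurable_diff borel_measurable_fst z)
    show "AE x in M. (\<lambda>n. \<bar>fst (z n x) - fst (z' n x)\<bar>) \<longlonglongrightarrow> 0"
      using lim by eventually_elim (rule tendsto_rabs_zero)
    show "AE x in M. norm \<bar>fst (z n x) - fst (z' n x)\<bar> \<le> \<beta> x" for n using \<beta>(2)[of n] by simp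
  qed simp
  then show ?thesis by simp
qed

text \<open>The replacement is the pointwise projection of \<open>z n\<close> onto the target set.
  Source and target are both near \<open>G x (y x)\<close>, so the projection error tends to 0
  almost everywhere; \<open>weights_pairing_tendsto_0\<close> makes this uniform over the unit ball,
  and there \<open>1 < p\<close> enters.\<close>

lemma selection_stable_if_p_gt_1:
  assumes p: "1 < p" shows "selection_stable G"
  unfolding selection_stable_def
proof (intro allI impI)
  fix j k :: "nat \<Rightarrow> 'a \<Rightarrow> 'e" and y r z
  assume r: "r \<in> radii"
    and m: "\<forall>n. j n \<in> borel_measurable M \<and> k n \<in> borel_measurable M \<and> z n \<in> measurable_selections M (\<lambda>x. G x (j n x))"
    and b: "AE x in M. \<forall>n. norm (j n x) \<le> r x \<and> norm (k n x) \<le> r x"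
    and lim: "AE x in M. (\<lambda>n. j n x) \<longlonglongrightarrow> y x \<and> (\<lambda>n. k n x) \<longlonglongrightarrow> y x"
  define z' where "z' n x = closest_point (G x (k n x)) (z n x)" for n x
  have zm: "z n \<in> borel_measurable M" for n using m by (auto simp: measurable_selections_def)
  have z': "z' n \<in> measurable_selections M (\<lambda>x. G x (k n x))" for n
    unfolding z'_def[abs_def]
    by (rule compact_convex_map.closest_point_selection[OF compact_convex_map_compose zm]) (use m in auto)
  have z'm: "z' n \<in> borel_measurable M" for n using z' by (auto simp: measurable_selections_def)
  obtain \<beta> \<kappa> where bk: "integrable M \<beta>" "\<kappa> \<in> weights"
    "\<And>n. AE x in M. \<bar>fst (z n x) - fst (z' n x)\<bar> \<le> \<beta> x"
    "\<And>n. AE x in M. norm (snd (z n x) - snd (z' n x)) \<le> \<kappa> x"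
    by (rule selection_differences[OF r b, of z z']) (use m z' in auto)
  have "AE x in M. \<forall>n. z n x \<in> G x (j n x)" using m by (auto simp: measurable_selections_def AE_all_countable)
  with lim AE_space have lim0: "AE x in M. (\<lambda>n. z n x - z' n x) \<longlonglongrightarrow> 0"
  proof eventually_elim
    case (elim x)
    note x = elim(2)
    show ?case
    proof (rule LIMSEQ_I)
      fix \<epsilon> :: real assume "\<epsilon> > 0"
      \<comment> \<open>Continuity at the limit point \<open>y x\<close> compares each moving set
        only with \<open>G x (y x)\<close>, so the comparison of the two moving sets passes through
        it, at \<epsilon> / 2 each way.\<close>
      then obtain \<delta> where \<delta>: "\<delta> > 0" "\<And>w. dist w (y x) < \<delta> \<Longrightarrow> hausdorff_dist dist (G x w) (G x (y x)) < ennreal (\<epsilon> / 2)"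
        using G_continuous[OF x] unfolding hausdorff_continuous_on_def by (meson UNIV_I half_gt_zero)
      have "\<forall>\<^sub>F n in sequentially. dist (j n x) (y x) < \<delta>" "\<forall>\<^sub>F n in sequentially. dist (k n x) (y x) < \<delta>"
        using elim(1) \<delta>(1) by (auto intro: tendstoD)
      then have "\<forall>\<^sub>F n in sequentially. norm (z n x - z' n x - 0) < \<epsilon>"
      proof eventually_elim
        case (elim n)
        obtain a where a: "a \<in> G x (y x)" "dist (z n x) a < \<epsilon> / 2"
          using hausdorff_dist_lessD(1)[OF \<delta>(2)[OF elim(1)]] \<open>\<forall>n. z n x \<in> G x (j n x)\<close> by blast
        obtain b where b: "b \<in> G x (k n x)" "dist b a < \<epsilon> / 2"
          using hausdorff_dist_lessD(2)[OF \<delta>(2)[OF elim(2)] a(1)] by blast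
        have "dist (z n x) (z' n x) \<le> dist (z n x) b"
          unfolding z'_def by (rule closest_point_le[OF compact_imp_closed[OF G_compact[OF x]] b(1)])
        also have "\<dots> < \<epsilon>" using a(2) b(2) dist_triangle[of "z n x" b a] by (simp add: dist_commute)
        finally show ?case by (simp add: dist_norm)
      qed
      then show "\<exists>no. \<forall>n\<ge>no. norm (z n x - z' n x - 0) < \<epsilon>" by (simp add: eventually_sequentially)
    qed
  qed
  have "AE x in M. (\<lambda>n. fst (z n x) - fst (z' n x)) \<longlonglongrightarrow> 0"
    using lim0 by eventually_elim (drule tendsto_fst, simp)
  then have "(\<lambda>n. \<integral>x. \<bar>fst (z n x) - fst (z' n x)\<bar> \<partial>M) \<longlonglongrightarrow> 0"
    by (rule selection_integral_tendsto_0[OF zm z'm bk(1,3)])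
  moreover have "\<forall>\<^sub>F n in sequentially. \<forall>h\<in>V. N h \<le> 1 \<longrightarrow> (\<integral>x. norm (snd (z n x) - snd (z' n x)) * norm (J h x) \<partial>M) \<le> \<epsilon>"
    if "\<epsilon> > 0" for \<epsilon>
  proof (rule weights_pairing_tendsto_0[OF p bk(2) _ _ bk(4) _ that])
    show "(\<lambda>x. norm (snd (z n x) - snd (z' n x))) \<in> borel_measurable M" for n
      by (rule borel_measurable_snd_diff[OF zm z'm])
    show "AE x in M. (\<lambda>n. norm (snd (z n x) - snd (z' n x))) \<longlonglongrightarrow> 0"
      using lim0 by eventually_elim (drule tendsto_snd, simp add: tendsto_norm_zero)
  qed simp
  ultimately show "\<exists>z'. (\<forall>n. z' n \<in> measurable_selections M (\<lambda>x. G x (k n x))) \<and>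
        (\<lambda>n. \<integral>x. \<bar>fst (z n x) - fst (z' n x)\<bar> \<partial>M) \<longlonglongrightarrow> 0 \<and>
        (\<forall>\<epsilon>>0. \<forall>\<^sub>F n in sequentially. \<forall>h\<in>V. N h \<le> 1 \<longrightarrow>
           (\<integral>x. norm (snd (z n x) - snd (z' n x)) * norm (J h x) \<partial>M) \<le> \<epsilon>)"
    using z' by blast
qed

text \<open>For \<open>p = 1\<close> the second components have to be close in \<open>L\<^sup>\<infinity>\<close>. The generators have constant second
  components, so some point of the target set differs from a given one in the first component only;
  stretching the second components before projecting makes their change uniformly small.\<close>

lemma selection_stable_if_finitely_generated:
  fixes F :: "nat \<Rightarrow> 'a \<Rightarrow> 'e \<Rightarrow> real" and v :: "nat \<Rightarrow> 'e"
  assumes p: "p = 1" and I: "finite I"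
    and F: "\<And>i y. i \<in> I \<Longrightarrow> (\<lambda>x. F i x y) \<in> borel_measurable M"
      "\<And>i x. i \<in> I \<Longrightarrow> x \<in> space M \<Longrightarrow> continuous_on UNIV (F i x)"
    and G: "AE x in M. \<forall>y. G x y = convex hull ((\<lambda>i. (F i x y, v i)) ` I)"
  shows "selection_stable G"
  unfolding selection_stable_def
proof (intro allI impI)
  fix j k :: "nat \<Rightarrow> 'a \<Rightarrow> 'e" and y r z
  assume r: "r \<in> radii"
    and m: "\<forall>n. j n \<in> borel_measurable M \<and> k n \<in> borel_measurable M \<and> z n \<in> measurable_selections M (\<lambda>x. G x (j n x))"
    and b: "AE x in M. \<forall>n. norm (j n x) \<le> r x \<and> norm (k n x) \<le> r x"
    and lim: "AE x in M. (\<lambda>n. j n x) \<longlonglongrightarrow> y x \<and> (\<lambda>n. k n x) \<longlonglongrightarrow> y x"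
  have zm: "z n \<in> borel_measurable M" for n using m by (auto simp: measurable_selections_def)
  define gen where "gen = {x \<in> space M. \<forall>y. G x y = convex hull ((\<lambda>i. (F i x y, v i)) ` I)}"
  have AE_gen: "AE x in M. x \<in> gen" using G AE_space by eventually_elim (simp add: gen_def)
  have gen: "x \<in> space M" "G x y = convex hull ((\<lambda>i. (F i x y, v i)) ` I)" if "x \<in> gen" for x y
    using that by (auto simp: gen_def)
  \<comment> \<open>The total change of the generator functions bounds the change of the first
    component of any fixed convex combination of the generators.\<close>
  define \<mu> where "\<mu> n x = (\<Sum>i\<in>I. \<bar>F i x (j n x) - F i x (k n x)\<bar>)" for n x
  have \<mu>m: "\<mu> n \<in> borel_measurable M" for n
    unfolding \<mu>_def[abs_def]
    by (intro borel_measurable_sum borel_measurable_abs borel_measurable_diff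
        borel_measurable_caratheodory_compose[OF F]) (use m in auto)
  have \<mu>0: "0 \<le> \<mu> n x" for n x by (simp add: \<mu>_def sum_nonneg)
  have hit: "\<exists>a. (a, snd w) \<in> G x (k n x) \<and> \<bar>fst w - a\<bar> \<le> \<mu> n x" if x: "x \<in> gen" and w: "w \<in> G x (j n x)" for x n w
  proof -
    \<comment> \<open>Since this set is convex and contains the generators, it contains their hull;
      no explicit convex combination has to be selected.\<close>
    let ?C = "{w. \<exists>a. (a, snd w) \<in> G x (k n x) \<and> \<bar>fst w - a\<bar> \<le> \<mu> n x}"
    have "convex ?C"
    proof (rule convexI)
      fix w w' and s t :: real assume w: "w \<in> ?C" "w' \<in> ?C" and st: "0 \<le> s" "0 \<le> t" "s + t = 1"
      obtain a a' where a: "(a, snd w) \<in> G x (k n x)" "\<bar>fst w - a\<bar> \<le> \<mu> n x"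
        "(a', snd w') \<in> G x (k n x)" "\<bar>fst w' - a'\<bar> \<le> \<mu> n x" using w by blast
      have "s *\<^sub>R (a, snd w) + t *\<^sub>R (a', snd w') \<in> G x (k n x)"
        by (rule convexD[OF G_convex[OF gen(1)[OF x]] a(1,3) st])
      moreover have "\<bar>fst (s *\<^sub>R w + t *\<^sub>R w') - (s * a + t * a')\<bar> \<le> \<mu> n x"
      proof -
        have "fst (s *\<^sub>R w + t *\<^sub>R w') - (s * a + t * a') = s * (fst w - a) + t * (fst w' - a')"
          by (simp add: algebra_simps)
        also have "\<bar>\<dots>\<bar> \<le> s * \<bar>fst w - a\<bar> + t * \<bar>fst w' - a'\<bar>"
          using st abs_triangle_ineq[of "s * (fst w - a)" "t * (fst w' - a')"] by (simp add: abs_mult)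
        also have "\<dots> \<le> s * \<mu> n x + t * \<mu> n x" using st a by (intro add_mono mult_left_mono) auto
        finally show ?thesis using st(3) by (simp flip: distrib_right)
      qed
      ultimately show "s *\<^sub>R w + t *\<^sub>R w' \<in> ?C" by auto
    qed
    moreover have "(\<lambda>i. (F i x (j n x), v i)) ` I \<subseteq> ?C"
    proof
      fix w assume "w \<in> (\<lambda>i. (F i x (j n x), v i)) ` I"
      then obtain i where i: "i \<in> I" "w = (F i x (j n x), v i)" by blast
      have "(F i x (k n x), v i) \<in> G x (k n x)" unfolding gen(2)[OF x] using i(1) by (intro hull_inc) auto
      moreover have "\<bar>F i x (j n x) - F i x (k n x)\<bar> \<le> \<mu> n x"
        unfolding \<mu>_def using i(1) I by (intro member_le_sum) auto
      ultimately show "w \<in> ?C" using i(2) by auto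
    qed
    ultimately have "G x (j n x) \<subseteq> ?C" unfolding gen(2)[OF x] by (intro hull_minimal) auto
    then show ?thesis using w by blast
  qed
  define S :: "nat \<Rightarrow> real \<times> 'e \<Rightarrow> real \<times> 'e" where "S c w = (fst w, real (Suc c) *\<^sub>R snd w)" for c w
  define S' :: "nat \<Rightarrow> real \<times> 'e \<Rightarrow> real \<times> 'e" where "S' c w = (fst w, snd w /\<^sub>R real (Suc c))" for c w
  have SS: "S' c (S c w) = w" "S c (S' c w) = w" for c w by (auto simp: S_def S'_def prod_eq_iff)
  have lin: "linear (S c)" for c by (rule linearI) (auto simp: S_def algebra_simps)
  have Scont: "continuous_on UNIV (S c)" "continuous_on UNIV (S' c)" for c
    unfolding S_def S'_def by (auto intro!: continuous_intros)
  have S'm: "S' c \<in> borel_measurable borel" "S c \<in> borel_measurable borel" for c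
    using Scont by (auto intro: borel_measurable_continuous_onI)
  have ccm: "compact_convex_map M (\<lambda>x. S c ` G x (k n x))" for c n
  proof
    interpret K: compact_convex_map M "\<lambda>x. G x (k n x)" by (rule compact_convex_map_compose) (use m in auto)
    show "S c ` G x (k n x) \<noteq> {}" if "x \<in> space M" for x using K.nonempty[OF that] by simp
    show "compact (S c ` G x (k n x))" if "x \<in> space M" for x
      using K.compact[OF that] continuous_on_subset[OF Scont(1) subset_UNIV] by (rule compact_continuous_image[rotated])
    show "convex (S c ` G x (k n x))" if "x \<in> space M" for x
      using K.convex[OF that] lin by (rule convex_linear_image[rotated])
    show "(\<lambda>x. infdist y (S c ` G x (k n x))) \<in> borel_measurable M" for y
    proof (rule infdist_measurable_if_open_hit_measurable)
      fix U :: "(real \<times> 'e) set" assume U: "open U"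
      have "open (S c -` U)" using Scont(1) U by (simp add: open_vimage)
      from open_hit_measurable[OF K.nonempty K.infdist_measurable this]
      have "{x \<in> space M. G x (k n x) \<inter> S c -` U \<noteq> {}} \<in> sets M" .
      moreover have "{x \<in> space M. G x (k n x) \<inter> S c -` U \<noteq> {}} = {x \<in> space M. S c ` G x (k n x) \<inter> U \<noteq> {}}" by auto
      ultimately show "{x \<in> space M. S c ` G x (k n x) \<inter> U \<noteq> {}} \<in> sets M" by simp
    qed (use K.nonempty in auto)
  qed
  \<comment> \<open>The stretch \<open>Suc (c n x)\<close> is at least
    \<open>\<mu> n x * Suc n\<close>, so an error \<open>\<mu> n x\<close> after stretching means at
    most \<open>1 / Suc n\<close> in the second component. Natural number values keep the choice
    measurable: on each level set of \<open>c n\<close> the stretch is fixed.\<close>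
  define c where "c n x = nat \<lceil>\<mu> n x * real (Suc n)\<rceil>" for n x
  define P where "P n c x = S' c (closest_point (S c ` G x (k n x)) (S c (z n x)))" for n c x
  define z' where "z' n x = P n (c n x) x" for n x
  have Pm: "P n c \<in> borel_measurable M" for n c
    unfolding P_def[abs_def] using measurable_compose[OF zm S'm(2)]
    by (intro measurable_compose[OF compact_convex_map.borel_measurable_closest_point[OF ccm] S'm(1)])
  have cm: "c n \<in> measurable M (count_space UNIV)" for n
    unfolding c_def[abs_def] using \<mu>m by measurable
  have z'm: "z' n \<in> borel_measurable M" for n
    unfolding z'_def[abs_def] using Pm cm by (rule measurable_compose_countable)
  have near: "z' n x \<in> G x (k n x)" "\<bar>fst (z n x) - fst (z' n x)\<bar> \<le> \<mu> n x"
      "norm (snd (z n x) - snd (z' n x)) \<le> 1 / real (Suc n)"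
    if gx: "x \<in> gen" and zx: "z n x \<in> G x (j n x)" for n x
  proof -
    note x = gen(1)[OF gx]
    let ?c = "c n x"
    interpret C: compact_convex_map M "\<lambda>x. S ?c ` G x (k n x)" by (rule ccm)
    have cl: "closed (S ?c ` G x (k n x))" "S ?c ` G x (k n x) \<noteq> {}"
      using C.compact[OF x] C.nonempty[OF x] compact_imp_closed by auto
    have "closest_point (S ?c ` G x (k n x)) (S ?c (z n x)) \<in> S ?c ` G x (k n x)"
      by (rule closest_point_in_set[OF cl])
    then show "z' n x \<in> G x (k n x)" by (auto simp: z'_def P_def SS)
    obtain a where a: "(a, snd (z n x)) \<in> G x (k n x)" "\<bar>fst (z n x) - a\<bar> \<le> \<mu> n x" using hit[OF gx zx] by blast
    have "S ?c (z' n x) = closest_point (S ?c ` G x (k n x)) (S ?c (z n x))" by (simp add: z'_def P_def SS)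
    \<comment> \<open>The competitor shares its second component with \<open>z n x\<close>, so its
      distance is not affected by the stretching and stays at most \<open>\<mu> n x\<close>.\<close>
    then have "dist (S ?c (z n x)) (S ?c (z' n x)) \<le> dist (S ?c (z n x)) (S ?c (a, snd (z n x)))"
      using closest_point_le[OF cl(1), of "S ?c (a, snd (z n x))" "S ?c (z n x)"] a(1) by auto
    also have "\<dots> = \<bar>fst (z n x) - a\<bar>" by (simp add: S_def dist_Pair_Pair dist_real_def)
    finally have d: "dist (S ?c (z n x)) (S ?c (z' n x)) \<le> \<mu> n x" using a(2) by simp
    show "\<bar>fst (z n x) - fst (z' n x)\<bar> \<le> \<mu> n x"
      using d dist_fst_le[of "S ?c (z n x)" "S ?c (z' n x)"] by (simp add: S_def dist_real_def)
    have "real (Suc ?c) * norm (snd (z n x) - snd (z' n x)) \<le> \<mu> n x"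
      using d dist_snd_le[of "S ?c (z n x)" "S ?c (z' n x)"]
      by (simp add: S_def dist_norm flip: scaleR_diff_right)
    also have "\<mu> n x * real (Suc n) \<le> real (Suc ?c)"
      unfolding c_def by (smt (verit) of_nat_Suc real_nat_ceiling_ge)
    then have "\<mu> n x \<le> real (Suc ?c) * (1 / real (Suc n))" by (simp add: field_simps)
    finally have "real (Suc ?c) * norm (snd (z n x) - snd (z' n x)) \<le> real (Suc ?c) * (1 / real (Suc n))" .
    then show "norm (snd (z n x) - snd (z' n x)) \<le> 1 / real (Suc n)" by (rule mult_left_le_imp_le) simp
  qed
  have zAE: "AE x in M. z n x \<in> G x (j n x)" for n using m by (auto simp: measurable_selections_def)
  have z': "z' n \<in> measurable_selections M (\<lambda>x. G x (k n x))" for n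
    unfolding measurable_selections_def using z'm zAE[of n] AE_gen near(1)
    by (auto elim: eventually_elim2)
  obtain \<beta> \<kappa> where bk: "integrable M \<beta>" "\<kappa> \<in> weights"
    "\<And>n. AE x in M. \<bar>fst (z n x) - fst (z' n x)\<bar> \<le> \<beta> x"
    "\<And>n. AE x in M. norm (snd (z n x) - snd (z' n x)) \<le> \<kappa> x"
    by (rule selection_differences[OF r b, of z z']) (use m z' in auto)
  have "AE x in M. \<forall>n. z n x \<in> G x (j n x)" using zAE by (simp add: AE_all_countable)
  with lim AE_gen have "AE x in M. (\<lambda>n. fst (z n x) - fst (z' n x)) \<longlonglongrightarrow> 0"
  proof eventually_elim
    case (elim x)
    have c: "isCont (F i x) (y x)" if "i \<in> I" for i
      using F(2)[OF that gen(1)[OF elim(2)]] by (simp add: continuous_on_eq_continuous_at)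
    have "(\<lambda>n. \<mu> n x) \<longlonglongrightarrow> (\<Sum>i\<in>I. \<bar>F i x (y x) - F i x (y x)\<bar>)"
      unfolding \<mu>_def by (intro tendsto_sum tendsto_rabs tendsto_diff isCont_tendsto_compose[OF c]) (use elim in auto)
    then have "(\<lambda>n. \<mu> n x) \<longlonglongrightarrow> 0" by simp
    then show ?case
      by (rule Lim_null_comparison[rotated]) (use near(2)[OF elim(2)] elim(3) in auto)
  qed
  then have "(\<lambda>n. \<integral>x. \<bar>fst (z n x) - fst (z' n x)\<bar> \<partial>M) \<longlonglongrightarrow> 0"
    by (rule selection_integral_tendsto_0[OF zm z'm bk(1,3)])
  moreover have "\<forall>\<^sub>F n in sequentially. \<forall>h\<in>V. N h \<le> 1 \<longrightarrow> (\<integral>x. norm (snd (z n x) - snd (z' n x)) * norm (J h x) \<partial>M) \<le> \<epsilon>"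
    if "\<epsilon> > 0" for \<epsilon>
  proof -
    have "(\<lambda>n. 1 / real (Suc n) * 2) \<longlonglongrightarrow> 0 * 2" by (intro tendsto_intros LIMSEQ_Suc[OF lim_1_over_n])
    then have "\<forall>\<^sub>F n in sequentially. 1 / real (Suc n) * 2 < \<epsilon>" using that by (intro order_tendstoD) auto
    then show ?thesis
    proof eventually_elim
      case (elim n)
      show ?case
      proof (intro ballI impI)
        fix h assume h: "h \<in> V" "N h \<le> 1"
        have Jh: "integrable M (\<lambda>x. norm (J h x))" "(\<integral>x. norm (J h x) \<partial>M) \<le> 2"
          using J_powr_integrable[OF _ h(1)] J_powr_integral_le[OF _ h(1)] p N_nonneg[OF h(1)] h(2) by auto
        have le: "AE x in M. norm (snd (z n x) - snd (z' n x)) * norm (J h x) \<le> 1 / real (Suc n) * norm (J h x)"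
          using zAE[of n] AE_gen by eventually_elim (intro mult_right_mono near(3), auto)
        have i: "integrable M (\<lambda>x. 1 / real (Suc n) * norm (J h x))" using Jh(1) by (rule integrable_mult_right)
        have "(\<integral>x. norm (snd (z n x) - snd (z' n x)) * norm (J h x) \<partial>M) \<le> (\<integral>x. 1 / real (Suc n) * norm (J h x) \<partial>M)"
        proof (rule integral_mono_AE[OF _ i le])
          show "integrable M (\<lambda>x. norm (snd (z n x) - snd (z' n x)) * norm (J h x))"
          proof (rule Bochner_Integration.integrable_bound[OF i])
            show "(\<lambda>x. norm (snd (z n x) - snd (z' n x)) * norm (J h x)) \<in> borel_measurable M"
              by (intro borel_measurable_times borel_measurable_snd_diff zm z'm Jh(1)[THEN borel_measurable_integrable])
            show "AE x in M. norm (norm (snd (z n x) - snd (z' n x)) * norm (J h x)) \<le> norm (1 / real (Suc n) * norm (J h x))"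
              using le by eventually_elim simp
          qed
        qed
        also have "\<dots> = 1 / real (Suc n) * (\<integral>x. norm (J h x) \<partial>M)" by (rule integral_mult_right_zero)
        also have "\<dots> \<le> 1 / real (Suc n) * 2" using Jh(2) by (intro mult_left_mono) auto
        finally show "(\<integral>x. norm (snd (z n x) - snd (z' n x)) * norm (J h x) \<partial>M) \<le> \<epsilon>" using elim by linarith
      qed
    qed
  qed
  ultimately show "\<exists>z'. (\<forall>n. z' n \<in> measurable_selections M (\<lambda>x. G x (k n x))) \<and>
        (\<lambda>n. \<integral>x. \<bar>fst (z n x) - fst (z' n x)\<bar> \<partial>M) \<longlonglongrightarrow> 0 \<and>
        (\<forall>\<epsilon>>0. \<forall>\<^sub>F n in sequentially. \<forall>h\<in>V. N h \<le> 1 \<longrightarrow>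
           (\<integral>x. norm (snd (z n x) - snd (z' n x)) * norm (J h x) \<partial>M) \<le> \<epsilon>)"
    using z' by blast
qed

text \<open>Stability concerns one selection per index. Applied to selections that violate the claim
  whenever a violating one exists, it yields the estimate for all selections at once.\<close>

lemma selection_stable_uniform:
  assumes stable: "selection_stable G" and r: "r \<in> radii"
    and m: "\<And>n. j n \<in> borel_measurable M" "\<And>n. k n \<in> borel_measurable M"
    and b: "AE x in M. \<forall>n. norm (j n x) \<le> r x \<and> norm (k n x) \<le> r x"
    and lim: "AE x in M. (\<lambda>n. j n x) \<longlonglongrightarrow> y x \<and> (\<lambda>n. k n x) \<longlonglongrightarrow> y x"
    and \<epsilon>: "\<epsilon> > 0"
  shows "\<forall>\<^sub>F n in sequentially. \<forall>z\<in>measurable_selections M (\<lambda>x. G x (j n x)).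
    \<exists>z'\<in>measurable_selections M (\<lambda>x. G x (k n x)).
      (\<integral>x. \<bar>fst (z x) - fst (z' x)\<bar> \<partial>M) \<le> \<epsilon> \<and>
      (\<forall>h\<in>V. N h \<le> 1 \<longrightarrow> (\<integral>x. norm (snd (z x) - snd (z' x)) * norm (J h x) \<partial>M) \<le> \<epsilon>)"
proof -
  define Q where "Q n z \<longleftrightarrow> (\<exists>z'\<in>measurable_selections M (\<lambda>x. G x (k n x)).
      (\<integral>x. \<bar>fst (z x) - fst (z' x)\<bar> \<partial>M) \<le> \<epsilon> \<and>
      (\<forall>h\<in>V. N h \<le> 1 \<longrightarrow> (\<integral>x. norm (snd (z x) - snd (z' x)) * norm (J h x) \<partial>M) \<le> \<epsilon>))" for n z
  have "\<exists>z. z \<in> measurable_selections M (\<lambda>x. G x (j n x)) \<and>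
     ((\<exists>w\<in>measurable_selections M (\<lambda>x. G x (j n x)). \<not> Q n w) \<longrightarrow> \<not> Q n z)" for n
    using compact_convex_map.closest_point_selection[OF compact_convex_map_compose[OF m(1)] borel_measurable_const] by blast
  then obtain z where z: "\<And>n. z n \<in> measurable_selections M (\<lambda>x. G x (j n x))"
     "\<And>n. (\<exists>w\<in>measurable_selections M (\<lambda>x. G x (j n x)). \<not> Q n w) \<Longrightarrow> \<not> Q n (z n)" by metis
  obtain z' where z': "\<And>n. z' n \<in> measurable_selections M (\<lambda>x. G x (k n x))"
    "(\<lambda>n. \<integral>x. \<bar>fst (z n x) - fst (z' n x)\<bar> \<partial>M) \<longlonglongrightarrow> 0"
    "\<And>\<epsilon>. \<epsilon> > 0 \<Longrightarrow> \<forall>\<^sub>F n in sequentially. \<forall>h\<in>V. N h \<le> 1 \<longrightarrow>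
           (\<integral>x. norm (snd (z n x) - snd (z' n x)) * norm (J h x) \<partial>M) \<le> \<epsilon>"
    using stable[unfolded selection_stable_def, rule_format, of r j k z y] r m b lim z(1) by blast
  have "\<forall>\<^sub>F n in sequentially. (\<integral>x. \<bar>fst (z n x) - fst (z' n x)\<bar> \<partial>M) < \<epsilon>"
    by (rule order_tendstoD(2)[OF z'(2) \<epsilon>])
  with z'(3)[OF \<epsilon>] have "\<forall>\<^sub>F n in sequentially. Q n (z n)"
  proof eventually_elim
    case (elim n)
    then show ?case unfolding Q_def using z'(1)[of n] by (intro bexI[of _ "z' n"]) auto
  qed
  then show ?thesis
    unfolding Q_def[symmetric]
  proof eventually_elim
    case (elim n)
    then show ?case using z(2)[of n] by blast
  qed
qed

lemma selection_functionals_near: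
  assumes u: "u \<in> V" and w: "w \<in> V"
    and y: "y \<in> measurable_selections M (\<lambda>x. G x (J u x))"
    and z: "z \<in> measurable_selections M (\<lambda>x. G x (J w x))"
    and le: "(\<integral>x. \<bar>fst (y x) - fst (z x)\<bar> \<partial>M) \<le> \<epsilon>"
      "\<And>h. h \<in> V \<Longrightarrow> N h \<le> 1 \<Longrightarrow> (\<integral>x. norm (snd (y x) - snd (z x)) * norm (J h x) \<partial>M) \<le> \<epsilon>"
  shows "\<bar>(\<integral>x. fst (y x) \<partial>M) - (\<integral>x. fst (z x) \<partial>M)\<bar> \<le> \<epsilon>"
    "\<And>h. h \<in> V \<Longrightarrow> N h \<le> 1 \<Longrightarrow> \<bar>(\<integral>x. snd (y x) \<bullet> J h x \<partial>M) - (\<integral>x. snd (z x) \<bullet> J h x \<partial>M)\<bar> \<le> \<epsilon>"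
proof -
  note iy = integrable_selection_fst[OF u u y] integrable_selection_snd[OF u _ y]
  note iz = integrable_selection_fst[OF w w z] integrable_selection_snd[OF w _ z]
  have "(\<integral>x. fst (y x) \<partial>M) - (\<integral>x. fst (z x) \<partial>M) = (\<integral>x. fst (y x) - fst (z x) \<partial>M)" using iy iz by simp
  then show "\<bar>(\<integral>x. fst (y x) \<partial>M) - (\<integral>x. fst (z x) \<partial>M)\<bar> \<le> \<epsilon>"
    using integral_abs_bound[of M "\<lambda>x. fst (y x) - fst (z x)"] le(1) by linarith
  fix h assume h: "h \<in> V" "N h \<le> 1"
  have ym: "y \<in> borel_measurable M" "z \<in> borel_measurable M" and
    yz: "AE x in M. y x \<in> G x (J u x)" "AE x in M. z x \<in> G x (J w x)"
    using y z by (auto simp: measurable_selections_def)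
  obtain \<beta> k where bk: "k \<in> weights" "AE x in M. \<forall>(a, v)\<in>G x (J u x). \<bar>a\<bar> \<le> \<beta> x \<and> norm v \<le> k x"
    by (rule controlled_at[OF u])
  obtain \<beta>' k' where bk': "k' \<in> weights" "AE x in M. \<forall>(a, v)\<in>G x (J w x). \<bar>a\<bar> \<le> \<beta>' x \<and> norm v \<le> k' x"
    by (rule controlled_at[OF w])
  have ki: "integrable M (\<lambda>x. k x * norm (J h x))" "integrable M (\<lambda>x. k' x * norm (J h x))"
    using weights_pairing[OF bk(1)] weights_pairing[OF bk'(1)] h(1) by metis+
  have i: "integrable M (\<lambda>x. norm (snd (y x) - snd (z x)) * norm (J h x))"
  proof (rule Bochner_Integration.integrable_bound)
    show "integrable M (\<lambda>x. k x * norm (J h x) + k' x * norm (J h x))" using ki by simp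
    have "(\<lambda>x. norm (J h x)) \<in> borel_measurable M" using J_measurable[OF h(1)] by measurable
    then show "(\<lambda>x. norm (snd (y x) - snd (z x)) * norm (J h x)) \<in> borel_measurable M"
      by (rule borel_measurable_times[OF borel_measurable_snd_diff[OF ym]])
    show "AE x in M. norm (norm (snd (y x) - snd (z x)) * norm (J h x)) \<le> norm (k x * norm (J h x) + k' x * norm (J h x))"
      using bk(2) bk'(2) yz
    proof eventually_elim
      case (elim x)
      then have "norm (snd (y x)) \<le> k x" "norm (snd (z x)) \<le> k' x" by (auto simp: case_prod_unfold)
      then have "norm (snd (y x) - snd (z x)) \<le> k x + k' x"
        using norm_triangle_ineq4[of "snd (y x)" "snd (z x)"] by linarith
      then have "norm (snd (y x) - snd (z x)) * norm (J h x) \<le> (k x + k' x) * norm (J h x)"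
        by (rule mult_right_mono) simp
      then show ?case by (simp add: distrib_right)
    qed
  qed
  have "(\<integral>x. snd (y x) \<bullet> J h x \<partial>M) - (\<integral>x. snd (z x) \<bullet> J h x \<partial>M) = (\<integral>x. (snd (y x) - snd (z x)) \<bullet> J h x \<partial>M)"
    using iy(2)[OF h(1)] iz(2)[OF h(1)] by (simp add: inner_diff_left)
  also have "\<bar>\<dots>\<bar> \<le> (\<integral>x. \<bar>(snd (y x) - snd (z x)) \<bullet> J h x\<bar> \<partial>M)"
    using integral_norm_bound[of M "\<lambda>x. (snd (y x) - snd (z x)) \<bullet> J h x"] by simp
  also have "\<dots> \<le> (\<integral>x. norm (snd (y x) - snd (z x)) * norm (J h x) \<partial>M)"
    using iy(2)[OF h(1)] iz(2)[OF h(1)] by (intro integral_mono i Cauchy_Schwarz_ineq2) (auto simp: inner_diff_left)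
  also have "\<dots> \<le> \<epsilon>" by (rule le(2)[OF h])
  finally show "\<bar>(\<integral>x. snd (y x) \<bullet> J h x \<partial>M) - (\<integral>x. snd (z x) \<bullet> J h x \<partial>M)\<bar> \<le> \<epsilon>" .
qed

text \<open>A failure of continuity gives a sequence that can be taken to converge at the rate
  required by \<open>radii_dominating_sequence\<close>. Stability, used with the moving and the
  constant sequence in both orders, bounds the two halves of the Hausdorff distance.\<close>

theorem selection_differential_hausdorff_continuous:
  assumes stable: "selection_stable G"
  shows "hausdorff_continuous_on V (\<lambda>u w. N (u - w)) (real_dual_dist V N) (selection_differential G)"
proof (rule ccontr)
  assume "\<not> ?thesis"
  then obtain u \<epsilon> where u: "u \<in> V" and \<epsilon>: "\<epsilon> > 0" and bad: "\<And>\<delta>. \<delta> > 0 \<Longrightarrow> \<exists>w\<in>V. N (w - u) < \<delta> \<and>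
      \<not> hausdorff_dist (real_dual_dist V N) (selection_differential G w) (selection_differential G u) < ennreal \<epsilon>"
    unfolding hausdorff_continuous_on_def by blast
  have "\<exists>w\<in>V. N (w - u) < (1 / 2) ^ n / 2 \<and>
      \<not> hausdorff_dist (real_dual_dist V N) (selection_differential G w) (selection_differential G u) < ennreal \<epsilon>" for n
    by (rule bad) simp
  then obtain w where w: "\<And>n. w n \<in> V" "\<And>n. N (w n - u) < (1 / 2) ^ n / 2"
      "\<And>n. \<not> hausdorff_dist (real_dual_dist V N) (selection_differential G (w n)) (selection_differential G u) < ennreal \<epsilon>"
    by metis
  obtain r where r: "r \<in> radii" "AE x in M. \<forall>n. norm (J (w n) x) \<le> r x" "AE x in M. norm (J u x) \<le> r x"
    "AE x in M. (\<lambda>n. J (w n) x) \<longlonglongrightarrow> J u x"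
    by (rule radii_dominating_sequence[OF u w(1) less_imp_le[OF w(2)]])
  have b: "AE x in M. \<forall>n :: nat. norm (J (w n) x) \<le> r x \<and> norm (J u x) \<le> r x"
     "AE x in M. \<forall>n :: nat. norm (J u x) \<le> r x \<and> norm (J (w n) x) \<le> r x"
    using r(2,3) by (auto elim: eventually_elim2)
  have l: "AE x in M. (\<lambda>n. J (w n) x) \<longlonglongrightarrow> J u x \<and> (\<lambda>n. J u x) \<longlonglongrightarrow> J u x"
     "AE x in M. (\<lambda>n. J u x) \<longlonglongrightarrow> J u x \<and> (\<lambda>n. J (w n) x) \<longlonglongrightarrow> J u x"
    using r(4) by (auto elim!: eventually_mono)
  \<comment> \<open>The scalar part and the functional part contribute \<epsilon> / 4 each, so the
    Hausdorff distance is at most \<epsilon> / 2, strictly below \<epsilon>.\<close>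
  have e4: "\<epsilon> / 4 > 0" using \<epsilon> by simp
  note Jm = J_measurable[OF w(1)] J_measurable[OF u]
  have "\<forall>\<^sub>F n in sequentially. False"
    using selection_stable_uniform[OF stable r(1) Jm b(1) l(1) e4]
      selection_stable_uniform[OF stable r(1) Jm(2,1) b(2) l(2) e4]
  proof eventually_elim
    case (elim n)
    let ?d = "real_dual_dist V N"
    let ?T = "\<lambda>z. (\<integral>x. fst (z x) \<partial>M, restrict (\<lambda>h. \<integral>x. snd (z x) \<bullet> J h x \<partial>M) V)"
    have A: "\<exists>Y\<in>selection_differential G u. ?d X Y \<le> \<epsilon> / 2" if X: "X \<in> selection_differential G (w n)" for X
    proof -
      obtain y where y: "y \<in> measurable_selections M (\<lambda>x. G x (J (w n) x))" "X = ?T y"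
        using X unfolding selection_differential_eq[OF w(1)] by blast
      obtain z where z: "z \<in> measurable_selections M (\<lambda>x. G x (J u x))"
        "(\<integral>x. \<bar>fst (y x) - fst (z x)\<bar> \<partial>M) \<le> \<epsilon> / 4"
        "\<And>h. h \<in> V \<Longrightarrow> N h \<le> 1 \<Longrightarrow> (\<integral>x. norm (snd (y x) - snd (z x)) * norm (J h x) \<partial>M) \<le> \<epsilon> / 4"
        using elim(1) y(1) by blast
      have "?d X (?T z) \<le> \<epsilon> / 4 + \<epsilon> / 4"
        unfolding y(2) using selection_functionals_near[OF w(1) u y(1) z]
        by (intro real_dual_dist_le[of V N, OF V_zero N_zero]) auto
      moreover have "?T z \<in> selection_differential G u" using z(1) by (auto simp: selection_differential_eq[OF u])
      ultimately show ?thesis by (intro bexI[of _ "?T z"]) auto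
    qed
    have B: "\<exists>X\<in>selection_differential G (w n). ?d X Y \<le> \<epsilon> / 2" if Y: "Y \<in> selection_differential G u" for Y
    proof -
      obtain y where y: "y \<in> measurable_selections M (\<lambda>x. G x (J u x))" "Y = ?T y"
        using Y unfolding selection_differential_eq[OF u] by blast
      obtain z where z: "z \<in> measurable_selections M (\<lambda>x. G x (J (w n) x))"
        "(\<integral>x. \<bar>fst (y x) - fst (z x)\<bar> \<partial>M) \<le> \<epsilon> / 4"
        "\<And>h. h \<in> V \<Longrightarrow> N h \<le> 1 \<Longrightarrow> (\<integral>x. norm (snd (y x) - snd (z x)) * norm (J h x) \<partial>M) \<le> \<epsilon> / 4"
        using elim(2) y(1) by blast
      have "?d (?T z) Y \<le> \<epsilon> / 4 + \<epsilon> / 4"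
        unfolding y(2) using selection_functionals_near[OF u w(1) y(1) z]
        by (intro real_dual_dist_le[of V N, OF V_zero N_zero]) (auto simp: abs_minus_commute)
      moreover have "?T z \<in> selection_differential G (w n)" using z(1) by (auto simp: selection_differential_eq[OF w(1)])
      ultimately show ?thesis by (intro bexI[of _ "?T z"]) auto
    qed
    have "hausdorff_dist ?d (selection_differential G (w n)) (selection_differential G u) \<le> ennreal (\<epsilon> / 2)"
      unfolding hausdorff_dist_def
    proof (intro max.boundedI SUP_least)
      fix X assume "X \<in> selection_differential G (w n)"
      then obtain Y where "Y \<in> selection_differential G u" "?d X Y \<le> \<epsilon> / 2" using A by blast
      then show "(INF Y\<in>selection_differential G u. ennreal (?d X Y)) \<le> ennreal (\<epsilon> / 2)"
        by (intro INF_lower2 ennreal_leI)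
    next
      fix Y assume "Y \<in> selection_differential G u"
      then obtain X where "X \<in> selection_differential G (w n)" "?d X Y \<le> \<epsilon> / 2" using B by blast
      then show "(INF X\<in>selection_differential G (w n). ennreal (?d X Y)) \<le> ennreal (\<epsilon> / 2)"
        by (intro INF_lower2 ennreal_leI)
    qed
    also have "\<dots> < ennreal \<epsilon>" using \<epsilon> by (intro ennreal_lessI) auto
    finally show ?case using w(3)[of n] by blast
  qed
  then show False by simp
qed

end

section \<open>Growth conditions\<close>

lemma sobolev_norm_zero:
  assumes \<Omega>: "open \<Omega>" and p: "1 \<le> p"
  shows "sobolev_norm p \<Omega> (0 :: (real^'d, real^'m) aefun) = 0"
proof -
  let ?M = "lebesgue_on \<Omega>" and ?u = "0 :: (real^'d, real^'m) aefun"
  have s: "?u \<in> sobolev p \<Omega>" by (rule sobolev_zero[OF \<Omega>])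
  have "AE x in ?M. jet \<Omega> ?u x = 0" using sobolev_scaleRI(2)[OF \<Omega> s, of 0] by simp
  then have z: "AE x in ?M. rep_aefun ?u x = 0" "AE x in ?M. weak_gradient \<Omega> ?u x = 0"
    by (auto simp: jet_def prod_eq_iff elim!: eventually_mono)
  have m: "rep_aefun ?u \<in> borel_measurable ?M" "weak_gradient \<Omega> ?u \<in> borel_measurable ?M"
    using s sobolev_weak_gradient_Lp[OF \<Omega> s] by (auto simp: sobolev_def Lp_def)
  have L: "Lp_norm p ?M f = 0" if "AE x in ?M. f x = 0" "f \<in> borel_measurable ?M" for f :: "real^'d \<Rightarrow> 'z::euclidean_space"
  proof (cases "p = \<infinity>")
    case True
    have "{K. 0 \<le> K \<and> (AE x in ?M. norm (f x) \<le> K)} = {0..}"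
      using that(1) by (auto elim: eventually_mono)
    then show ?thesis using True by (simp add: Lp_norm_def)
  next
    case False
    have "(\<integral>x. norm (f x) powr enn2real p \<partial>?M) = (\<integral>x. 0 \<partial>?M)"
      using that by (intro integral_cong_AE) (auto elim!: eventually_mono)
    then show ?thesis using False by (simp add: Lp_norm_def)
  qed
  show ?thesis using L[OF z(1) m(1)] L[OF z(2) m(2)] by (simp add: sobolev_norm_def Let_def)
qed

lemma sobolev_jets:
  assumes \<Omega>: "open (\<Omega> :: (real^'d) set)" and p: "1 \<le> p"
  shows "jets (lebesgue_on \<Omega>) p (sobolev p \<Omega> :: (real^'d, real^'m) aefun set) (sobolev_norm p \<Omega>) (jet \<Omega>)"
proof (intro jets.intro jets_axioms.intro)
  show "sigma_finite_measure (lebesgue_on \<Omega>)"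
  proof (rule sigma_finite_measure_restrict_space)
    \<comment> \<open>A countable cover by Borel sets of finite measure serves the completion as
      well.\<close>
    show "sigma_finite_measure (lebesgue :: (real^'d) measure)"
    proof
      obtain A :: "(real^'d) set set" where A: "countable A" "A \<subseteq> sets lborel" "\<Union>A = space lborel" "\<forall>a\<in>A. emeasure lborel a \<noteq> \<infinity>"
        using lborel.sigma_finite_countable by auto
      then show "\<exists>A. countable A \<and> A \<subseteq> sets lebesgue \<and> \<Union>A = space (lebesgue :: (real^'d) measure) \<and>
          (\<forall>a\<in>A. emeasure lebesgue a \<noteq> \<infinity>)"
        by (intro exI[of _ A]) (auto simp: subset_iff emeasure_completion)
    qed
  qed (use \<Omega> in auto)
  show "AE x in lebesgue_on \<Omega>. norm (jet \<Omega> u x) \<le> 2 * sobolev_norm p \<Omega> u"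
    if "p = \<infinity>" "u \<in> sobolev p \<Omega>" for u :: "(real^'d, real^'m) aefun"
    using jet_infinity_bound[OF \<Omega>] that by simp
qed (use p \<Omega> in \<open>auto simp: sobolev_zero sobolev_norm_zero sobolev_norm_nonneg intro: sobolev_addI sobolev_scaleRI jet_measurable jet_powr_integrable\<close>)

lemma Lp_1_integrable: "f \<in> Lp 1 M \<Longrightarrow> integrable M f" for f :: "'a \<Rightarrow> real"
  by (auto simp: Lp_def integrable_abs_iff)

lemma rpow_mono: "0 \<le> s \<Longrightarrow> 0 \<le> a \<Longrightarrow> a \<le> b \<Longrightarrow> rpow a s \<le> rpow b s"
  by (simp add: rpow_def powr_mono2)

text \<open>Conjugacy is stated in the extended reals, where 1 / 0 is \<infinity> and 1 /
  \<infinity> is 0; the degenerate values of p' are sorted out before passing to real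
  numbers.\<close>

lemma conjugate_exponent_ennreal:
  assumes p: "1 \<le> p" "p < \<infinity>" and p': "1 / p + 1 / p' = (1 :: ennreal)"
  shows "p = 1 \<Longrightarrow> p' = \<infinity>"
    and "p \<noteq> 1 \<Longrightarrow> p' < \<infinity> \<and> enn2real p' = enn2real p / (enn2real p - 1)"
proof -
  obtain P where P: "p = ennreal P" "1 \<le> P" using p by (cases p) auto
  show "p' = \<infinity>" if "p = 1"
  proof -
    have "1 + 1 / p' = 1 + (0 :: ennreal)" using p' that by simp
    then have "1 / p' = 0" by (subst (asm) ennreal_add_left_cancel) auto
    then show ?thesis by (cases p') (auto simp: divide_ennreal ennreal_1[symmetric] simp del: ennreal_1 split: if_splits)
  qed
  show "p' < \<infinity> \<and> enn2real p' = enn2real p / (enn2real p - 1)" if "p \<noteq> 1"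
  proof (cases p')
    case (real Q)
    have P1: "P > 1" using P that by (auto simp: less_le)
    have "Q \<noteq> 0"
    proof
      assume "Q = 0"
      then have "1 / p' = top" using real by simp
      then show False using p' by simp
    qed
    then have Q: "Q > 0" using real by simp
    have "ennreal (1 / P) + ennreal (1 / Q) = 1"
      using p' P Q unfolding real P(1) by (simp add: divide_ennreal flip: ennreal_1)
    then have "ennreal (1 / P + 1 / Q) = ennreal 1" using P Q by (simp add: ennreal_plus)
    then have "1 / P + 1 / Q = 1" using P Q by (subst (asm) ennreal_inj) auto
    then have "Q = P / (P - 1)" using P1 Q by (simp add: field_simps)
    then show ?thesis using real Q P by simp
  next
    case top
    then have "ennreal (1 / P) = ennreal 1" using p' P by (simp add: divide_ennreal flip: ennreal_1)
    then have "P = 1" using P by (subst (asm) ennreal_inj) auto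
    then show ?thesis using that P by simp
  qed
qed

lemma growth_condition_integrable_bound:
  fixes f :: "('d::finite, 'm::finite, real) integrand"
  assumes \<Omega>: "open \<Omega>" and p: "1 \<le> p" and f: "growth_condition p \<Omega> f" and r: "r \<in> jets.radii (lebesgue_on \<Omega>) p"
  obtains \<beta> where "integrable (lebesgue_on \<Omega>) \<beta>"
    "AE x in lebesgue_on \<Omega>. \<forall>y. norm y \<le> r x \<longrightarrow> \<bar>f x (fst y) (snd y)\<bar> \<le> \<beta> x"
proof -
  interpret jets "lebesgue_on \<Omega>" p "sobolev p \<Omega> :: (real^'d, real^'m) aefun set" "sobolev_norm p \<Omega>" "jet \<Omega>"
    by (rule sobolev_jets[OF \<Omega> p])
  show ?thesis
  proof (cases "p = \<infinity>")
    case True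
    then obtain K where K: "AE x in lebesgue_on \<Omega>. r x \<le> K" using r[unfolded radii_def] by auto
    \<comment> \<open>The condition for p = \<infinity> is stated for positive N, while the bound K
      of r may be 0 or negative.\<close>
    have "max 1 K > 0" by simp
    have "\<forall>N>0. \<exists>\<beta>\<in>Lp 1 (lebesgue_on \<Omega>). (AE x in lebesgue_on \<Omega>. 0 \<le> \<beta> x) \<and>
            (AE x in lebesgue_on \<Omega>. \<forall>u \<xi>. max (norm u) (norm \<xi>) \<le> N \<longrightarrow> \<bar>f x u \<xi>\<bar> \<le> \<beta> x)"
      using f unfolding growth_condition_def True by (simp only: less_irrefl if_False)
    from this[rule_format, OF \<open>max 1 K > 0\<close>] obtain \<beta> where \<beta>: "\<beta> \<in> Lp 1 (lebesgue_on \<Omega>)"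
       "AE x in lebesgue_on \<Omega>. \<forall>u \<xi>. max (norm u) (norm \<xi>) \<le> max 1 K \<longrightarrow> \<bar>f x u \<xi>\<bar> \<le> \<beta> x"
      by blast
    have "AE x in lebesgue_on \<Omega>. \<forall>y. norm y \<le> r x \<longrightarrow> \<bar>f x (fst y) (snd y)\<bar> \<le> \<beta> x"
      using \<beta>(2) K
    proof eventually_elim
      case (elim x)
      show ?case
      proof (intro allI impI)
        fix y :: "(real^'m) \<times> (real^'d^'m)" assume "norm y \<le> r x"
        then have "max (norm (fst y)) (norm (snd y)) \<le> max 1 K"
          using elim(2) norm_fst_le[of "fst y" "snd y"] norm_snd_le[of "snd y" "fst y"] by (auto simp: le_max_iff_disj)
        then show "\<bar>f x (fst y) (snd y)\<bar> \<le> \<beta> x" using elim(1) by blast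
      qed
    qed
    then show ?thesis using Lp_1_integrable[OF \<beta>(1)] that by blast
  next
    case False
    then have pf: "p < \<infinity>" by (simp add: top.not_eq_extremum)
    define P where "P = enn2real p"
    have P: "P \<ge> 1" using p_real(1)[OF pf] by (simp add: P_def)
    obtain \<beta> C where \<beta>: "\<beta> \<in> Lp 1 (lebesgue_on \<Omega>)" "C > 0"
      "AE x in lebesgue_on \<Omega>. \<forall>u \<xi>. \<bar>f x u \<xi>\<bar> \<le> \<beta> x + C * (rpow (norm u) P + rpow (norm \<xi>) P)"
      using f pf unfolding growth_condition_def P_def by auto
    have ri: "integrable (lebesgue_on \<Omega>) (\<lambda>x. r x powr P)" using r False unfolding radii_def P_def by auto
    have "AE x in lebesgue_on \<Omega>. \<forall>y. norm y \<le> r x \<longrightarrow> \<bar>f x (fst y) (snd y)\<bar> \<le> \<beta> x + C * (2 * r x powr P)"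
      using \<beta>(3)
    proof eventually_elim
      case (elim x)
      show ?case
      proof (intro allI impI)
        fix y :: "(real^'m) \<times> (real^'d^'m)" assume y: "norm y \<le> r x"
        have "norm (fst y) powr P \<le> r x powr P" "norm (snd y) powr P \<le> r x powr P"
          using y P norm_fst_le[of "fst y" "snd y"] norm_snd_le[of "snd y" "fst y"] by (auto intro!: powr_mono2)
        then have "C * (rpow (norm (fst y)) P + rpow (norm (snd y)) P) \<le> C * (2 * r x powr P)"
          using \<beta>(2) P by (intro mult_left_mono) (auto simp: rpow_def)
        with elim show "\<bar>f x (fst y) (snd y)\<bar> \<le> \<beta> x + C * (2 * r x powr P)" by (meson add_left_mono order_trans)
      qed
    qed
    moreover have "integrable (lebesgue_on \<Omega>) (\<lambda>x. \<beta> x + C * (2 * r x powr P))"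
      using Lp_1_integrable[OF \<beta>(1)] ri by auto
    ultimately show ?thesis using that by blast
  qed
qed

text \<open>Nonemptiness enters because the condition quantifies over pairs from both sets: an empty
  partner would make the bound on the other set vacuous. The conclusion has the form of
  \<open>G_controlled\<close>, for both maps with the same bounds.\<close>

lemma codiff_growth_condition_bound:
  fixes dlo dup :: "('d::finite, 'm::finite, ('d, 'm) triple set) integrand"
  assumes \<Omega>: "open \<Omega>" and p: "1 \<le> p" and g: "codiff_growth_condition p \<Omega> dlo dup"
    and ne: "AE x in lebesgue_on \<Omega>. \<forall>y. dlo x (fst y) (snd y) \<noteq> {} \<and> dup x (fst y) (snd y) \<noteq> {}"
    and r: "r \<in> jets.radii (lebesgue_on \<Omega>) p"
  obtains \<beta> k where "integrable (lebesgue_on \<Omega>) \<beta>" "k \<in> jets.weights (lebesgue_on \<Omega>) p"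
    "AE x in lebesgue_on \<Omega>. \<forall>y. norm y \<le> r x \<longrightarrow>
       (\<forall>(a, v)\<in>dlo x (fst y) (snd y) \<union> dup x (fst y) (snd y). \<bar>a\<bar> \<le> \<beta> x \<and> norm v \<le> k x)"
proof -
  interpret jets "lebesgue_on \<Omega>" p "sobolev p \<Omega> :: (real^'d, real^'m) aefun set" "sobolev_norm p \<Omega>" "jet \<Omega>"
    by (rule sobolev_jets[OF \<Omega> p])
  show ?thesis
  proof (cases "p = \<infinity>")
    case True
    then obtain K where K: "AE x in lebesgue_on \<Omega>. r x \<le> K" using r[unfolded radii_def] by auto
    have "max 1 K > 0" by simp
    have "\<forall>N>0. \<exists>\<beta>\<in>Lp 1 (lebesgue_on \<Omega>). (AE x in lebesgue_on \<Omega>. 0 \<le> \<beta> x) \<and>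
            (AE x in lebesgue_on \<Omega>. \<forall>u \<xi>. max (norm u) (norm \<xi>) \<le> N \<longrightarrow>
               (\<forall>(a, v1, v2)\<in>dlo x u \<xi>. \<forall>(b, w1, w2)\<in>dup x u \<xi>.
                 Max {\<bar>a\<bar>, norm v1, norm v2, \<bar>b\<bar>, norm w1, norm w2} \<le> \<beta> x))"
      using g unfolding codiff_growth_condition_def True by (simp only: less_irrefl if_False)
    from this[rule_format, OF \<open>max 1 K > 0\<close>] obtain \<beta> where \<beta>: "\<beta> \<in> Lp 1 (lebesgue_on \<Omega>)" "AE x in lebesgue_on \<Omega>. 0 \<le> \<beta> x"
       "AE x in lebesgue_on \<Omega>. \<forall>u \<xi>. max (norm u) (norm \<xi>) \<le> max 1 K \<longrightarrow>
               (\<forall>(a, v1, v2)\<in>dlo x u \<xi>. \<forall>(b, w1, w2)\<in>dup x u \<xi>.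
                 Max {\<bar>a\<bar>, norm v1, norm v2, \<bar>b\<bar>, norm w1, norm w2} \<le> \<beta> x)"
      by blast
    have bi: "integrable (lebesgue_on \<Omega>) \<beta>" by (rule Lp_1_integrable[OF \<beta>(1)])
    \<comment> \<open>Twice \<beta>, since the joint covector satisfies |(v1, v2)| \<le> |v1| +
      |v2|.\<close>
    have "(\<lambda>x. 2 * \<beta> x) \<in> weights"
    proof -
      have "AE x in lebesgue_on \<Omega>. 0 \<le> 2 * \<beta> x" using \<beta>(2) by eventually_elim simp
      then show ?thesis unfolding weights_def using True bi by auto
    qed
    moreover have "AE x in lebesgue_on \<Omega>. \<forall>y. norm y \<le> r x \<longrightarrow>
         (\<forall>(a, v)\<in>dlo x (fst y) (snd y) \<union> dup x (fst y) (snd y). \<bar>a\<bar> \<le> \<beta> x \<and> norm v \<le> 2 * \<beta> x)"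
      using \<beta>(3) K ne
    proof eventually_elim
      case (elim x)
      show ?case
      proof (intro allI impI ballI, clarify)
        fix u \<xi> a v1 v2 assume "norm (u :: real^'m, \<xi> :: real^'d^'m) \<le> r x"
          and av: "(a, v1, v2) \<in> dlo x (fst (u, \<xi>)) (snd (u, \<xi>)) \<union> dup x (fst (u, \<xi>)) (snd (u, \<xi>))"
        then have "max (norm u) (norm \<xi>) \<le> max 1 K"
          using elim(2) norm_fst_le[of u \<xi>] norm_snd_le[of \<xi> u] by (auto simp: le_max_iff_disj)
        then have bnd: "max (norm u) (norm \<xi>) \<le> max 1 K" .
        define R where "R z \<longleftrightarrow> \<bar>fst z\<bar> \<le> \<beta> x \<and> norm (fst (snd z)) \<le> \<beta> x \<and> norm (snd (snd z)) \<le> \<beta> x"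
          for z :: "('d, 'm) triple"
        have "R z \<and> R w" if z: "z \<in> dlo x u \<xi>" and w: "w \<in> dup x u \<xi>" for z w
        proof -
          obtain a v1 v2 where z': "z = (a, v1, v2)" by (rule prod_cases3)
          obtain b w1 w2 where w': "w = (b, w1, w2)" by (rule prod_cases3)
          have "\<forall>(a, v1, v2)\<in>dlo x u \<xi>. \<forall>(b, w1, w2)\<in>dup x u \<xi>. Max {\<bar>a\<bar>, norm v1, norm v2, \<bar>b\<bar>, norm w1, norm w2} \<le> \<beta> x"
            using elim(1) bnd by blast
          from bspec[OF this z] have "\<forall>(b, w1, w2)\<in>dup x u \<xi>. Max {\<bar>a\<bar>, norm v1, norm v2, \<bar>b\<bar>, norm w1, norm w2} \<le> \<beta> x"
            by (simp only: z' prod.case)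
          from bspec[OF this w] show ?thesis by (simp add: R_def z' w')
        qed
        moreover have "dlo x u \<xi> \<noteq> {}" "dup x u \<xi> \<noteq> {}" using elim spec[of _ "(u, \<xi>)"] by auto
        ultimately have "R (a, v1, v2)" using av by auto
        then have "\<bar>a\<bar> \<le> \<beta> x \<and> norm v1 \<le> \<beta> x \<and> norm v2 \<le> \<beta> x" by (simp add: R_def)
        then show "\<bar>a\<bar> \<le> \<beta> x \<and> norm (v1, v2) \<le> 2 * \<beta> x" using norm_Pair_le[of v1 v2] by linarith
      qed
    qed
    ultimately show ?thesis using bi that by blast
  next
    case False
    then have pf: "p < \<infinity>" by (simp add: top.not_eq_extremum)
    define P where "P = enn2real p"
    have P: "P \<ge> 1" using p_real(1)[OF pf] by (simp add: P_def)
    obtain C p' \<beta> \<gamma> where C: "C > 0" and p': "1 / p + 1 / p' = 1"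
      and \<beta>: "\<beta> \<in> Lp 1 (lebesgue_on \<Omega>)" and \<gamma>: "\<gamma> \<in> Lp p' (lebesgue_on \<Omega>)" "AE x in lebesgue_on \<Omega>. 0 \<le> \<gamma> x"
      and bd: "AE x in lebesgue_on \<Omega>. \<forall>u \<xi>. \<forall>(a, v1, v2)\<in>dlo x u \<xi>. \<forall>(b, w1, w2)\<in>dup x u \<xi>.
                 Max {\<bar>a\<bar>, \<bar>b\<bar>} \<le> \<beta> x + C * (rpow (norm u) P + rpow (norm \<xi>) P) \<and>
                 Max {norm v1, norm v2, norm w1, norm w2}
                   \<le> \<gamma> x + C * (rpow (norm u) (P - 1) + rpow (norm \<xi>) (P - 1))"
      using g pf unfolding codiff_growth_condition_def P_def by auto
    have bi: "integrable (lebesgue_on \<Omega>) \<beta>" by (rule Lp_1_integrable[OF \<beta>])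
    have rm: "r \<in> borel_measurable (lebesgue_on \<Omega>)" and r0: "AE x in lebesgue_on \<Omega>. 0 \<le> r x"
      using r by (auto simp: radii_def)
    have ri: "integrable (lebesgue_on \<Omega>) (\<lambda>x. r x powr P)" using r False unfolding radii_def P_def by auto
    \<comment> \<open>Each of v1 and v2 is bounded by
      \<open>\<gamma> x + 2 * C * rpow (r x) (P - 1)\<close>; doubling for the joint norm gives the
      constants 2 and 4.\<close>
    define k where "k x = 2 * \<gamma> x + 4 * C * rpow (r x) (P - 1)" for x
    have \<gamma>m: "\<gamma> \<in> borel_measurable (lebesgue_on \<Omega>)" using \<gamma> by (auto simp: Lp_def)
    have km: "k \<in> borel_measurable (lebesgue_on \<Omega>)"
      unfolding k_def[abs_def] rpow_def using \<gamma>m rm by measurable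
    have rp0: "0 \<le> rpow t s" for t s by (simp add: rpow_def)
    have k0: "AE x in lebesgue_on \<Omega>. 0 \<le> k x"
      using \<gamma>(2) by eventually_elim (use C rp0 in \<open>auto simp: k_def\<close>)
    have "k \<in> weights"
    proof (cases "p = 1")
      case True
      then have "p' = \<infinity>" using conjugate_exponent_ennreal(1)[OF p pf p'] by simp
      then obtain K where "AE x in lebesgue_on \<Omega>. norm (\<gamma> x) \<le> K" using \<gamma>(1) unfolding Lp_def by auto
      \<comment> \<open>For p = 1 the exponent P - 1 is 0, where \<open>rpow\<close> equals 1 also
        at the base 0, so only constants remain.\<close>
      then have "AE x in lebesgue_on \<Omega>. k x \<le> 2 * K + 4 * C"
        by eventually_elim (use True in \<open>auto simp: k_def rpow_def P_def\<close>)
      then have "\<exists>K. AE x in lebesgue_on \<Omega>. k x \<le> K" by blast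
      then show ?thesis unfolding weights_def using True km k0 by auto
    next
      case p1: False
      define Q where "Q = P / (P - 1)"
      have p'Q: "p' < \<infinity>" "enn2real p' = Q" using conjugate_exponent_ennreal(2)[OF p pf p' p1] by (auto simp: Q_def P_def)
      have P1: "P > 1" using p_real(2)[OF pf p1] by (simp add: P_def)
      \<comment> \<open>The identity turns the Q-th power of r^(P - 1) into r^P, which is integrable
        because r is admissible.\<close>
      have Q: "Q > 1" "(P - 1) * Q = P" using P1 by (auto simp: Q_def field_simps)
      have \<gamma>i: "integrable (lebesgue_on \<Omega>) (\<lambda>x. norm (\<gamma> x) powr Q)"
        using \<gamma>(1) p'Q(1) unfolding Lp_def p'Q(2)[symmetric] by (auto split: if_splits)
      have "integrable (lebesgue_on \<Omega>) (\<lambda>x. k x powr Q)"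
      proof (rule Bochner_Integration.integrable_bound)
        show "integrable (lebesgue_on \<Omega>) (\<lambda>x. 2 powr Q * (2 powr Q * norm (\<gamma> x) powr Q + (4 * C) powr Q * r x powr P))"
          using \<gamma>i ri by auto
        show "(\<lambda>x. k x powr Q) \<in> borel_measurable (lebesgue_on \<Omega>)" using km by measurable
        show "AE x in lebesgue_on \<Omega>. norm (k x powr Q) \<le> norm (2 powr Q * (2 powr Q * norm (\<gamma> x) powr Q + (4 * C) powr Q * r x powr P))"
          using \<gamma>(2) r0
        proof eventually_elim
          case (elim x)
          have "k x powr Q \<le> 2 powr Q * ((2 * \<gamma> x) powr Q + (4 * C * rpow (r x) (P - 1)) powr Q)"
            unfolding k_def using elim C rp0 Q by (intro powr_add_le) auto
          also have "\<dots> = 2 powr Q * (2 powr Q * norm (\<gamma> x) powr Q + (4 * C) powr Q * r x powr P)"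
            using elim C P1 Q by (simp add: powr_mult rpow_def powr_powr)
          finally show ?case by simp
        qed
      qed
      then show ?thesis unfolding weights_def using False p1 km k0 by (auto simp: P_def Q_def)
    qed
    moreover have "integrable (lebesgue_on \<Omega>) (\<lambda>x. \<beta> x + C * (2 * r x powr P))" using bi ri by auto
    moreover have "AE x in lebesgue_on \<Omega>. \<forall>y. norm y \<le> r x \<longrightarrow>
         (\<forall>(a, v)\<in>dlo x (fst y) (snd y) \<union> dup x (fst y) (snd y). \<bar>a\<bar> \<le> \<beta> x + C * (2 * r x powr P) \<and> norm v \<le> k x)"
      using bd ne
    proof eventually_elim
      case (elim x)
      show ?case
      proof (intro allI impI ballI, clarify)
        fix u \<xi> a v1 v2 assume y: "norm (u :: real^'m, \<xi> :: real^'d^'m) \<le> r x"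
          and av: "(a, v1, v2) \<in> dlo x (fst (u, \<xi>)) (snd (u, \<xi>)) \<union> dup x (fst (u, \<xi>)) (snd (u, \<xi>))"
        let ?A = "\<beta> x + C * (rpow (norm u) P + rpow (norm \<xi>) P)"
        let ?B = "\<gamma> x + C * (rpow (norm u) (P - 1) + rpow (norm \<xi>) (P - 1))"
        define R where "R z \<longleftrightarrow> \<bar>fst z\<bar> \<le> ?A \<and> norm (fst (snd z)) \<le> ?B \<and> norm (snd (snd z)) \<le> ?B"
          for z :: "('d, 'm) triple"
        have "R z \<and> R w" if z: "z \<in> dlo x u \<xi>" and w: "w \<in> dup x u \<xi>" for z w
        proof -
          obtain a v1 v2 where z': "z = (a, v1, v2)" by (rule prod_cases3)
          obtain b w1 w2 where w': "w = (b, w1, w2)" by (rule prod_cases3)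
          have "\<forall>(a, v1, v2)\<in>dlo x u \<xi>. \<forall>(b, w1, w2)\<in>dup x u \<xi>. Max {\<bar>a\<bar>, \<bar>b\<bar>} \<le> ?A \<and> Max {norm v1, norm v2, norm w1, norm w2} \<le> ?B"
            using elim(1) by blast
          from bspec[OF this z] have "\<forall>(b, w1, w2)\<in>dup x u \<xi>. Max {\<bar>a\<bar>, \<bar>b\<bar>} \<le> ?A \<and> Max {norm v1, norm v2, norm w1, norm w2} \<le> ?B"
            by (simp only: z' prod.case)
          from bspec[OF this w] show ?thesis by (simp add: R_def z' w')
        qed
        moreover have "dlo x u \<xi> \<noteq> {}" "dup x u \<xi> \<noteq> {}" using elim spec[of _ "(u, \<xi>)"] by auto
        ultimately have "R (a, v1, v2)" using av by auto
        then have 1: "\<bar>a\<bar> \<le> ?A \<and> norm v1 \<le> ?B \<and> norm v2 \<le> ?B" by (simp add: R_def)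
        have n: "norm u \<le> r x" "norm \<xi> \<le> r x" using y norm_fst_le[of u \<xi>] norm_snd_le[of \<xi> u] by auto
        have "rpow (norm u) P + rpow (norm \<xi>) P \<le> 2 * r x powr P"
          using rpow_mono[OF _ _ n(1), of P] rpow_mono[OF _ _ n(2), of P] P by (simp add: rpow_def)
        then have A: "?A \<le> \<beta> x + C * (2 * r x powr P)" using C by (intro add_left_mono mult_left_mono) auto
        have "rpow (norm u) (P - 1) + rpow (norm \<xi>) (P - 1) \<le> 2 * rpow (r x) (P - 1)"
          using rpow_mono[OF _ _ n(1), of "P - 1"] rpow_mono[OF _ _ n(2), of "P - 1"] P by simp
        then have "C * (rpow (norm u) (P - 1) + rpow (norm \<xi>) (P - 1)) \<le> C * (2 * rpow (r x) (P - 1))"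
          using C by (intro mult_left_mono) auto
        then have "norm (v1, v2) \<le> k x"
          using 1 norm_Pair_le[of v1 v2] unfolding k_def by linarith
        then show "\<bar>a\<bar> \<le> \<beta> x + C * (2 * r x powr P) \<and> norm (v1, v2) \<le> k x" using 1 A by linarith
      qed
    qed
    ultimately show ?thesis using that by blast
  qed
qed

section \<open>Codifferentials of integral functionals\<close>

lemma AE_imp_null_exception:
  assumes "AE x in M. P x"
  shows "\<exists>Z\<in>null_sets M. \<forall>x\<in>space M. x \<notin> Z \<longrightarrow> P x"
proof -
  from assms obtain Z where "{x \<in> space M. \<not> P x} \<subseteq> Z" "emeasure M Z = 0" "Z \<in> sets M" by (rule AE_E)
  then show ?thesis by (intro bexI[of _ Z]) auto
qed

text \<open>The value on a null set is changed to make the pointwise hypotheses hold everywhere.\<close>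

definition off_set :: "(real^'d) set \<Rightarrow> ('d, 'm, ('d, 'm) triple set) integrand \<Rightarrow>
    real^'d \<Rightarrow> (real^'m) \<times> (real^'d^'m) \<Rightarrow> (real \<times> (real^'m) \<times> (real^'d^'m)) set" where
  "off_set Z D x y = (if x \<in> Z then {0} else D x (fst y) (snd y))"

text \<open>On Z the singleton {0} does not depend on y and satisfies all pointwise requirements;
  the sets of points where an open set is hit are altered only inside the measurable set Z.\<close>

lemma jet_multifunction_off_set:
  fixes D :: "('d::finite, 'm::finite, ('d, 'm) triple set) integrand"
  assumes \<Omega>: "open \<Omega>" and p: "1 \<le> p" and Z: "Z \<in> null_sets (lebesgue_on \<Omega>)"
    and D: "caratheodory_multi \<Omega> D"
    and good: "\<And>x y. x \<in> \<Omega> \<Longrightarrow> x \<notin> Z \<Longrightarrow> D x (fst y) (snd y) \<noteq> {} \<and> compact (D x (fst y) (snd y)) \<and> convex (D x (fst y) (snd y))"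
      "\<And>x. x \<in> \<Omega> \<Longrightarrow> x \<notin> Z \<Longrightarrow> hausdorff_continuous_on UNIV dist dist (\<lambda>(u, \<xi>). D x u \<xi>)"
    and bound: "\<And>r. r \<in> jets.radii (lebesgue_on \<Omega>) p \<Longrightarrow>
      \<exists>\<beta> k. integrable (lebesgue_on \<Omega>) \<beta> \<and> k \<in> jets.weights (lebesgue_on \<Omega>) p \<and>
        (AE x in lebesgue_on \<Omega>. \<forall>y. norm y \<le> r x \<longrightarrow> (\<forall>(a, v)\<in>D x (fst y) (snd y). \<bar>a\<bar> \<le> \<beta> x \<and> norm v \<le> k x))"
  shows "jet_multifunction (lebesgue_on \<Omega>) p (sobolev p \<Omega> :: (real^'d, real^'m) aefun set)
    (sobolev_norm p \<Omega>) (jet \<Omega>) (off_set Z D)"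
proof -
  interpret jets "lebesgue_on \<Omega>" p "sobolev p \<Omega> :: (real^'d, real^'m) aefun set" "sobolev_norm p \<Omega>" "jet \<Omega>"
    by (rule sobolev_jets[OF \<Omega> p])
  have Zs: "Z \<in> sets (lebesgue_on \<Omega>)" using Z by auto
  have AEZ: "AE x in lebesgue_on \<Omega>. x \<notin> Z" using Z by (rule AE_not_in)
  have ne: "off_set Z D x y \<noteq> {}" if "x \<in> space (lebesgue_on \<Omega>)" for x y
    using good(1)[of x y] that by (auto simp: off_set_def)
  show ?thesis
  proof
    fix x y assume x: "x \<in> space (lebesgue_on \<Omega>)"
    show "off_set Z D x y \<noteq> {}" by (rule ne[OF x])
    show "compact (off_set Z D x y)" "convex (off_set Z D x y)"
      using good(1)[of x y] x by (auto simp: off_set_def)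
  next
    fix x assume x: "x \<in> space (lebesgue_on \<Omega>)"
    show "hausdorff_continuous_on UNIV dist dist (off_set Z D x)"
    proof (cases "x \<in> Z")
      case True
      then have "off_set Z D x = (\<lambda>y. {0})" by (auto simp: off_set_def)
      then show ?thesis by (auto simp: hausdorff_continuous_on_def hausdorff_dist_def intro: exI[of _ 1])
    next
      case False
      then have "off_set Z D x = (\<lambda>(u, \<xi>). D x u \<xi>)" by (auto simp: off_set_def fun_eq_iff)
      then show ?thesis using good(2)[of x] x False by simp
    qed
  next
    fix z y
    show "(\<lambda>x. infdist z (off_set Z D x y)) \<in> borel_measurable (lebesgue_on \<Omega>)"
    proof (rule infdist_measurable_if_open_hit_measurable[OF ne])
      fix U :: "('d, 'm) triple set" assume "open U"
      then have "{x \<in> space (lebesgue_on \<Omega>). D x (fst y) (snd y) \<inter> U \<noteq> {}} \<in> sets (lebesgue_on \<Omega>)"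
        using D by (auto simp: caratheodory_multi_def measurable_multifunction_def)
      then have "({x \<in> space (lebesgue_on \<Omega>). D x (fst y) (snd y) \<inter> U \<noteq> {}} - Z) \<union> (if 0 \<in> U then Z else {})
          \<in> sets (lebesgue_on \<Omega>)" using Zs by auto
      moreover have "{x \<in> space (lebesgue_on \<Omega>). off_set Z D x y \<inter> U \<noteq> {}}
          = ({x \<in> space (lebesgue_on \<Omega>). D x (fst y) (snd y) \<inter> U \<noteq> {}} - Z) \<union> (if 0 \<in> U then Z else {})"
        using sets.sets_into_space[OF Zs] by (auto simp: off_set_def split: if_splits)
      ultimately show "{x \<in> space (lebesgue_on \<Omega>). off_set Z D x y \<inter> U \<noteq> {}} \<in> sets (lebesgue_on \<Omega>)" by simp
    qed
  next
    fix r assume "r \<in> radii"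
    from bound[OF this] obtain \<beta> k where *: "integrable (lebesgue_on \<Omega>) \<beta>" "k \<in> weights"
      "AE x in lebesgue_on \<Omega>. \<forall>y. norm y \<le> r x \<longrightarrow> (\<forall>(a, v)\<in>D x (fst y) (snd y). \<bar>a\<bar> \<le> \<beta> x \<and> norm v \<le> k x)"
      by blast
    have "AE x in lebesgue_on \<Omega>. \<forall>y. norm y \<le> r x \<longrightarrow> (\<forall>(a, v)\<in>off_set Z D x y. \<bar>a\<bar> \<le> \<beta> x \<and> norm v \<le> k x)"
      using *(3) AEZ by eventually_elim (simp add: off_set_def)
    with * show "\<exists>\<beta> k. integrable (lebesgue_on \<Omega>) \<beta> \<and> k \<in> weights \<and>
      (AE x in lebesgue_on \<Omega>. \<forall>y. norm y \<le> r x \<longrightarrow> (\<forall>(a, v)\<in>off_set Z D x y. \<bar>a\<bar> \<le> \<beta> x \<and> norm v \<le> k x))" by blast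
  qed
qed

text \<open>Selections are subject to almost everywhere membership, so altering the map on a null
  set keeps them; the rest is the packing of three functions into one.\<close>

lemma integral_differential_eq_selection_differential:
  fixes D :: "('d::finite, 'm::finite, ('d, 'm) triple set) integrand" and u :: "(real^'d, real^'m) aefun"
  assumes \<Omega>: "open \<Omega>" and p: "1 \<le> p" and Z: "Z \<in> null_sets (lebesgue_on \<Omega>)"
  shows "integral_differential p \<Omega> D u
    = jets.selection_differential (lebesgue_on \<Omega>) (sobolev p \<Omega>) (sobolev_norm p \<Omega>) (jet \<Omega>) (off_set Z D) u"
proof -
  interpret jets "lebesgue_on \<Omega>" p "sobolev p \<Omega> :: (real^'d, real^'m) aefun set" "sobolev_norm p \<Omega>" "jet \<Omega>"
    by (rule sobolev_jets[OF \<Omega> p])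
  have AEZ: "AE x in lebesgue_on \<Omega>. x \<notin> Z" using Z by (rule AE_not_in)
  have "(AE x in lebesgue_on \<Omega>. z x \<in> off_set Z D x (jet \<Omega> u x))
      \<longleftrightarrow> (AE x in lebesgue_on \<Omega>. z x \<in> D x (rep_aefun u x) (weak_gradient \<Omega> u x))" for z
  proof
    assume "AE x in lebesgue_on \<Omega>. z x \<in> off_set Z D x (jet \<Omega> u x)"
    with AEZ show "AE x in lebesgue_on \<Omega>. z x \<in> D x (rep_aefun u x) (weak_gradient \<Omega> u x)"
      by eventually_elim (simp add: off_set_def jet_def)
  next
    assume "AE x in lebesgue_on \<Omega>. z x \<in> D x (rep_aefun u x) (weak_gradient \<Omega> u x)"
    with AEZ show "AE x in lebesgue_on \<Omega>. z x \<in> off_set Z D x (jet \<Omega> u x)"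
      by eventually_elim (simp add: off_set_def jet_def)
  qed
  then have S: "measurable_selections (lebesgue_on \<Omega>) (\<lambda>x. off_set Z D x (jet \<Omega> u x))
     = measurable_selections (lebesgue_on \<Omega>) (\<lambda>x. D x (rep_aefun u x) (weak_gradient \<Omega> u x))"
    by (simp add: measurable_selections_def)
  have ex: "(\<exists>z\<in>S. P z) \<longleftrightarrow> (\<exists>a v1 v2. (\<lambda>x. (a x, v1 x, v2 x)) \<in> S \<and> P (\<lambda>x. (a x, v1 x, v2 x)))"
    for S and P :: "(real^'d \<Rightarrow> ('d, 'm) triple) \<Rightarrow> bool"
  proof
    assume "\<exists>z\<in>S. P z"
    then obtain z where "z \<in> S" "P z" by blast
    then show "\<exists>a v1 v2. (\<lambda>x. (a x, v1 x, v2 x)) \<in> S \<and> P (\<lambda>x. (a x, v1 x, v2 x))"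
      by (intro exI[of _ "\<lambda>x. fst (z x)"] exI[of _ "\<lambda>x. fst (snd (z x))"] exI[of _ "\<lambda>x. snd (snd (z x))"]) simp
  qed blast
  show ?thesis
    unfolding integral_differential_def selection_differential_def S ex
    by (simp add: jet_def inner_prod_def)
qed

text \<open>Serves the exceptional null set, where the integrand is replaced by 0 and both of its
  differentials by {0}.\<close>

lemma euclidean_codifferential_zero:
  "is_euclidean_codifferential (\<lambda>_. 0) x {0} {0 :: real \<times> 'a::euclidean_space}"
proof -
  have r: "riesz ` {0 :: real \<times> 'a} = {(0, \<lambda>h. 0)}" by (simp add: riesz_def zero_prod_def fun_eq_iff)
  have "(\<lambda>h :: 'a. 0) \<in> dual UNIV norm" by (auto simp: dual_def intro: exI[of _ 0])
  then have "compactin (prod_topology euclideanreal (weak_star UNIV norm)) {(0 :: real, \<lambda>h :: 'a. 0 :: real)}"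
    by (intro finite_imp_compactin) (auto simp: weak_star_def topspace_subtopology)
  then show ?thesis
    unfolding is_euclidean_codifferential_def is_codifferential_def r
    by (auto simp: convex_real_dual_def hypo_fun_def hyper_fun_def restrict_def)
qed

lemma is_codifferential_cong:
  assumes "\<And>u. u \<in> V \<Longrightarrow> F u = F' u" "x \<in> V" "\<And>h c. h \<in> V \<Longrightarrow> x + c *\<^sub>R h \<in> V"
  shows "is_codifferential V N F x A B \<longleftrightarrow> is_codifferential V N F' x A B"
  unfolding is_codifferential_def using assms by simp

lemma borel_measurable_off_null:
  assumes "Z \<in> sets M" "g \<in> borel_measurable M"
  shows "(\<lambda>x. if x \<in> Z then 0 else g x :: real) \<in> borel_measurable M"
  using assms by measurable

text \<open>The generator functions may be discontinuous on a further null set. They are set to 0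
  there, which keeps the hull representation valid almost everywhere.\<close>

lemma finitely_generated_selection_stable:
  fixes D :: "('d::finite, 'm::finite, ('d, 'm) triple set) integrand"
  assumes \<Omega>: "open \<Omega>" and p: "p = 1" and Z: "Z \<in> null_sets (lebesgue_on \<Omega>)"
    and jm: "jet_multifunction (lebesgue_on \<Omega>) p (sobolev p \<Omega> :: (real^'d, real^'m) aefun set)
      (sobolev_norm p \<Omega>) (jet \<Omega>) (off_set Z D)"
    and D: "finitely_generated_form \<Omega> D"
  shows "jets.selection_stable (lebesgue_on \<Omega>) p (sobolev p \<Omega> :: (real^'d, real^'m) aefun set)
      (sobolev_norm p \<Omega>) (jet \<Omega>) (off_set Z D)"
proof -
  interpret jet_multifunction "lebesgue_on \<Omega>" p "sobolev p \<Omega> :: (real^'d, real^'m) aefun set"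
      "sobolev_norm p \<Omega>" "jet \<Omega>" "off_set Z D" by fact
  obtain n :: nat and F :: "nat \<Rightarrow> ('d, 'm, real) integrand" and v1 v2 where
    F: "\<And>i. i \<in> {1..n} \<Longrightarrow> caratheodory \<Omega> (F i)"
    and eq: "AE x in lebesgue_on \<Omega>. \<forall>u \<xi>. D x u \<xi> = convex hull ((\<lambda>i. (F i x u \<xi>, v1 i, v2 i)) ` {1..n})"
    using D unfolding finitely_generated_form_def by blast
  have "AE x in lebesgue_on \<Omega>. \<forall>i\<in>{1..n}. continuous_on UNIV (\<lambda>(u, \<xi>). F i x u \<xi>)"
    using F by (subst AE_ball_countable) (auto simp: caratheodory_def)
  from AE_imp_null_exception[OF this] obtain Y where Y: "Y \<in> null_sets (lebesgue_on \<Omega>)"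
    "\<And>x i. x \<in> space (lebesgue_on \<Omega>) \<Longrightarrow> x \<notin> Y \<Longrightarrow> i \<in> {1..n} \<Longrightarrow> continuous_on UNIV (\<lambda>(u, \<xi>). F i x u \<xi>)"
    by blast
  define F' where "F' i x y = (if x \<in> Y then 0 else F i x (fst y) (snd y))" for i x and y :: "(real^'m) \<times> (real^'d^'m)"
  show ?thesis
  proof (rule selection_stable_if_finitely_generated[OF p, where I = "{1..n}" and F = F' and v = "\<lambda>i. (v1 i, v2 i)"])
    show "(\<lambda>x. F' i x y) \<in> borel_measurable (lebesgue_on \<Omega>)" if "i \<in> {1..n}" for i y
      unfolding F'_def using F[OF that] Y(1) by (intro borel_measurable_off_null) (auto simp: caratheodory_def)
    show "continuous_on UNIV (F' i x)" if "i \<in> {1..n}" "x \<in> space (lebesgue_on \<Omega>)" for i x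
    proof (cases "x \<in> Y")
      case True
      then have "F' i x = (\<lambda>y. 0)" by (auto simp: F'_def)
      then show ?thesis by simp
    next
      case False
      then have "F' i x = (\<lambda>(u, \<xi>). F i x u \<xi>)" by (auto simp: F'_def fun_eq_iff)
      then show ?thesis using Y(2)[OF that(2) False that(1)] by simp
    qed
    show "AE x in lebesgue_on \<Omega>. \<forall>y. off_set Z D x y = convex hull ((\<lambda>i. (F' i x y, v1 i, v2 i)) ` {1..n})"
      using eq AE_not_in[OF Z] AE_not_in[OF Y(1)] by eventually_elim (simp add: off_set_def F'_def)
  qed simp
qed

text \<open>The hypotheses on the integrand hold almost everywhere. Outside one null set Z they hold
  at every point, and the abstract results are applied to the integrand and the maps modified on Z,
  which have the same integrals and the same selections.\<close>

theorem theorem2p3: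
  fixes \<Omega> :: "(real^'d::finite) set"
    and f :: "real^'d \<Rightarrow> real^'m::finite \<Rightarrow> real^'d^'m \<Rightarrow> real"
    and dlo dup :: "real^'d \<Rightarrow> real^'m \<Rightarrow> real^'d^'m \<Rightarrow> (real \<times> (real^'m) \<times> (real^'d^'m)) set"
    and p :: ennreal
  defines "W \<equiv> sobolev p \<Omega> :: (real^'d, real^'m) aefun set"
    and "nrm \<equiv> sobolev_norm p \<Omega> :: (real^'d, real^'m) aefun \<Rightarrow> real"
    and "I \<equiv> int_functional \<Omega> f"
    and "dI_lo \<equiv> integral_differential p \<Omega> dlo"
    and "dI_up \<equiv> integral_differential p \<Omega> dup"
  assumes "open \<Omega>"
    and "1 \<le> p"
    and "codifferentiability_conditions p \<Omega> f dlo dup"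
    and "1 < p \<or> bounded \<Omega> \<and> segment_property \<Omega>"
  shows "correctly_defined p \<Omega> f \<and>
    (\<forall>u\<in>W. codifferentiable_at W nrm I u \<and> is_codifferential W nrm I u (dI_lo u) (dI_up u)) \<and>
    (1 < p \<or> finitely_generated_form \<Omega> dlo \<and> finitely_generated_form \<Omega> dup \<longrightarrow>
      hausdorff_continuous_on W (\<lambda>u w. nrm (u - w)) (real_dual_dist W nrm) dI_lo \<and>
      hausdorff_continuous_on W (\<lambda>u w. nrm (u - w)) (real_dual_dist W nrm) dI_up \<and>
      continuously_codifferentiable_on W nrm W I)"
proof -
  note \<Omega> = \<open>open \<Omega>\<close> and p = \<open>1 \<le> p\<close>
  interpret jets "lebesgue_on \<Omega>" p W nrm "jet \<Omega>" unfolding W_def nrm_def by (rule sobolev_jets[OF \<Omega> p])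
  let ?M = "lebesgue_on \<Omega>"
  have f: "caratheodory \<Omega> f" "growth_condition p \<Omega> f"
    and cod: "AE x in ?M. \<forall>u \<xi>. is_euclidean_codifferential (\<lambda>(u, \<xi>). f x u \<xi>) (u, \<xi>) (dlo x u \<xi>) (dup x u \<xi>)"
    and cm: "caratheodory_multi \<Omega> dlo" "caratheodory_multi \<Omega> dup"
    and cg: "codiff_growth_condition p \<Omega> dlo dup"
    using assms(8) by (auto simp: codifferentiability_conditions_def)
  define good where "good x \<longleftrightarrow> continuous_on UNIV (\<lambda>(u, \<xi>). f x u \<xi>) \<and>
     (\<forall>u \<xi>. is_euclidean_codifferential (\<lambda>(u, \<xi>). f x u \<xi>) (u, \<xi>) (dlo x u \<xi>) (dup x u \<xi>)) \<and>
     hausdorff_continuous_on UNIV dist dist (\<lambda>(u, \<xi>). dlo x u \<xi>) \<and>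
     hausdorff_continuous_on UNIV dist dist (\<lambda>(u, \<xi>). dup x u \<xi>)" for x
  have "AE x in ?M. good x"
    using f(1) cod cm unfolding good_def caratheodory_def caratheodory_multi_def by (auto simp: AE_conj_iff)
  from AE_imp_null_exception[OF this] obtain Z where Z: "Z \<in> null_sets ?M" "\<And>x. x \<in> \<Omega> \<Longrightarrow> x \<notin> Z \<Longrightarrow> good x"
    by auto
  have AEZ: "AE x in ?M. x \<notin> Z" by (rule AE_not_in[OF Z(1)])
  have gcod: "is_euclidean_codifferential (\<lambda>(u, \<xi>). f x u \<xi>) y (dlo x (fst y) (snd y)) (dup x (fst y) (snd y))"
    if "x \<in> \<Omega>" "x \<notin> Z" for x y
    using Z(2)[OF that] by (cases y) (simp add: good_def)
  have ne: "AE x in ?M. \<forall>y. dlo x (fst y) (snd y) \<noteq> {} \<and> dup x (fst y) (snd y) \<noteq> {}"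
    using cod by eventually_elim (use euclidean_codifferentialD(1,4) in blast)
  define f' where "f' x y = (if x \<in> Z then 0 else f x (fst y) (snd y))" for x y
  have bound: "\<exists>\<beta> k. integrable ?M \<beta> \<and> k \<in> weights \<and> (AE x in ?M. \<forall>y. norm y \<le> r x \<longrightarrow>
       (\<forall>(a, v)\<in>dlo x (fst y) (snd y) \<union> dup x (fst y) (snd y). \<bar>a\<bar> \<le> \<beta> x \<and> norm v \<le> k x))"
    if "r \<in> radii" for r
    by (rule codiff_growth_condition_bound[OF \<Omega> p cg ne that]) blast
  have lo: "jet_multifunction ?M p W nrm (jet \<Omega>) (off_set Z dlo)"
    unfolding W_def nrm_def
  proof (rule jet_multifunction_off_set[OF \<Omega> p Z(1) cm(1)])
    show "dlo x (fst y) (snd y) \<noteq> {} \<and> compact (dlo x (fst y) (snd y)) \<and> convex (dlo x (fst y) (snd y))"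
      if "x \<in> \<Omega>" "x \<notin> Z" for x y using euclidean_codifferentialD(1-3)[OF gcod[OF that]] by blast
    show "hausdorff_continuous_on UNIV dist dist (\<lambda>(u, \<xi>). dlo x u \<xi>)" if "x \<in> \<Omega>" "x \<notin> Z" for x
      using Z(2)[OF that] by (simp add: good_def)
    fix r assume "r \<in> radii"
    from bound[OF this] show "\<exists>\<beta> k. integrable ?M \<beta> \<and> k \<in> weights \<and> (AE x in ?M. \<forall>y. norm y \<le> r x \<longrightarrow>
       (\<forall>(a, v)\<in>dlo x (fst y) (snd y). \<bar>a\<bar> \<le> \<beta> x \<and> norm v \<le> k x))"
      by (elim exE conjE, intro exI conjI) (assumption, assumption, erule eventually_mono, blast)
  qed
  have up: "jet_multifunction ?M p W nrm (jet \<Omega>) (off_set Z dup)"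
    unfolding W_def nrm_def
  proof (rule jet_multifunction_off_set[OF \<Omega> p Z(1) cm(2)])
    show "dup x (fst y) (snd y) \<noteq> {} \<and> compact (dup x (fst y) (snd y)) \<and> convex (dup x (fst y) (snd y))"
      if "x \<in> \<Omega>" "x \<notin> Z" for x y using euclidean_codifferentialD(4-6)[OF gcod[OF that]] by blast
    show "hausdorff_continuous_on UNIV dist dist (\<lambda>(u, \<xi>). dup x u \<xi>)" if "x \<in> \<Omega>" "x \<notin> Z" for x
      using Z(2)[OF that] by (simp add: good_def)
    fix r assume "r \<in> radii"
    from bound[OF this] show "\<exists>\<beta> k. integrable ?M \<beta> \<and> k \<in> weights \<and> (AE x in ?M. \<forall>y. norm y \<le> r x \<longrightarrow>
       (\<forall>(a, v)\<in>dup x (fst y) (snd y). \<bar>a\<bar> \<le> \<beta> x \<and> norm v \<le> k x))"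
      by (elim exE conjE, intro exI conjI) (assumption, assumption, erule eventually_mono, blast)
  qed
  have f'_meas: "(\<lambda>x. f' x y) \<in> borel_measurable ?M" for y
    unfolding f'_def using f(1) Z(1) by (intro borel_measurable_off_null) (auto simp: caratheodory_def)
  have f'_eq: "f' x = (\<lambda>(u, \<xi>). f x u \<xi>)" if "x \<notin> Z" for x using that by (auto simp: f'_def fun_eq_iff)
  have f'_zero: "f' x = (\<lambda>y. 0)" if "x \<in> Z" for x using that by (auto simp: f'_def)
  have f'_cont: "continuous_on UNIV (f' x)" if "x \<in> space ?M" for x
    using Z(2)[of x] that by (cases "x \<in> Z") (auto simp: f'_eq f'_zero good_def)
  have f'_cod: "is_euclidean_codifferential (f' x) y (off_set Z dlo x y) (off_set Z dup x y)" if "x \<in> space ?M" for x y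
    using gcod[of x y] that
    by (cases "x \<in> Z") (simp_all add: f'_eq f'_zero off_set_def euclidean_codifferential_zero)
  have f'_AE: "AE x in ?M. f' x (jet \<Omega> u x) = f x (rep_aefun u x) (weak_gradient \<Omega> u x)" for u
    using AEZ by eventually_elim (simp add: f'_def jet_def)
  have f'_int: "integrable ?M (\<lambda>x. f' x (jet \<Omega> u x))" if u: "u \<in> W" for u
  proof -
    obtain \<beta> where \<beta>: "integrable ?M \<beta>"
      "AE x in ?M. \<forall>y. norm y \<le> norm (jet \<Omega> u x) \<longrightarrow> \<bar>f x (fst y) (snd y)\<bar> \<le> \<beta> x"
      by (rule growth_condition_integrable_bound[OF \<Omega> p f(2) norm_jet_radii[OF u]])
    show ?thesis
    proof (rule Bochner_Integration.integrable_bound[OF \<beta>(1)])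
      show "(\<lambda>x. f' x (jet \<Omega> u x)) \<in> borel_measurable ?M"
        by (rule borel_measurable_caratheodory_compose[OF f'_meas f'_cont J_measurable[OF u]])
      show "AE x in ?M. norm (f' x (jet \<Omega> u x)) \<le> norm (\<beta> x)"
        using \<beta>(2) AEZ
      proof eventually_elim
        case (elim x)
        then have "\<bar>f x (fst (jet \<Omega> u x)) (snd (jet \<Omega> u x))\<bar> \<le> \<beta> x" by blast
        then show ?case using elim(2) by (simp add: f'_def)
      qed
    qed
  qed
  have fvg: "integrable ?M (\<lambda>x. f x (v x) (g x))" "(\<integral>x. f x (v x) (g x) \<partial>?M) = (\<integral>x. f' x (jet \<Omega> u x) \<partial>?M)"
    if u: "u \<in> W" and v: "AE x in ?M. v x = rep_aefun u x" and g: "is_weak_gradient \<Omega> v g" for u v g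
  proof -
    have "AE x in ?M. g x = weak_gradient \<Omega> u x"
      by (rule weak_gradient_unique[OF \<Omega> g sobolev_weak_gradient[OF \<Omega>] v]) (use u in \<open>simp add: W_def\<close>)
    with v f'_AE[of u] have eq: "AE x in ?M. f' x (jet \<Omega> u x) = f x (v x) (g x)" by eventually_elim simp
    have m: "(\<lambda>x. f x (v x) (g x)) \<in> borel_measurable ?M"
      by (rule borel_measurable_lebesgue_on_AE[OF _ borel_measurable_integrable[OF f'_int[OF u]] eq]) (use \<Omega> in simp)
    show "integrable ?M (\<lambda>x. f x (v x) (g x))" by (rule integrable_cong_AE_imp[OF f'_int[OF u] m eq])
    show "(\<integral>x. f x (v x) (g x) \<partial>?M) = (\<integral>x. f' x (jet \<Omega> u x) \<partial>?M)"
      using eq m borel_measurable_integrable[OF f'_int[OF u]] by (intro integral_cong_AE) (auto elim: eventually_mono)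
  qed
  have I: "I u = (\<integral>x. f' x (jet \<Omega> u x) \<partial>?M)" if u: "u \<in> W" for u
    unfolding I_def int_functional_def
    by (rule fvg(2)[OF u _ sobolev_weak_gradient[OF \<Omega>]]) (use u in \<open>auto simp: W_def\<close>)
  have correct: "correctly_defined p \<Omega> f"
    unfolding correctly_defined_def using fvg I by (auto simp: W_def I_def)
  have dI: "dI_lo u = selection_differential (off_set Z dlo) u" "dI_up u = selection_differential (off_set Z dup) u" for u
    unfolding dI_lo_def dI_up_def W_def nrm_def
    by (rule integral_differential_eq_selection_differential[OF \<Omega> p Z(1)])+
  have codiff: "is_codifferential W nrm I u (dI_lo u) (dI_up u)" if u: "u \<in> W" for u
  proof -
    have "is_codifferential W nrm (\<lambda>u. \<integral>x. f' x (jet \<Omega> u x) \<partial>?M) u (dI_lo u) (dI_up u)"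
      unfolding dI by (rule selection_differential_codifferential[OF lo up f'_meas f'_cont f'_cod f'_int u])
    then show ?thesis
      using is_codifferential_cong[of W I "\<lambda>u. \<integral>x. f' x (jet \<Omega> u x) \<partial>?M" u] I u V_add V_scaleR by blast
  qed
  have haus: "hausdorff_continuous_on W (\<lambda>u w. nrm (u - w)) (real_dual_dist W nrm) dI_lo \<and>
      hausdorff_continuous_on W (\<lambda>u w. nrm (u - w)) (real_dual_dist W nrm) dI_up"
    if c: "1 < p \<or> finitely_generated_form \<Omega> dlo \<and> finitely_generated_form \<Omega> dup"
  proof -
    have "selection_stable (off_set Z dlo) \<and> selection_stable (off_set Z dup)"
    proof (cases "1 < p")
      case True
      then show ?thesis using jet_multifunction.selection_stable_if_p_gt_1 lo up by blast
    next
      case False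
      then have "p = 1" using p by simp
      then show ?thesis
        using finitely_generated_selection_stable[OF \<Omega> _ Z(1)] lo up c False unfolding W_def nrm_def by blast
    qed
    then have "hausdorff_continuous_on W (\<lambda>u w. nrm (u - w)) (real_dual_dist W nrm) (selection_differential (off_set Z dlo)) \<and>
      hausdorff_continuous_on W (\<lambda>u w. nrm (u - w)) (real_dual_dist W nrm) (selection_differential (off_set Z dup))"
      using jet_multifunction.selection_differential_hausdorff_continuous lo up by blast
    moreover have "dI_lo = selection_differential (off_set Z dlo)" "dI_up = selection_differential (off_set Z dup)"
      using dI by auto
    ultimately show ?thesis by (simp only:)
  qed
  show ?thesis
    using correct codiff haus
    unfolding codifferentiable_at_def continuously_codifferentiable_on_def by blast
qed

end
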